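(* Let $q>1$, $q'=q/(q-1)$, $a=(2-q)/(q-1)$, and $\mathbb{R}^{N+}=\{x\in\mathbb{R}^N:x_1>0\}$. There exists a positive classical solution $U$ of (E) in $Q_{\mathbb{R}^N,\infty}$, depending only on $x_1$ and self-similar, of the form $U(x,t)=t^{-a/2}f(t^{-1/2}x_1)$ with $f\in C^2(\mathbb{R})$, $f>0$, which has initial trace $(\overline{\mathbb{R}^{N+}},0)$, and $$\lim_{\eta\to\infty}\eta^{-q'}f(\eta)=c_q:=(q')^{-q'}\Big(\frac1{q-1}\Big)^{\frac1{q-1}},\qquad \lim_{\eta\to-\infty}e^{\eta^2/4}(-\eta)^{-\frac{3-2q}{q-1}}f(\eta)=C>0 .$$ In particular, as $t\to0$, $U(x,t)$ behaves like $c_q x_1^{q'}t^{-1/(q-1)}$ for fixed $x$ with $x_1>0$, $U(x,t)=f(0)t^{-a/2}$ for $x_1=0$, and for fixed $t>0$, $U(x,t)\sim c_q t^{-1/(q-1)}x_1^{q'}$ as $x_1\to\infty$.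
   Context: Equation (E) is $u_t-\Delta u+|\nabla u|^q=0$, $Q_{\mathbb{R}^N,T}=\mathbb{R}^N\times(0,T)$. A classical solution is $u\in C^{2,1}(Q_{\mathbb{R}^N,T})$ satisfying (E) pointwise. A nonnegative solution $u$ has initial trace $(\mathcal{S},u_0)$, where $\mathcal{S}\subset\mathbb{R}^N$ is closed, $\mathcal{R}=\mathbb{R}^N\setminus\mathcal{S}$ and $u_0$ is a nonnegative Radon measure on $\mathcal{R}$, if $\lim_{t\to0}\int_{\mathcal{R}}u(\cdot,t)\psi\,dx=\int_{\mathcal{R}}\psi\,du_0$ for all $\psi\in C_c(\mathcal{R})$ and $\lim_{t\to0}\int_{B(x_0,\varepsilon)}u(\cdot,t)dx=\infty$ for all $x_0\in\mathcal{S}$, $\varepsilon>0$. The trace $(\overline{\mathbb{R}^{N+}},0)$ means $\mathcal{S}=\{x_1\ge0\}$ and $u_0=0$ on $\{x_1<0\}$. *)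

theory Defs
  imports "HOL-Analysis.Analysis"
begin

definition classical_solution ::
  "real \<Rightarrow> ((real^'n::finite) \<times> real) set \<Rightarrow> ((real^'n::finite) \<times> real \<Rightarrow> real) \<Rightarrow> bool" where
  "classical_solution q Q u \<longleftrightarrow>
     (\<exists>ut ux uxx.
        continuous_on Q u \<and> continuous_on Q ut \<and>
        (\<forall>i. continuous_on Q (ux i)) \<and> (\<forall>i j. continuous_on Q (uxx i j)) \<and>
        (\<forall>x t. (x, t) \<in> Q \<longrightarrow>
           ((\<lambda>s. u (x, s)) has_real_derivative ut (x, t)) (at t) \<and>
           (\<forall>i. ((\<lambda>h. u (x + h *\<^sub>R axis i 1, t)) has_real_derivative ux i (x, t)) (at 0)) \<and>
           (\<forall>i j. ((\<lambda>h. ux i (x + h *\<^sub>R axis j 1, t)) has_real_derivative uxx i j (x, t)) (at 0)) \<and>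
           ut (x, t) - (\<Sum>i\<in>UNIV. uxx i i (x, t))
             + (sqrt (\<Sum>i\<in>UNIV. (ux i (x, t))\<^sup>2)) powr q = 0))"

text \<open>Initial trace (S, mu) of a nonnegative function u on R^N x (0,T):
  S closed, R = complement of S, mu a measure on R (given as a measure on R^N,
  integrated over R).\<close>

definition has_initial_trace ::
  "((real^'n::finite) \<times> real \<Rightarrow> real) \<Rightarrow> (real^'n::finite) set \<Rightarrow> (real^'n) measure \<Rightarrow> bool" where
  "has_initial_trace u S \<mu> \<longleftrightarrow>
     closed S \<and>
     (\<forall>\<psi>. continuous_on UNIV \<psi> \<and> compact (closure {x. \<psi> x \<noteq> 0})
           \<and> closure {x. \<psi> x \<noteq> 0} \<subseteq> - S \<longrightarrow>
        ((\<lambda>t. \<integral>x\<in>(- S). u (x, t) * \<psi> x \<partial>lborel)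
           \<longlongrightarrow> (\<integral>x\<in>(- S). \<psi> x \<partial>\<mu>)) (at_right 0)) \<and>
     (\<forall>x0\<in>S. \<forall>\<epsilon>>0.
        ((\<lambda>t. \<integral>\<^sup>+ x\<in>ball x0 \<epsilon>. ennreal (u (x, t)) \<partial>lborel) \<longlongrightarrow> \<infinity>) (at_right 0))"

definition C2_real :: "(real \<Rightarrow> real) \<Rightarrow> bool" where
  "C2_real f \<longleftrightarrow> (\<exists>f' f''. (\<forall>x. (f has_real_derivative f' x) (at x)) \<and>
       (\<forall>x. (f' has_real_derivative f'' x) (at x)) \<and> continuous_on UNIV f'')"

end

theory Submission
  imports Defs "HOL-Real_Asymp.Real_Asymp"
begin

text \<open>
  Put b = 1/(q-1). The profile must solve f'' + (x/2) f' + ((b-1)/2) f = (f')^q. Writing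
  f' = exp (b u) turns this into u'' = - b u'^2 - (x/2 - q exp u) u' - 1/2, whose right-hand side
  is increasing in u where u' > 0, so that a comparison principle holds although the equation
  for f has none. If M is the inverse Mills ratio of the normal distribution and
  s^2 = 1/(2b), then for d large the shifts u(x) = ln (A s M(s (x + d))) and u(x) = ln (A s M(s (x - d)))
  with A = 2b/q are a supersolution and a subsolution. Both satisfy exp u = x/q + O(1) at +infinity.
  Shooting for the truncated equation on [-n,n] gives solutions between the two barriers whose
  slope at -n is the one of the Gaussian tail; near -infinity this slope is an attractor as x
  increases, so it persists with an error O(|x|^-3) that is uniform in n. A subsequence converges to
  an entire solution, and f is the integral of exp (b u) from -infinity.
\<close>

section \<open>Calculus on half-lines and comparison\<close>

text \<open>The equation for \<open>u\<close> is the profile equation differentiated once and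
  divided by b f', with q = 1 + 1/b. Differentiation loses a constant of integration; it is
  recovered at the end, since the left-hand side of the profile equation is constant along the
  solution and tends to 0 at -infinity. The barriers originate in the case q = 2: there the
  Hopf-Cole substitution w = exp (- f) makes the profile equation linear, and f' is exactly a scaled
  inverse Mills ratio. For other q the residual of this ansatz is a multiple of 1 - M', which is at
  most a constant times M z - z. A shift by d adds a term proportional to d (M z - z), so a large
  shift to either side fixes the sign of the residual. The barriers determine exp u to leading order
  at +infinity, but near -infinity they drift apart by a factor growing exponentially in |x|, too
  coarse for the constant C. This is why the slope is controlled separately: an error O(|x|^-3) is
  integrable, so the logarithm of f' relative to the expected tail converges.\<close>

lemma negative_barrier:
  fixes v v' :: "real \<Rightarrow> real"
  assumes der: "\<And>t. t \<in> {l..r} \<Longrightarrow> (v has_real_derivative v' t) (at t within {l..r})"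
    and start: "v l < 0"
    and zero: "\<And>t. t \<in> {l..r} \<Longrightarrow> v t = 0 \<Longrightarrow> v' t < 0"
    and t: "t \<in> {l..r}"
  shows "v t < 0"
proof (rule ccontr)
  assume "\<not> v t < 0"
  then have vt: "v t \<ge> 0" by simp
  have cont: "continuous_on {l..r} v"
    by (rule DERIV_continuous_on) (use der in auto)
  \<comment> \<open>The argument looks at the earliest zero \<open>t0\<close>. A negative derivative
    there makes \<open>v\<close> positive just to its left, and the intermediate value theorem then
    yields a still earlier zero.\<close>
  define Z where "Z = {s \<in> {l..t}. v s = 0}"
  have contt: "continuous_on {l..t} v"
    by (rule continuous_on_subset[OF cont]) (use t in auto)
  have "\<exists>s. l \<le> s \<and> s \<le> t \<and> v s = 0"
    by (rule IVT') (use start vt t contt in auto)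
  then have "Z \<noteq> {}" by (auto simp: Z_def)
  moreover have "compact Z"
  proof -
    have "closed Z"
      unfolding Z_def
      using continuous_closed_preimage_constant[OF contt closed_atLeastAtMost, of 0]
      by simp
    moreover have "bounded Z"
      by (rule bounded_subset[OF bounded_closed_interval[of l t]]) (auto simp: Z_def)
    ultimately show ?thesis by (simp add: compact_eq_bounded_closed)
  qed
  ultimately obtain t0 where t0: "t0 \<in> Z" "\<And>s. s \<in> Z \<Longrightarrow> t0 \<le> s"
    using compact_attains_inf by metis
  have t0': "v t0 = 0" "l \<le> t0" "t0 \<le> t" using t0 by (auto simp: Z_def)
  then have "l < t0" using start by (cases "l = t0") auto
  have "v' t0 < 0" using zero t0' t by auto
  with has_real_derivative_neg_dec_left[OF der[of t0]] t0' t
  obtain d where d: "d > 0" "\<And>h. 0 < h \<Longrightarrow> t0 - h \<in> {l..r} \<Longrightarrow> h < d \<Longrightarrow> v t0 < v (t0 - h)"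
    by auto
  define h where "h = min (d/2) (t0 - l)"
  have h: "0 < h" "h < d" "t0 - h \<in> {l..r}"
    using d(1) \<open>l < t0\<close> t0' t by (auto simp: h_def)
  then have vh: "v (t0 - h) > 0" using d(2) t0' by force
  have "\<exists>s. l \<le> s \<and> s \<le> t0 - h \<and> v s = 0"
    by (rule IVT') (use start vh h t0' t in \<open>auto intro!: continuous_on_subset[OF cont]\<close>)
  then obtain s where "l \<le> s" "s \<le> t0 - h" "v s = 0" by auto
  then have "s \<in> Z" using h(1) t0' by (auto simp: Z_def)
  then show False using t0(2)[of s] h(1) \<open>s \<le> t0 - h\<close> by simp
qed

text \<open>At a positive maximum of \<open>w\<close> the slope condition excludes \<open>l\<close>
  and the sign condition excludes \<open>r\<close>; hence \<open>v\<close> vanishes there, and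
  \<open>conv\<close> makes \<open>w\<close> increase to the right of its maximum. Testing only
  points with \<open>v t = 0\<close> keeps first-order terms out of the comparison. The mixed
  boundary conditions are those of the shooting problem: slope on the left, value on the
  right.\<close>

lemma maximum_principle:
  fixes w v v' :: "real \<Rightarrow> real"
  assumes dw: "\<And>t. t \<in> {l..r} \<Longrightarrow> (w has_real_derivative v t) (at t within {l..r})"
    and dv: "\<And>t. t \<in> {l..r} \<Longrightarrow> (v has_real_derivative v' t) (at t within {l..r})"
    and left: "v l > 0" and right: "w r \<le> 0"
    and conv: "\<And>t. t \<in> {l..r} \<Longrightarrow> w t > 0 \<Longrightarrow> v t = 0 \<Longrightarrow> v' t > 0"
    and t: "t \<in> {l..r}"
  shows "w t \<le> 0"
proof (rule ccontr)
  assume neg: "\<not> w t \<le> 0"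
  have cont: "continuous_on {l..r} w"
    by (rule DERIV_continuous_on) (use dw in auto)
  obtain m where m: "m \<in> {l..r}" "\<And>s. s \<in> {l..r} \<Longrightarrow> w s \<le> w m"
    using continuous_attains_sup[OF compact_Icc _ cont] t by force
  then have wm: "w m > 0" using neg t by force
  then have mr: "m < r" using right m by (cases "m = r") auto
  have nonpos: "v m \<le> 0"
  proof (rule ccontr)
    assume "\<not> v m \<le> 0"
    then obtain d where d: "d > 0" "\<And>h. 0 < h \<Longrightarrow> m + h \<in> {l..r} \<Longrightarrow> h < d \<Longrightarrow> w m < w (m + h)"
      using has_real_derivative_pos_inc_right[OF dw[OF m(1)]] by auto
    define h where "h = min (d/2) (r - m)"
    have "0 < h" "h < d" "m + h \<in> {l..r}" using d(1) mr m(1) by (auto simp: h_def)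
    then show False using d(2)[of h] m(2)[of "m + h"] by simp
  qed
  then have lm: "l < m" using left m(1) by (cases "l = m") auto
  have nonneg: "v m \<ge> 0"
  proof (rule ccontr)
    assume "\<not> v m \<ge> 0"
    then obtain d where d: "d > 0" "\<And>h. 0 < h \<Longrightarrow> m - h \<in> {l..r} \<Longrightarrow> h < d \<Longrightarrow> w m < w (m - h)"
      using has_real_derivative_neg_dec_left[OF dw[OF m(1)]] by auto
    define h where "h = min (d/2) (m - l)"
    have "0 < h" "h < d" "m - h \<in> {l..r}" using d(1) lm m(1) by (auto simp: h_def)
    then show False using d(2)[of h] m(2)[of "m - h"] by simp
  qed
  have vm: "v m = 0" using nonpos nonneg by simp
  then obtain d where d: "d > 0" "\<And>h. 0 < h \<Longrightarrow> m + h \<in> {l..r} \<Longrightarrow> h < d \<Longrightarrow> v m < v (m + h)"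
    using has_real_derivative_pos_inc_right[OF dv[OF m(1)]] conv[OF m(1) wm] by auto
  define h where "h = min (d/2) (r - m)"
  have h: "0 < h" "h < d" "m + h \<in> {l..r}" using d(1) mr m(1) by (auto simp: h_def)
  have "w m < w (m + h)"
  proof (rule DERIV_pos_imp_increasing_open[of m "m + h" w])
    show "continuous_on {m..m + h} w"
      by (rule continuous_on_subset[OF cont]) (use h m in auto)
    fix x assume x: "m < x" "x < m + h"
    then have "(w has_real_derivative v x) (at x)"
      using dw[of x] m(1) h by (simp add: at_within_Icc_at)
    moreover have "v x > 0" using d(2)[of "x - m"] vm x h m(1) by auto
    ultimately show "\<exists>y. (w has_real_derivative y) (at x) \<and> 0 < y" by blast
  qed (use h in simp)
  then show False using m(2)[OF h(3)] by simp
qed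

lemma mono_bounded_tendsto_at_bot:
  fixes f :: "real \<Rightarrow> real"
  assumes mono: "\<And>x y. x \<le> y \<Longrightarrow> y \<le> R \<Longrightarrow> f x \<le> f y"
    and bdd: "\<And>x. x \<le> R \<Longrightarrow> B \<le> f x"
  obtains L where "(f \<longlongrightarrow> L) at_bot" "\<And>x. x \<le> R \<Longrightarrow> L \<le> f x"
proof
  define L where "L = (INF x\<in>{..R}. f x)"
  have bb: "bdd_below (f ` {..R})" using bdd by (auto intro!: bdd_belowI2)
  show le: "L \<le> f x" if "x \<le> R" for x
    unfolding L_def by (rule cINF_lower[OF bb]) (use that in auto)
  show "(f \<longlongrightarrow> L) at_bot"
  proof (rule order_tendstoI)
    fix a assume "a < L"
    show "\<forall>\<^sub>F x in at_bot. a < f x"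
      using eventually_le_at_bot[of R] by eventually_elim (use le \<open>a < L\<close> in fastforce)
  next
    fix a assume "L < a"
    then obtain x0 where x0: "x0 \<le> R" "f x0 < a"
      unfolding L_def using cINF_less_iff[OF _ bb] by auto
    show "\<forall>\<^sub>F x in at_bot. f x < a"
      using eventually_le_at_bot[of x0] by eventually_elim (use mono[of _ x0] x0 in fastforce)
  qed
qed

text \<open>Domination by \<open>K * exp x\<close> stands in for integrability:
  \<open>K * exp x - G x\<close> is nondecreasing for negative arguments, which bounds an
  antiderivative \<open>G\<close> from below, and \<open>f\<close> is \<open>G\<close> minus its
  limit. It serves both the Gaussian integral and the final profile.\<close>

lemma antiderivative_vanishing_at_bot:
  fixes g :: "real \<Rightarrow> real"
  assumes cont: "continuous_on UNIV g" and pos: "\<And>x. g x > 0"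
    and bound: "\<And>x. x \<le> 0 \<Longrightarrow> g x \<le> K * exp x"
  obtains f where "\<And>x. (f has_real_derivative g x) (at x)" "(f \<longlongrightarrow> 0) at_bot"
    "\<And>x. f x > 0" "strict_mono f"
proof -
  have "\<exists>G. \<forall>x. (G has_vector_derivative g x) (at x)"
  proof -
    obtain G where "\<And>x. x \<in> UNIV \<Longrightarrow> (G has_vector_derivative g x) (at x)"
      using einterval_antiderivative[of "-\<infinity>" "\<infinity>" g] cont
      by (auto simp: continuous_on_eq_continuous_at einterval_def)
    then show ?thesis by auto
  qed
  then obtain G where G: "\<And>x. (G has_real_derivative g x) (at x)"
    by (auto simp: has_real_derivative_iff_has_vector_derivative)
  have smono: "G x < G y" if "x < y" for x y
    by (rule DERIV_pos_imp_increasing[OF that]) (use G pos in blast)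
  have cmp: "K * exp x - G x \<le> K * exp y - G y" if "x \<le> y" "y \<le> 0" for x y
    by (rule DERIV_nonneg_imp_nondecreasing[OF that(1)])
       (use bound that in \<open>auto intro!: exI derivative_eq_intros G simp: mult.commute\<close>)
  have "K * exp 0 > 0" using bound[of 0] pos[of 0] by simp
  then have K: "K > 0" by simp
  have low: "G 0 - K \<le> G x" if "x \<le> 0" for x
  proof -
    have "K * exp x > 0" using K by simp
    then show ?thesis using cmp[OF that] by simp
  qed
  have mono: "G x \<le> G y" if "x \<le> y" for x y
    using smono[of x y] that by (cases "x = y") auto
  obtain L where L: "(G \<longlongrightarrow> L) at_bot" "\<And>x. x \<le> 0 \<Longrightarrow> L \<le> G x"
    using mono_bounded_tendsto_at_bot[of 0 G "G 0 - K", OF mono low] by metis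
  have Lle: "L < G x" for x
    using L(2)[of "min x 0 - 1"] smono[of "min x 0 - 1" x] by linarith
  show ?thesis
  proof
    show "((\<lambda>x. G x - L) has_real_derivative g x) (at x)" for x
      by (auto intro!: derivative_eq_intros G)
    show "((\<lambda>x. G x - L) \<longlongrightarrow> 0) at_bot" using tendsto_diff[OF L(1) tendsto_const[of L]] by simp
    show "G x - L > 0" for x using Lle by simp
    show "strict_mono (\<lambda>x. G x - L)" by (auto intro!: strict_monoI smono)
  qed
qed

text \<open>Once f'/W' is within e/2 of \<open>L\<close>, both (L + e/2) W - f and f - (L - e/2) W
  are nondecreasing up to the given point and vanish at -infinity, so they are nonnegative
  (\<open>key\<close>). Dividing by W > 0 gives the limit.\<close>

lemma lhopital_at_bot:
  fixes f W f' W' :: "real \<Rightarrow> real"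
  assumes df: "\<And>x. x \<le> R \<Longrightarrow> (f has_real_derivative f' x) (at x)"
    and dW: "\<And>x. x \<le> R \<Longrightarrow> (W has_real_derivative W' x) (at x)"
    and W': "\<And>x. x \<le> R \<Longrightarrow> W' x > 0"
    and f0: "(f \<longlongrightarrow> 0) at_bot" and W0: "(W \<longlongrightarrow> 0) at_bot"
    and lim: "((\<lambda>x. f' x / W' x) \<longlongrightarrow> L) at_bot"
  shows "((\<lambda>x. f x / W x) \<longlongrightarrow> L) at_bot"
proof -
  have key: "h z \<ge> 0"
    if dh: "\<And>x. x \<le> z \<Longrightarrow> (h has_real_derivative h' x) (at x)"
    and h': "\<And>x. x \<le> z \<Longrightarrow> h' x \<ge> 0" and h0: "(h \<longlongrightarrow> 0) at_bot" for h h' z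
  proof (rule tendsto_upperbound[OF h0])
    show "\<forall>\<^sub>F x in at_bot. h x \<le> h z"
      using eventually_le_at_bot[of z]
      proof eventually_elim
      case (elim x)
      then show ?case
        by (rule DERIV_nonneg_imp_nondecreasing) (use dh h' in blast)
    qed
  qed simp
  have Wpos: "W x > 0" if "x \<le> R" for x
  proof -
    have "W (x - 1) \<ge> 0" by (rule key[of _ W W']) (use dW W' W0 that in \<open>auto intro: less_imp_le\<close>)
    moreover have "W (x - 1) < W x"
      proof (rule DERIV_pos_imp_increasing[of "x - 1" x W])
      fix y assume "y \<le> x"
      then have "y \<le> R" using that by simp
      then show "\<exists>d. (W has_real_derivative d) (at y) \<and> 0 < d" using dW W' by blast
    qed simp
    ultimately show ?thesis by simp
  qed
  show ?thesis
  proof (rule tendstoI)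
    fix e :: real assume e: "e > 0"
    then have "\<forall>\<^sub>F x in at_bot. dist (f' x / W' x) L < e/2"
      using tendstoD[OF lim, of "e/2"] by simp
    then obtain S where S: "\<And>x. x \<le> S \<Longrightarrow> dist (f' x / W' x) L < e/2"
      by (auto simp: eventually_at_bot_linorder)
    define z0 where "z0 = min S R"
    have b1: "f' x \<le> (L + e/2) * W' x" "(L - e/2) * W' x \<le> f' x" if "x \<le> z0" for x
    proof -
      have W: "W' x > 0" using W' that by (simp add: z0_def)
      have "f' x / W' x \<le> L + e/2" "L - e/2 \<le> f' x / W' x"
        using S[of x] that unfolding dist_real_def z0_def by linarith+
      with W show "f' x \<le> (L + e/2) * W' x" "(L - e/2) * W' x \<le> f' x"
        by (simp_all add: pos_divide_le_eq pos_le_divide_eq)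
    qed
    have "\<forall>\<^sub>F z in at_bot. z \<le> z0" by (rule eventually_le_at_bot)
    then show "\<forall>\<^sub>F x in at_bot. dist (f x / W x) L < e"
    proof eventually_elim
      case (elim z)
      have "(L + e/2) * W z - f z \<ge> 0"
      proof (rule key[where h = "\<lambda>x. (L + e/2) * W x - f x" and h' = "\<lambda>x. (L + e/2) * W' x - f' x"])
        show "((\<lambda>x. (L + e/2) * W x - f x) \<longlongrightarrow> 0) at_bot"
          using tendsto_diff[OF tendsto_mult_left[OF W0, of "L + e/2"] f0] by simp
      qed (use b1 elim in \<open>auto intro!: derivative_eq_intros df dW simp: z0_def\<close>)
      moreover have "f z - (L - e/2) * W z \<ge> 0"
      proof (rule key[where h = "\<lambda>x. f x - (L - e/2) * W x" and h' = "\<lambda>x. f' x - (L - e/2) * W' x"])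
        show "((\<lambda>x. f x - (L - e/2) * W x) \<longlongrightarrow> 0) at_bot"
          using tendsto_diff[OF f0 tendsto_mult_left[OF W0, of "L - e/2"]] by simp
      qed (use b1 elim in \<open>auto intro!: derivative_eq_intros df dW simp: z0_def\<close>)
      moreover have W: "W z > 0" using Wpos elim by (auto simp: z0_def)
      ultimately have "f z / W z \<le> L + e/2" "L - e/2 \<le> f z / W z"
        by (auto simp: field_simps)
      then show ?case using e by (auto simp: dist_real_def abs_less_iff)
    qed
  qed
qed

section \<open>Lipschitz ordinary differential equations\<close>

text \<open>Banach's fixed point theorem in the norm weighted by exp (- 2 L t), which makes the
  Picard operator a contraction on intervals of any length.\<close>

lemma lipschitz_ode_solution:
  fixes G :: "real \<Rightarrow> 'a::euclidean_space \<Rightarrow> 'a"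
  assumes cont: "continuous_on UNIV (\<lambda>(t, y). G t y)"
    and lip: "\<And>t y z. norm (G t y - G t z) \<le> L * norm (y - z)"
    and L: "L > 0" and lr: "l \<le> r"
  obtains y where "y l = y0"
    "\<And>t. t \<in> {l..r} \<Longrightarrow> (y has_vector_derivative G t (y t)) (at t within {l..r})"
proof -
  \<comment> \<open>The unknown of the fixed point problem is v = y / w, which turns the weighted
    norm into the plain supremum norm. \<open>cl\<close> freezes time outside \<open>{l..r}\<close>,
    so that \<open>T0 v\<close> is bounded and continuous on the whole line.\<close>
  define cl where "cl = (\<lambda>t. max l (min r t))"
  define w where "w = (\<lambda>t. exp (2 * L * (t - l)))"
  have cl: "cl t \<in> {l..r}" for t using lr by (auto simp: cl_def)
  have clid: "cl t = t" if "t \<in> {l..r}" for t using that by (auto simp: cl_def)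
  have ccl: "continuous_on UNIV cl" unfolding cl_def by (intro continuous_intros)
  define J where "J = (\<lambda>v :: real \<Rightarrow>\<^sub>C 'a. \<lambda>t. integral {l..t} (\<lambda>s. G s (w s *\<^sub>R apply_bcontfun v s)))"
  have cG: "continuous_on S (\<lambda>s. G s (w s *\<^sub>R apply_bcontfun v s))" for v S
  proof -
    have "continuous_on S (\<lambda>s. (s, w s *\<^sub>R apply_bcontfun v s))"
      unfolding w_def by (intro continuous_intros continuous_on_apply_bcontfun)
    from continuous_on_compose2[OF cont this] show ?thesis by simp
  qed
  have Gint: "(\<lambda>s. G s (w s *\<^sub>R apply_bcontfun v s)) integrable_on {l..t}" for v t
    by (rule integrable_continuous_interval[OF cG])
  define T0 where "T0 = (\<lambda>v :: real \<Rightarrow>\<^sub>C 'a. \<lambda>t. (1 / w (cl t)) *\<^sub>R (y0 + J v (cl t)))"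
  have T0b: "T0 v \<in> bcontfun" for v
  proof -
    have cJ: "continuous_on {l..r} (J v)"
      unfolding J_def by (rule indefinite_integral_continuous_1[OF Gint])
    have c: "continuous_on {l..r} (\<lambda>t. (1 / w t) *\<^sub>R (y0 + J v t))"
      unfolding w_def by (intro continuous_intros cJ) auto
    then have "bounded ((\<lambda>t. (1 / w t) *\<^sub>R (y0 + J v t)) ` {l..r})"
      by (intro compact_imp_bounded compact_continuous_image) auto
    then obtain B where B: "\<And>t. t \<in> {l..r} \<Longrightarrow> norm ((1 / w t) *\<^sub>R (y0 + J v t)) \<le> B"
      unfolding bounded_iff by blast
    have "continuous_on UNIV (T0 v)"
      unfolding T0_def by (rule continuous_on_compose2[OF c ccl]) (use cl in auto)
    then show ?thesis
      by (rule bcontfun_normI[where b = B]) (use B cl in \<open>auto simp: T0_def\<close>)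
  qed
  define T where "T = (\<lambda>v. Bcontfun (T0 v))"
  have T: "apply_bcontfun (T v) = T0 v" for v
    unfolding T_def using Bcontfun_inverse[OF T0b] .
  have contr: "dist (T v1) (T v2) \<le> 1/2 * dist v1 v2" for v1 v2
  proof (rule dist_bound)
    fix t
    define s where "s = cl t"
    have s: "s \<in> {l..r}" using cl by (simp add: s_def)
    have wpos: "w x > 0" for x by (simp add: w_def)
    have "norm (J v1 s - J v2 s) =
        norm (integral {l..s} (\<lambda>x. G x (w x *\<^sub>R apply_bcontfun v1 x) - G x (w x *\<^sub>R apply_bcontfun v2 x)))"
      unfolding J_def by (simp add: Henstock_Kurzweil_Integration.integral_diff[OF Gint Gint])
    also have "\<dots> \<le> integral {l..s} (\<lambda>x. L * w x * dist v1 v2)"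
    proof (rule integral_norm_bound_integral)
      show "(\<lambda>x. G x (w x *\<^sub>R apply_bcontfun v1 x) - G x (w x *\<^sub>R apply_bcontfun v2 x)) integrable_on {l..s}"
        by (intro integrable_diff Gint)
      show "(\<lambda>x. L * w x * dist v1 v2) integrable_on {l..s}"
        unfolding w_def by (intro integrable_continuous_interval continuous_intros)
      fix x
      have "norm (G x (w x *\<^sub>R apply_bcontfun v1 x) - G x (w x *\<^sub>R apply_bcontfun v2 x))
          \<le> L * norm (w x *\<^sub>R apply_bcontfun v1 x - w x *\<^sub>R apply_bcontfun v2 x)" by (rule lip)
      also have "\<dots> = L * w x * dist (apply_bcontfun v1 x) (apply_bcontfun v2 x)"
        using wpos[of x] by (simp add: scaleR_diff_right[symmetric] dist_norm)
      also have "\<dots> \<le> L * w x * dist v1 v2"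
        using wpos[of x] L by (intro mult_left_mono dist_bounded) auto
      finally show "norm (G x (w x *\<^sub>R apply_bcontfun v1 x) - G x (w x *\<^sub>R apply_bcontfun v2 x))
          \<le> L * w x * dist v1 v2" .
    qed
    \<comment> \<open>Since w' = 2 L w, the integral of L w is w / 2 up to the lower limit; the
      exponent 2 L is what produces the contraction factor 1/2.\<close>
    also have "((\<lambda>x. L * w x * dist v1 v2) has_integral
        (w s / 2 * dist v1 v2 - w l / 2 * dist v1 v2)) {l..s}"
    proof (rule fundamental_theorem_of_calculus)
      show "((\<lambda>x. w x / 2 * dist v1 v2) has_vector_derivative L * w x * dist v1 v2) (at x within {l..s})" for x
        unfolding w_def has_real_derivative_iff_has_vector_derivative[symmetric]
        by (auto intro!: derivative_eq_intros)
    qed (use s in auto)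
    then have "integral {l..s} (\<lambda>x. L * w x * dist v1 v2) = w s / 2 * dist v1 v2 - w l / 2 * dist v1 v2"
      by (rule integral_unique)
    also have "\<dots> \<le> w s / 2 * dist v1 v2" using wpos[of l] by simp
    finally have est: "norm (J v1 s - J v2 s) \<le> w s / 2 * dist v1 v2" .
    have "dist (T0 v1 t) (T0 v2 t) = (1 / w s) * norm (J v1 s - J v2 s)"
      using wpos[of s]
      by (simp add: T0_def dist_norm s_def[symmetric] scaleR_diff_right[symmetric])
    also have "\<dots> \<le> (1 / w s) * (w s / 2 * dist v1 v2)"
      using wpos[of s] est by (intro mult_left_mono) auto
    also have "\<dots> = 1/2 * dist v1 v2" using wpos[of s] by simp
    finally show "dist (apply_bcontfun (T v1) t) (apply_bcontfun (T v2) t) \<le> 1/2 * dist v1 v2"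
      by (simp add: T)
  qed
  have "\<exists>!v. T v = v"
    by (rule banach_fix_type[of "1/2"]) (use contr in auto)
  then obtain v where v: "T v = v" by blast
  define y where "y = (\<lambda>t. w t *\<^sub>R apply_bcontfun v t)"
  have y: "y t = y0 + integral {l..t} (\<lambda>s. G s (y s))" if "t \<in> {l..r}" for t
  proof -
    have "apply_bcontfun v t = T0 v t" using T[of v] v by simp
    then show ?thesis
      by (simp add: y_def T0_def clid[OF that] J_def) (simp add: w_def)
  qed
  show ?thesis
  proof
    show "y l = y0" using y[of l] lr by simp
    fix t assume t: "t \<in> {l..r}"
    have "((\<lambda>t. y0 + integral {l..t} (\<lambda>s. G s (y s))) has_vector_derivative G t (y t)) (at t within {l..r})"
      using integral_has_vector_derivative[OF cG[of "{l..r}" v] t]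
      by (auto simp: y_def intro!: derivative_eq_intros)
    then show "(y has_vector_derivative G t (y t)) (at t within {l..r})"
      by (rule has_vector_derivative_transform[OF t, rotated]) (use y in auto)
  qed
qed

text \<open>For d = y - z, the function exp (- 2 L t) |d|^2 is nonincreasing and exp (2 L t) |d|^2
  is nondecreasing, so the estimate works forwards and backwards in time. The square is used because
  it is differentiable where the norm may not be.\<close>

lemma gronwall:
  fixes y z y' z' :: "real \<Rightarrow> 'a::euclidean_space"
  assumes dy: "\<And>t. t \<in> {l..r} \<Longrightarrow> (y has_vector_derivative y' t) (at t within {l..r})"
    and dz: "\<And>t. t \<in> {l..r} \<Longrightarrow> (z has_vector_derivative z' t) (at t within {l..r})"
    and lip: "\<And>t. t \<in> {l..r} \<Longrightarrow> norm (y' t - z' t) \<le> L * norm (y t - z t)"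
    and st: "s \<in> {l..r}" "t \<in> {l..r}"
  shows "norm (y t - z t) \<le> exp (L * \<bar>t - s\<bar>) * norm (y s - z s)"
proof -
  define d where "d = (\<lambda>t. y t - z t)"
  define d' where "d' = (\<lambda>t. y' t - z' t)"
  have dd: "(d has_vector_derivative d' t) (at t within {l..r})" if "t \<in> {l..r}" for t
    unfolding d_def d'_def by (intro has_vector_derivative_diff dy dz that)
  have d2: "((\<lambda>t. exp (c * t) * (d t \<bullet> d t)) has_real_derivative
      exp (c * t) * (c * (d t \<bullet> d t) + 2 * (d t \<bullet> d' t))) (at t within {l..r})"
    if "t \<in> {l..r}" for c t
    using dd[OF that] unfolding has_vector_derivative_def has_field_derivative_def
    by (auto intro!: derivative_eq_intros simp: fun_eq_iff algebra_simps inner_commute)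
  have cs: "\<bar>d t \<bullet> d' t\<bar> \<le> L * (d t \<bullet> d t)" if "t \<in> {l..r}" for t
  proof -
    have "\<bar>d t \<bullet> d' t\<bar> \<le> norm (d t) * norm (d' t)" by (rule Cauchy_Schwarz_ineq2)
    also have "\<dots> \<le> norm (d t) * (L * norm (d t))"
      using lip[OF that] by (intro mult_left_mono) (auto simp: d_def d'_def)
    finally show ?thesis by (simp add: power2_norm_eq_inner[symmetric] power2_eq_square mult.left_commute)
  qed
  \<comment> \<open>The sign \<open>\<sigma>\<close> and the rate \<open>c\<close> cover both
    directions at once: (-1, -2L) for s before t, and (1, 2L) for t before s.\<close>
  have mono: "\<sigma> * (exp (c * x) * (d x \<bullet> d x)) \<le> \<sigma> * (exp (c * x') * (d x' \<bullet> d x'))"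
    if "x \<le> x'" "x \<in> {l..r}" "x' \<in> {l..r}"
    and c: "\<And>t. t \<in> {l..r} \<Longrightarrow> \<sigma> * (c * (d t \<bullet> d t) + 2 * (d t \<bullet> d' t)) \<ge> 0" for x x' c \<sigma>
  proof (rule DERIV_nonneg_imp_increasing_open[of x x' "\<lambda>x. \<sigma> * (exp (c * x) * (d x \<bullet> d x))", OF that(1)])
    show "continuous_on {x..x'} (\<lambda>x. \<sigma> * (exp (c * x) * (d x \<bullet> d x)))"
      by (intro continuous_on_mult_left continuous_on_subset[of "{l..r}", OF DERIV_continuous_on[OF d2]])
         (use that in auto)
    fix t assume t: "x < t" "t < x'"
    have "((\<lambda>t. \<sigma> * (exp (c * t) * (d t \<bullet> d t))) has_real_derivative
      \<sigma> * (exp (c * t) * (c * (d t \<bullet> d t) + 2 * (d t \<bullet> d' t)))) (at t)"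
      using DERIV_cmult[OF d2[of t c]] t that by (simp add: at_within_Icc_at)
    moreover have "\<sigma> * (exp (c * t) * (c * (d t \<bullet> d t) + 2 * (d t \<bullet> d' t))) \<ge> 0"
      using mult_nonneg_nonneg[OF exp_ge_zero[of "c * t"] c[of t]] t that by (simp add: mult.left_commute)
    ultimately show "\<exists>y. ((\<lambda>t. \<sigma> * (exp (c * t) * (d t \<bullet> d t))) has_real_derivative y) (at t) \<and> 0 \<le> y"
      by blast
  qed
  have sq: "norm (d t) \<le> exp (L * e) * norm (d s)" if "d t \<bullet> d t \<le> exp (2 * L * e) * (d s \<bullet> d s)" for e
  proof -
    have "(norm (d t))\<^sup>2 \<le> (exp (L * e) * norm (d s))\<^sup>2"
      using that by (simp add: power2_norm_eq_inner power_mult_distrib exp_double[symmetric] mult.assoc)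
    then show ?thesis by (rule power2_le_imp_le) auto
  qed
  show ?thesis
  proof (cases "s \<le> t")
    case True
    have "(-1) * (exp (- 2 * L * s) * (d s \<bullet> d s)) \<le> (-1) * (exp (- 2 * L * t) * (d t \<bullet> d t))"
    proof (rule mono[OF True st])
      fix x assume "x \<in> {l..r}"
      from cs[OF this] show "(-1) * (- 2 * L * (d x \<bullet> d x) + 2 * (d x \<bullet> d' x)) \<ge> 0"
        by (simp add: abs_le_iff)
    qed
    then have "exp (2 * L * t) * (exp (- 2 * L * t) * (d t \<bullet> d t)) \<le> exp (2 * L * t) * (exp (- 2 * L * s) * (d s \<bullet> d s))"
      by (intro mult_left_mono) auto
    then have "exp (2 * L * t + - 2 * L * t) * (d t \<bullet> d t) \<le> exp (2 * L * t + - 2 * L * s) * (d s \<bullet> d s)"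
      by (simp only: exp_add mult.assoc)
    then have "d t \<bullet> d t \<le> exp (2 * L * (t - s)) * (d s \<bullet> d s)"
      by (simp add: right_diff_distrib)
    from sq[OF this] show ?thesis using True by (simp add: d_def)
  next
    case False
    have "exp (2 * L * t) * (d t \<bullet> d t) \<le> exp (2 * L * s) * (d s \<bullet> d s)"
    proof -
      have "1 * (exp (2 * L * t) * (d t \<bullet> d t)) \<le> 1 * (exp (2 * L * s) * (d s \<bullet> d s))"
      proof (rule mono[OF _ st(2) st(1)])
        fix x assume "x \<in> {l..r}"
        from cs[OF this] show "1 * (2 * L * (d x \<bullet> d x) + 2 * (d x \<bullet> d' x)) \<ge> 0"
          by (simp add: abs_le_iff)
      qed (use False in simp)
      then show ?thesis by simp
    qed
    then have "exp (- (2 * L * t)) * (exp (2 * L * t) * (d t \<bullet> d t)) \<le> exp (- (2 * L * t)) * (exp (2 * L * s) * (d s \<bullet> d s))"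
      by (intro mult_left_mono) auto
    then have "exp (- (2 * L * t) + 2 * L * t) * (d t \<bullet> d t) \<le> exp (- (2 * L * t) + 2 * L * s) * (d s \<bullet> d s)"
      by (simp only: exp_add mult.assoc)
    then have "d t \<bullet> d t \<le> exp (2 * L * (s - t)) * (d s \<bullet> d s)"
      by (simp add: right_diff_distrib)
    from sq[OF this] show ?thesis using False by (simp add: d_def)
  qed
qed


text \<open>Convergence at the single time \<open>t0\<close> spreads to every bounded interval by
  Gronwall, and with it the uniform convergence of the derivatives; so compactness is only ever
  required of the values at one time. The Lipschitz bound is asked only between values of the given
  solutions, because the field of the application is quadratic and exponential.\<close>

lemma ode_limit:
  fixes G :: "real \<Rightarrow> 'a::euclidean_space \<Rightarrow> 'a" and y :: "nat \<Rightarrow> real \<Rightarrow> 'a" and L :: "nat \<Rightarrow> real"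
  assumes cont: "\<And>t. continuous_on UNIV (G t)"
    and ode: "\<And>n t. N0 \<le> n \<Longrightarrow> t \<in> {-real n..real n} \<Longrightarrow>
      (y n has_vector_derivative G t (y n t)) (at t within {-real n..real n})"
    and lip: "\<And>N m n t. N0 \<le> N \<Longrightarrow> N \<le> m \<Longrightarrow> N \<le> n \<Longrightarrow> t \<in> {-real N..real N} \<Longrightarrow>
      norm (G t (y m t) - G t (y n t)) \<le> L N * norm (y m t - y n t)"
    and L0: "\<And>N. L N \<ge> 0"
    and r: "strict_mono r" and conv: "(\<lambda>n. y (r n) t0) \<longlonglongrightarrow> c"
  obtains z where "\<And>t. (\<lambda>n. y (r n) t) \<longlonglongrightarrow> z t"
    "\<And>t. (z has_vector_derivative G t (z t)) (at t)"
proof -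
  have rge: "n \<le> r n" for n using r by (rule seq_suble)
  have est: "norm (y m t - y n t) \<le> exp (L N * (2 * N)) * norm (y m t0 - y n t0)"
    if N: "N0 \<le> N" "\<bar>t0\<bar> \<le> real N" "N \<le> m" "N \<le> n" "t \<in> {-real N..real N}" for N m n t
  proof -
    have sub: "{-real N..real N} \<subseteq> {-real k..real k}" if "N \<le> k" for k using that by auto
    have "norm (y m t - y n t) \<le> exp (L N * \<bar>t - t0\<bar>) * norm (y m t0 - y n t0)"
    proof (rule gronwall[of "-real N" "real N"])
      fix s assume s: "s \<in> {-real N..real N}"
      show "(y m has_vector_derivative G s (y m s)) (at s within {-real N..real N})"
        by (rule has_vector_derivative_within_subset[OF ode[of m s] sub]) (use s N in auto)
      show "(y n has_vector_derivative G s (y n s)) (at s within {-real N..real N})"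
        by (rule has_vector_derivative_within_subset[OF ode[of n s] sub]) (use s N in auto)
      show "norm (G s (y m s) - G s (y n s)) \<le> L N * norm (y m s - y n s)"
        by (rule lip) (use s N in auto)
    qed (use N in auto)
    also have "\<dots> \<le> exp (L N * (2 * N)) * norm (y m t0 - y n t0)"
      using N L0[of N] by (intro mult_right_mono) (auto intro!: mult_left_mono)
    finally show ?thesis .
  qed
  have cau: "Cauchy (\<lambda>n. y (r n) t)" for t
  proof -
    obtain N where N: "N0 \<le> N" "\<bar>t0\<bar> \<le> real N" "\<bar>t\<bar> \<le> real N"
    proof -
      obtain k where "max (real N0) (max \<bar>t0\<bar> \<bar>t\<bar>) \<le> real k" using real_arch_simple by blast
      then show ?thesis using that[of k] by auto
    qed
    define C where "C = exp (L N * (2 * N))"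
    have C: "C > 0" by (simp add: C_def)
    show ?thesis
    proof (rule CauchyI)
      fix e :: real assume e: "e > 0"
      have "e / C > 0" using e C by simp
      from CauchyD[OF LIMSEQ_imp_Cauchy[OF conv] this] obtain M where
        M: "\<And>m n. m \<ge> M \<Longrightarrow> n \<ge> M \<Longrightarrow> norm (y (r m) t0 - y (r n) t0) < e / C" by blast
      show "\<exists>M. \<forall>m\<ge>M. \<forall>n\<ge>M. norm (y (r m) t - y (r n) t) < e"
      proof (intro exI[of _ "max M N"] allI impI)
        fix m n assume mn: "max M N \<le> m" "max M N \<le> n"
        have "norm (y (r m) t - y (r n) t) \<le> C * norm (y (r m) t0 - y (r n) t0)"
          unfolding C_def
          by (rule est) (use N mn rge[of m] rge[of n] in auto)
        also have "\<dots> < C * (e / C)" using M[of m n] mn C by (intro mult_strict_left_mono) auto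
        finally show "norm (y (r m) t - y (r n) t) < e" using C by simp
      qed
    qed
  qed
  then have "\<forall>t. \<exists>l. (\<lambda>n. y (r n) t) \<longlonglongrightarrow> l"
    by (simp add: Cauchy_convergent_iff convergent_def)
  then obtain z where z: "\<And>t. (\<lambda>n. y (r n) t) \<longlonglongrightarrow> z t" by metis
  have "(z has_vector_derivative G t (z t)) (at t)" for t
  proof -
    \<comment> \<open>The strict inequality puts \<open>t\<close> in the interior of
      \<open>S\<close>, so that the derivative within \<open>S\<close> is a full derivative.\<close>
    obtain N where N: "N0 \<le> N" "\<bar>t0\<bar> \<le> real N" "\<bar>t\<bar> < real N"
    proof -
      obtain k where "max (real N0) (max \<bar>t0\<bar> (\<bar>t\<bar> + 1)) \<le> real k" using real_arch_simple by blast
      then show ?thesis using that[of k] by auto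
    qed
    define S where "S = {-real N..real N}"
    define C where "C = L N * exp (L N * (2 * N))"
    have "C \<ge> 0" using L0[of N] by (simp add: C_def)
    \<comment> \<open>Letting m tend to infinity in the Lipschitz and Gronwall estimates gives a
      bound free of s, that is, uniform convergence of the right-hand sides on
      \<open>S\<close>.\<close>
    have Gest: "norm (G s (y (r n) s) - G s (z s)) \<le> C * norm (y (r n) t0 - c)"
      if s: "s \<in> S" and n: "n \<ge> N" for s n
    proof (rule tendsto_le[OF sequentially_bot])
      have "(\<lambda>m. G s (y (r m) s)) \<longlonglongrightarrow> G s (z s)"
        by (rule continuous_on_tendsto_compose[OF cont z]) auto
      then show "(\<lambda>m. norm (G s (y (r n) s) - G s (y (r m) s))) \<longlonglongrightarrow> norm (G s (y (r n) s) - G s (z s))"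
        by (intro tendsto_intros)
      show "(\<lambda>m. C * norm (y (r n) t0 - y (r m) t0)) \<longlonglongrightarrow> C * norm (y (r n) t0 - c)"
        by (intro tendsto_intros conv)
      show "\<forall>\<^sub>F m in sequentially. norm (G s (y (r n) s) - G s (y (r m) s)) \<le> C * norm (y (r n) t0 - y (r m) t0)"
        using eventually_ge_at_top[of N]
      proof eventually_elim
        case (elim m)
        have rr: "N \<le> r m" "N \<le> r n" using rge[of m] rge[of n] elim n by auto
        have "norm (G s (y (r n) s) - G s (y (r m) s)) \<le> L N * norm (y (r n) s - y (r m) s)"
          by (rule lip) (use N rr s in \<open>auto simp: S_def\<close>)
        also have "\<dots> \<le> L N * (exp (L N * (2 * N)) * norm (y (r n) t0 - y (r m) t0))"
          by (intro mult_left_mono est L0) (use N rr s in \<open>auto simp: S_def\<close>)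
        finally show ?case by (simp add: C_def mult.assoc)
      qed
    qed
    have "\<exists>g. \<forall>x\<in>S. (\<lambda>n. y (r (n + N)) x) \<longlonglongrightarrow> g x \<and>
        (g has_derivative (\<lambda>h. h *\<^sub>R G x (z x))) (at x within S)"
    proof (rule has_derivative_sequence[where f' = "\<lambda>n x h. h *\<^sub>R G x (y (r (n + N)) x)"])
      show "convex S" by (simp add: S_def)
      show "(y (r (n + N)) has_derivative (\<lambda>h. h *\<^sub>R G x (y (r (n + N)) x))) (at x within S)"
        if "x \<in> S" for n x
      proof -
        have sub: "S \<subseteq> {-real (r (n + N))..real (r (n + N))}"
          using rge[of "n + N"] by (auto simp: S_def)
        have "(y (r (n + N)) has_vector_derivative G x (y (r (n + N)) x)) (at x within S)"
          by (rule has_vector_derivative_within_subset[OF ode sub]) (use that sub N rge[of "n + N"] in auto)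
        then show ?thesis by (simp add: has_vector_derivative_def)
      qed
      show "t \<in> S" using N by (auto simp: S_def)
      show "(\<lambda>n. y (r (n + N)) t) \<longlonglongrightarrow> z t" by (rule LIMSEQ_ignore_initial_segment[OF z])
      fix e :: real assume e: "e > 0"
      have "(\<lambda>n. C * norm (y (r (n + N)) t0 - c)) \<longlonglongrightarrow> C * norm (c - c)"
        by (intro tendsto_intros LIMSEQ_ignore_initial_segment[OF conv])
      then have "\<forall>\<^sub>F n in sequentially. C * norm (y (r (n + N)) t0 - c) < e"
        using e by (simp add: order_tendstoD(2))
      then show "\<forall>\<^sub>F n in sequentially. \<forall>x\<in>S. \<forall>h. norm (h *\<^sub>R G x (y (r (n + N)) x) - h *\<^sub>R G x (z x)) \<le> e * norm h"
      proof eventually_elim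
        case (elim n)
        show ?case
        proof (intro ballI allI)
          fix x and h :: real assume x: "x \<in> S"
          have "norm (h *\<^sub>R G x (y (r (n + N)) x) - h *\<^sub>R G x (z x))
              = \<bar>h\<bar> * norm (G x (y (r (n + N)) x) - G x (z x))"
            by (simp add: scaleR_diff_right[symmetric])
          also have "\<dots> \<le> \<bar>h\<bar> * e"
            using Gest[OF x, of "n + N"] elim by (intro mult_left_mono) auto
          finally show "norm (h *\<^sub>R G x (y (r (n + N)) x) - h *\<^sub>R G x (z x)) \<le> e * norm h"
            by (simp add: mult.commute)
        qed
      qed
    qed
    then obtain g where g: "\<And>x. x \<in> S \<Longrightarrow> (\<lambda>n. y (r (n + N)) x) \<longlonglongrightarrow> g x"
      "\<And>x. x \<in> S \<Longrightarrow> (g has_derivative (\<lambda>h. h *\<^sub>R G x (z x))) (at x within S)" by blast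
    have gz: "g x = z x" if "x \<in> S" for x
      using LIMSEQ_unique[OF g(1)[OF that] LIMSEQ_ignore_initial_segment[OF z]] .
    have tS: "t \<in> S" using N by (auto simp: S_def)
    have "(z has_derivative (\<lambda>h. h *\<^sub>R G t (z t))) (at t within S)"
      by (rule has_derivative_transform[OF tS _ g(2)[OF tS]]) (simp add: gz)
    moreover have "at t within S = at t" unfolding S_def by (rule at_within_Icc_at) (use N in auto)
    ultimately show ?thesis by (simp add: has_vector_derivative_def)
  qed
  with z show ?thesis by (rule that)
qed

section \<open>The inverse Mills ratio\<close>

text \<open>M is the normal density divided by the upper tail probability (the normal hazard rate).
  The Riccati equation M' = M (M - z) makes it a candidate barrier. M' < 1 is a classical inequality
  for this function, and the bound of 1 - M' by \<open>K * (M z - z)\<close> is what lets a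
  translation absorb the residual of the barrier. The last property provides the Gaussian decay at
  -infinity.\<close>

lemma inverse_mills_ratio:
  obtains M :: "real \<Rightarrow> real" and K :: real where
    "\<And>z. M z > 0"
    "\<And>z. (M has_real_derivative M z * (M z - z)) (at z)"
    "\<And>z. M z > z"
    "\<And>z. z > 0 \<Longrightarrow> M z \<le> z + 1 / z"
    "\<And>z. M z * (M z - z) < 1"
    "K > 0" "\<And>z. 1 - M z * (M z - z) \<le> K * (M z - z)"
    "\<And>Z. \<exists>B>0. \<forall>z\<le>Z. M z \<le> B * exp (- z\<^sup>2 / 2)"
proof -
  have gauss: "exp (- x\<^sup>2 / 2) \<le> exp (1/2) * exp x" for x :: real
  proof -
    have "0 \<le> (x + 1)\<^sup>2" by simp
    then have "- x\<^sup>2 / 2 \<le> 1/2 + x" by (simp add: power2_sum)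
    then show ?thesis by (simp add: exp_add[symmetric])
  qed
  obtain P where P: "\<And>x. (P has_real_derivative exp (- x\<^sup>2 / 2)) (at x)" "(P \<longlongrightarrow> 0) at_bot"
    "\<And>x. P x > 0" "strict_mono P"
    by (rule antiderivative_vanishing_at_bot[of "\<lambda>x. exp (- x\<^sup>2 / 2)" "exp (1/2)"])
       (use gauss in \<open>auto intro!: continuous_intros\<close>)
  \<comment> \<open>Both tail bounds have the same proof: the difference of the two sides vanishes
    at -infinity and has a positive derivative, here exp (- y^2/2) / y^2 and in \<open>low\<close>
    the function 2 exp (- y^2/2) / (y^2 + 1)^2.\<close>
  have up: "P x < exp (- x\<^sup>2 / 2) / (- x)" if "x < 0" for x
  proof -
    have lim: "((\<lambda>x. exp (- x\<^sup>2 / 2) / (- x) - P x) \<longlongrightarrow> 0 - 0) at_bot"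
      by (rule tendsto_diff[OF _ P(2)]) real_asymp
    have "0 - 0 < exp (- x\<^sup>2 / 2) / (- x) - P x"
    proof (rule DERIV_pos_imp_increasing_at_bot[OF _ lim])
      fix y assume "y \<le> x"
      then have y: "y < 0" using that by simp
      then have "((\<lambda>x. exp (- x\<^sup>2 / 2) / (- x) - P x) has_real_derivative exp (- y\<^sup>2 / 2) / y\<^sup>2) (at y)"
        by (auto intro!: derivative_eq_intros P simp: field_simps power2_eq_square)
      then show "\<exists>d. ((\<lambda>x. exp (- x\<^sup>2 / 2) / (- x) - P x) has_real_derivative d) (at y) \<and> 0 < d"
        using y by (intro exI conjI) auto
    qed
    then show ?thesis by simp
  qed
  have low: "(- x) / (x\<^sup>2 + 1) * exp (- x\<^sup>2 / 2) < P x" for x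
  proof -
    have lim: "((\<lambda>x. P x - (- x) / (x\<^sup>2 + 1) * exp (- x\<^sup>2 / 2)) \<longlongrightarrow> 0 - 0) at_bot"
      by (rule tendsto_diff[OF P(2)]) real_asymp
    have "0 - 0 < P x - (- x) / (x\<^sup>2 + 1) * exp (- x\<^sup>2 / 2)"
    proof (rule DERIV_pos_imp_increasing_at_bot[OF _ lim])
      fix y :: real
      have nz: "y\<^sup>2 + 1 \<noteq> 0" by (smt (verit) zero_le_power2)
      have id: "1 - ((y\<^sup>2 - 1) / (y\<^sup>2 + 1)\<^sup>2 + y\<^sup>2 / (y\<^sup>2 + 1)) = 2 / (y\<^sup>2 + 1)\<^sup>2"
        using nz by (simp add: divide_simps) algebra
      have "((\<lambda>x. (- x) / (x\<^sup>2 + 1)) has_real_derivative (y\<^sup>2 - 1) / (y\<^sup>2 + 1)\<^sup>2) (at y)"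
      proof -
        have "((\<lambda>x. (- x) / (x\<^sup>2 + 1)) has_real_derivative
            ((-1) * (y\<^sup>2 + 1) - (- y) * (2 * y)) / ((y\<^sup>2 + 1) * (y\<^sup>2 + 1))) (at y)"
          by (rule DERIV_divide) (use nz in \<open>auto intro!: derivative_eq_intros\<close>)
        then show ?thesis by (simp add: power2_eq_square algebra_simps)
      qed
      moreover have "((\<lambda>x. exp (- x\<^sup>2 / 2)) has_real_derivative exp (- y\<^sup>2 / 2) * (- y)) (at y)"
        by (auto intro!: derivative_eq_intros)
      ultimately have "((\<lambda>x. P x - (- x) / (x\<^sup>2 + 1) * exp (- x\<^sup>2 / 2)) has_real_derivative
          exp (- y\<^sup>2 / 2) - ((y\<^sup>2 - 1) / (y\<^sup>2 + 1)\<^sup>2 * exp (- y\<^sup>2 / 2)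
             + exp (- y\<^sup>2 / 2) * (- y) * ((- y) / (y\<^sup>2 + 1)))) (at y)"
        by (intro DERIV_diff P DERIV_mult)
      also have "exp (- y\<^sup>2 / 2) - ((y\<^sup>2 - 1) / (y\<^sup>2 + 1)\<^sup>2 * exp (- y\<^sup>2 / 2)
             + exp (- y\<^sup>2 / 2) * (- y) * ((- y) / (y\<^sup>2 + 1)))
          = exp (- y\<^sup>2 / 2) * (1 - ((y\<^sup>2 - 1) / (y\<^sup>2 + 1)\<^sup>2 + y\<^sup>2 / (y\<^sup>2 + 1)))"
        by (simp add: algebra_simps power2_eq_square)
      finally show "\<exists>d. ((\<lambda>x. P x - (- x) / (x\<^sup>2 + 1) * exp (- x\<^sup>2 / 2)) has_real_derivative d) (at y) \<and> 0 < d"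
        unfolding id using nz by (intro exI conjI) auto
    qed
    then show ?thesis by simp
  qed
  define M where "M = (\<lambda>z. exp (- z\<^sup>2 / 2) / P (- z))"
  have Mpos: "M z > 0" for z using P(3) by (simp add: M_def)
  have dM: "(M has_real_derivative M z * (M z - z)) (at z)" for z
  proof -
    have Pn: "((\<lambda>z. P (- z)) has_real_derivative - exp (- z\<^sup>2 / 2)) (at z)"
      using P(1)[of "- z"] by (simp add: DERIV_mirror)
    have "P (- z) \<noteq> 0" using P(3)[of "- z"] by simp
    then show ?thesis
      unfolding M_def by (auto intro!: derivative_eq_intros Pn simp: field_simps)
  qed
  have Mz: "M z > z" for z
  proof (cases "z > 0")
    case True
    then have "P (- z) < exp (- z\<^sup>2 / 2) / z" using up[of "- z"] by simp
    then show ?thesis using P(3)[of "- z"] True by (simp add: M_def field_simps)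
  next
    case False
    then show ?thesis using Mpos[of z] by simp
  qed
  have Mup: "M z \<le> z + 1 / z" if "z > 0" for z
  proof -
    have "z / (z\<^sup>2 + 1) * exp (- z\<^sup>2 / 2) < P (- z)" using low[of "- z"] by simp
    moreover have "z\<^sup>2 + 1 > 0" using that by (simp add: add_pos_pos)
    ultimately have "z * exp (- z\<^sup>2 / 2) < P (- z) * (z\<^sup>2 + 1)"
      by (simp add: pos_divide_less_eq)
    then have "exp (- z\<^sup>2 / 2) / P (- z) < (z\<^sup>2 + 1) / z"
      using P(3)[of "- z"] that by (simp add: field_simps)
    also have "(z\<^sup>2 + 1) / z = z + 1 / z" using that by (simp add: field_simps power2_eq_square)
    finally show ?thesis by (simp add: M_def)
  qed
  \<comment> \<open>D is the excess of M over its asymptote and E is M'. They satisfy D' = E - 1 and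
    E' = E D + M (E - 1), and the two remaining inequalities are read off from this system.\<close>
  define D where "D = (\<lambda>z. M z - z)"
  define E where "E = (\<lambda>z. M z * D z)"
  have Dpos: "D z > 0" for z using Mz by (simp add: D_def)
  have Epos: "E z > 0" for z using Mpos Dpos by (simp add: E_def)
  have dD: "(D has_real_derivative E z - 1) (at z)" for z
    unfolding D_def E_def by (intro DERIV_diff dM DERIV_ident)
  have dM': "(M has_real_derivative E z) (at z)" for z using dM by (simp add: E_def D_def)
  have dE: "(E has_real_derivative E z * D z + M z * (E z - 1)) (at z)" for z
    using DERIV_mult[OF dM' dD, of z] by (simp only: E_def[symmetric] mult.commute[of "M z" "E z - 1"])
  \<comment> \<open>Once E reaches 1 it stays above, so D' = E - 1 keeps D away from 0, whereas D \<le> 1/z.\<close>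
  have E1: "E z0 < 1" for z0
  proof (rule ccontr)
    assume "\<not> E z0 < 1"
    \<comment> \<open>An integrating factor for (E - 1)' = (E - 1)(M + D) + D, because M + D = 2 M'/M + z.\<close>
    define Y where "Y = (\<lambda>z. (E z - 1) * (exp (- z\<^sup>2 / 2) / (M z)\<^sup>2))"
    have dY: "(Y has_real_derivative D z * (exp (- z\<^sup>2 / 2) / (M z)\<^sup>2)) (at z)" for z
    proof -
      have nz: "M z \<noteq> 0" using Mpos[of z] by simp
      have "((\<lambda>z. exp (- z\<^sup>2 / 2) / (M z)\<^sup>2) has_real_derivative
          ((exp (- z\<^sup>2 / 2) * (- z)) * (M z)\<^sup>2 - exp (- z\<^sup>2 / 2) * (2 * M z * E z)) / ((M z)\<^sup>2 * (M z)\<^sup>2)) (at z)"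
        using nz by (auto intro!: derivative_eq_intros dM')
      also have "((exp (- z\<^sup>2 / 2) * (- z)) * (M z)\<^sup>2 - exp (- z\<^sup>2 / 2) * (2 * M z * E z)) / ((M z)\<^sup>2 * (M z)\<^sup>2)
          = - (M z + D z) * (exp (- z\<^sup>2 / 2) / (M z)\<^sup>2)"
      proof -
        have "(exp (- z\<^sup>2 / 2) * (- z)) * (M z)\<^sup>2 - exp (- z\<^sup>2 / 2) * (2 * M z * E z)
            = - (M z + D z) * (exp (- z\<^sup>2 / 2) * (M z)\<^sup>2)"
          by (simp add: E_def D_def power2_eq_square algebra_simps)
        moreover have cancel: "x * (y * m) / (m * m) = x * (y / m)" if "m \<noteq> 0" for x y m :: real
          using that by simp
        ultimately show ?thesis using cancel[of "(M z)\<^sup>2"] nz by (metis power_not_zero)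
      qed
      finally have k: "((\<lambda>z. exp (- z\<^sup>2 / 2) / (M z)\<^sup>2) has_real_derivative
          - (M z + D z) * (exp (- z\<^sup>2 / 2) / (M z)\<^sup>2)) (at z)" .
      have "(E z * D z + M z * (E z - 1) - 0) * (exp (- z\<^sup>2 / 2) / (M z)\<^sup>2)
          + - (M z + D z) * (exp (- z\<^sup>2 / 2) / (M z)\<^sup>2) * (E z - 1)
          = D z * (exp (- z\<^sup>2 / 2) / (M z)\<^sup>2)" by algebra
      with DERIV_mult[OF DERIV_diff[OF dE DERIV_const[of 1]] k] show ?thesis
        unfolding Y_def by simp
    qed
    have kpos: "exp (- z\<^sup>2 / 2) / (M z)\<^sup>2 > 0" for z using Mpos[of z] by simp
    have Ymono: "Y z0 \<le> Y z" if "z0 \<le> z" for z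
      using that
    proof (rule DERIV_nonneg_imp_nondecreasing)
      fix x show "\<exists>y. (Y has_real_derivative y) (at x) \<and> 0 \<le> y"
        using dY[of x] mult_pos_pos[OF Dpos[of x] kpos[of x]] by (auto intro: less_imp_le)
    qed
    have "Y z0 \<ge> 0" unfolding Y_def using \<open>\<not> E z0 < 1\<close> kpos[of z0] by (intro mult_nonneg_nonneg) auto
    then have Ege: "E z \<ge> 1" if "z0 \<le> z" for z
    proof -
      have "0 \<le> (E z - 1) * (exp (- z\<^sup>2 / 2) / (M z)\<^sup>2)"
        using Ymono[OF that] \<open>Y z0 \<ge> 0\<close> by (simp add: Y_def)
      then show ?thesis using kpos[of z] by (simp only: zero_le_mult_iff) auto
    qed
    have Dmono: "D z0 \<le> D z" if "z0 \<le> z" for z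
      using that
    proof (rule DERIV_nonneg_imp_nondecreasing)
      fix x assume "z0 \<le> x"
      then show "\<exists>y. (D has_real_derivative y) (at x) \<and> 0 \<le> y"
        using dD[of x] Ege[of x] by auto
    qed
    define z where "z = max z0 (2 / D z0)"
    have z: "z0 \<le> z" "z \<ge> 2 / D z0" "z > 0"
      using Dpos[of z0] by (auto simp: z_def less_max_iff_disj)
    have "D z \<le> 1 / z" using Mup[OF z(3)] by (simp add: D_def)
    also have "\<dots> \<le> D z0 / 2" using z Dpos[of z0] by (simp add: field_simps)
    finally show False using Dmono[OF z(1)] Dpos[of z0] by simp
  qed
  \<comment> \<open>\<open>K * M 0 \<ge> 1\<close> settles z \<le> 0, where D z is at least D 0 = M
    0 while 1 - E z < 1. \<open>K \<ge> 1\<close> gives (K + M) K \<ge> 1, which the barrier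
    argument for z > 0 uses.\<close>
  define K where "K = max 1 (1 / M 0)"
  have K: "K \<ge> 1" "K * M 0 \<ge> 1"
  proof -
    have "1 / M 0 * M 0 \<le> K * M 0" using Mpos[of 0] by (intro mult_right_mono) (auto simp: K_def)
    then show "K * M 0 \<ge> 1" using Mpos[of 0] by simp
  qed (simp add: K_def)
  \<comment> \<open>If 1 - E > K D at a point z > 0, the gap persists and forces D' below a negative constant.\<close>
  have EK: "1 - E z \<le> K * D z" for z
  proof (cases "z \<le> 0")
    case True
    have "D 0 \<le> D z"
      using True
    proof (rule DERIV_nonpos_imp_nonincreasing)
      fix x show "\<exists>y. (D has_real_derivative y) (at x) \<and> y \<le> 0"
        using dD[of x] E1[of x] by (auto intro: less_imp_le)
    qed
    then have "K * D z \<ge> K * M 0" using K by (intro mult_left_mono) (auto simp: D_def)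
    then show ?thesis using K Epos[of z] by linarith
  next
    case False
    show ?thesis
    proof (rule ccontr)
      define X where "X = (\<lambda>z. K * D z + E z - 1)"
      assume "\<not> 1 - E z \<le> K * D z"
      then have Xz: "X z < 0" by (simp add: X_def)
      define e where "e = - X z / 2"
      have e: "e > 0" using Xz by (simp add: e_def)
      \<comment> \<open>On \<open>{z..r}\<close> the function D will be seen to fall at least at
        rate \<open>e\<close>, and \<open>r\<close> is the point where this has used up all of D z,
        contradicting D > 0.\<close>
      define r where "r = z + D z / e"
      have zr: "z \<le> r" using e Dpos[of z] by (simp add: r_def)
      have Xneg: "X x + e < 0" if "x \<in> {z..r}" for x
      proof (rule negative_barrier[of z r "\<lambda>x. X x + e"
            "\<lambda>x. K * (E x - 1) + (E x * D x + M x * (E x - 1))", OF _ _ _ that])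
        show "((\<lambda>x. X x + e) has_real_derivative K * (E t - 1) + (E t * D t + M t * (E t - 1))) (at t within {z..r})" for t
          unfolding X_def
          by (rule has_field_derivative_at_within) (auto intro!: derivative_eq_intros dD dE)
        show "X z + e < 0" using Xz by (simp add: e_def)
        fix t assume "X t + e = 0"
        then have t: "1 - E t > K * D t" using e by (simp add: X_def)
        have "(K + M t) * (K * D t) < (K + M t) * (1 - E t)"
          using t K Mpos[of t] by (intro mult_strict_left_mono) auto
        moreover have "E t * D t \<le> (K + M t) * (K * D t)"
        proof -
          have "1 * 1 \<le> (K + M t) * K"
            using K Mpos[of t] by (intro mult_mono) auto
          then have "E t \<le> (K + M t) * K" using E1[of t] by simp
          then have "E t * D t \<le> (K + M t) * K * D t"
            using Dpos[of t] by (intro mult_right_mono) auto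
          then show ?thesis by (simp add: mult.assoc)
        qed
        ultimately have "E t * D t < (K + M t) * (1 - E t)" by linarith
        then show "K * (E t - 1) + (E t * D t + M t * (E t - 1)) < 0" by (simp add: algebra_simps)
      qed
      have "D r + e * r \<le> D z + e * z"
      proof (rule DERIV_nonpos_imp_nonincreasing[of z r "\<lambda>x. D x + e * x", OF zr])
        fix x assume x: "z \<le> x" "x \<le> r"
        have "((\<lambda>x. D x + e * x) has_real_derivative E x - 1 + e) (at x)"
          by (auto intro!: derivative_eq_intros dD)
        moreover have "E x - 1 + e \<le> 0"
        proof -
          have "K * D x > 0" using K Dpos[of x] by simp
          then show ?thesis using Xneg[of x] x by (simp add: X_def)
        qed
        ultimately show "\<exists>y. ((\<lambda>x. D x + e * x) has_real_derivative y) (at x) \<and> y \<le> 0" by blast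
      qed
      moreover have "e * r = e * z + D z" using e by (simp add: r_def distrib_left)
      ultimately show False using Dpos[of r] by simp
    qed
  qed
  have Mdec: "\<exists>B>0. \<forall>z\<le>Z. M z \<le> B * exp (- z\<^sup>2 / 2)" for Z
  proof (intro exI[of _ "1 / P (- Z)"] conjI allI impI)
    show "1 / P (- Z) > 0" using P(3) by simp
    fix z assume "z \<le> Z"
    then have "P (- Z) \<le> P (- z)" using P(4) by (simp add: strict_mono_less_eq)
    then show "M z \<le> 1 / P (- Z) * exp (- z\<^sup>2 / 2)"
      unfolding M_def using P(3)[of "- Z"] by (simp add: frac_le)
  qed
  show ?thesis
    by (rule that[of M K]) (use Mpos dM Mz Mup E1 EK Mdec K in \<open>auto simp: E_def D_def\<close>)
qed

section \<open>Barriers for the profile equation\<close>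

text \<open>This is u'' as a function of t, u and p = u', with q written as 1 + 1/b. The factor exp
  u is (f')^(q - 1), since f' = exp (b u) and q - 1 = 1/b.\<close>

definition profile_rhs :: "real \<Rightarrow> real \<Rightarrow> real \<Rightarrow> real \<Rightarrow> real" where
  "profile_rhs b t u p = - b * p\<^sup>2 - (t / 2 - (1 + 1 / b) * exp u) * p - 1 / 2"

text \<open>The indices m and p stand for minus (subsolution) and plus (supersolution).\<close>

locale barriers =
  fixes b \<delta> K :: real and um pm pm' up pp pp' :: "real \<Rightarrow> real"
  assumes b: "b > 0"
    and um: "\<And>t. (um has_real_derivative pm t) (at t)"
    and pm: "\<And>t. (pm has_real_derivative pm' t) (at t)"
    and up: "\<And>t. (up has_real_derivative pp t) (at t)"
    and pp: "\<And>t. (pp has_real_derivative pp' t) (at t)"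
    and pm_pos: "\<And>t. pm t > 0" and pp_pos: "\<And>t. pp t > 0"
    and sub: "\<And>t. profile_rhs b t (um t) (pm t) \<le> pm' t"
    and super: "\<And>t. pp' t \<le> profile_rhs b t (up t) (pp t)"
    and um_le_up: "\<And>t. um t \<le> up t"
    and start: "\<forall>\<^sub>F x in at_top. pp (- x) < x / (2 * b) + (1 - b) / b / x
                  \<and> x / (2 * b) + (1 - b) / b / x < pm (- x)"
    and decay: "\<And>t. t \<le> 0 \<Longrightarrow> up t \<le> K - (t + \<delta>)\<^sup>2 / (4 * b)"
    and um_at_top: "((\<lambda>t. exp (um t) / t) \<longlongrightarrow> b / (b + 1)) at_top"
    and up_at_top: "((\<lambda>t. exp (up t) / t) \<longlongrightarrow> b / (b + 1)) at_top"

text \<open>With z = \<sigma> (t + d), inserting the shifted Mills ratio leaves the residual ((1 -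
  1/b)(1 - M') - \<sigma> d (M z - z)) / 2. It vanishes for b = 1 and d = 0; in general the bound on
  1 - M' lets the second term dominate for d = \<delta> and d = -\<delta>, with opposite
  signs.\<close>

lemma barriers_exist:
  fixes b :: real
  assumes b: "b > 0"
  obtains \<delta> K um pm pm' up pp pp' where "barriers b \<delta> K um pm pm' up pp pp'"
proof -
  obtain M L where M: "\<And>z. M z > 0" "\<And>z. (M has_real_derivative M z * (M z - z)) (at z)"
    "\<And>z. M z > z" "\<And>z. z > 0 \<Longrightarrow> M z \<le> z + 1 / z" "\<And>z. M z * (M z - z) < 1"
    "L > 0" "\<And>z. 1 - M z * (M z - z) \<le> L * (M z - z)"
    "\<And>Z. \<exists>B>0. \<forall>z\<le>Z. M z \<le> B * exp (- z\<^sup>2 / 2)"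
    using inverse_mills_ratio by blast
  \<comment> \<open>The constants come from matching coefficients: b \<sigma>^2 = 1/2 normalizes the
    term quadratic in M z - z, and (1 + 1/b) A = 2 b gives M z (M z - z) the coefficient 1, so that
    all terms of the field combine to (M' - 1) / 2 when d = 0.\<close>
  define \<sigma> where "\<sigma> = sqrt (1 / (2 * b))"
  have \<sigma>: "\<sigma> > 0" "\<sigma> * \<sigma> = 1 / (2 * b)" using b by (simp_all add: \<sigma>_def)
  define A where "A = 2 * b / (1 + 1 / b)"
  have A: "A > 0" "(1 + 1 / b) * A = 2 * b" "A * (\<sigma> * \<sigma>) = b / (b + 1)"
  proof -
    have "1 + 1 / b > 0" using b by (simp add: add_pos_pos)
    then show "A > 0" "(1 + 1 / b) * A = 2 * b" using b by (simp_all add: A_def)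
    show "A * (\<sigma> * \<sigma>) = b / (b + 1)" unfolding \<sigma>(2) A_def using b by (simp add: field_simps)
  qed
  \<comment> \<open>The summand 1 keeps \<delta> positive even for b = 1, where no shift is required
    by the residual; the strict ordering of the slopes near -infinity relies on it.\<close>
  define \<delta> where "\<delta> = (L * \<bar>1 - 1 / b\<bar> + 1) / \<sigma>"
  have \<delta>: "\<delta> > 0" "\<sigma> * \<delta> \<ge> L * \<bar>1 - 1 / b\<bar>"
    using M(6) \<sigma> by (auto simp: \<delta>_def intro!: divide_pos_pos add_nonneg_pos)
  define u where "u = (\<lambda>d t. ln (A * \<sigma> * M (\<sigma> * (t + d))))"
  define s where "s = (\<lambda>d t. \<sigma> * (M (\<sigma> * (t + d)) - \<sigma> * (t + d)))"
  define s' where "s' = (\<lambda>d t. \<sigma> * \<sigma> * (M (\<sigma> * (t + d)) * (M (\<sigma> * (t + d)) - \<sigma> * (t + d)) - 1))"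
  have AM: "A * \<sigma> * M z > 0" for z using A \<sigma> M(1) by simp
  have eu: "exp (u d t) = A * \<sigma> * M (\<sigma> * (t + d))" for d t
    using AM by (simp add: u_def)
  have dM: "((\<lambda>t. M (\<sigma> * (t + d))) has_real_derivative
      M (\<sigma> * (t + d)) * (M (\<sigma> * (t + d)) - \<sigma> * (t + d)) * \<sigma>) (at t)" for d t
    by (rule DERIV_chain2[where f = M and g = "\<lambda>t. \<sigma> * (t + d)", OF M(2)])
       (auto intro!: derivative_eq_intros)
  have du: "(u d has_real_derivative s d t) (at t)" for d t
  proof -
    have "((\<lambda>t. ln (A * \<sigma> * M (\<sigma> * (t + d)))) has_real_derivative
        1 / (A * \<sigma> * M (\<sigma> * (t + d))) * (A * \<sigma> * (M (\<sigma> * (t + d)) * (M (\<sigma> * (t + d)) - \<sigma> * (t + d)) * \<sigma>))) (at t)"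
      by (rule DERIV_chain2[where f = ln and g = "\<lambda>t. A * \<sigma> * M (\<sigma> * (t + d))",
            OF DERIV_ln_divide[OF AM] DERIV_cmult[OF dM]])
    also have "1 / (A * \<sigma> * M (\<sigma> * (t + d))) * (A * \<sigma> * (M (\<sigma> * (t + d)) * (M (\<sigma> * (t + d)) - \<sigma> * (t + d)) * \<sigma>))
        = s d t"
      unfolding s_def using A \<sigma> M(1)[of "\<sigma> * (t + d)"] by (simp add: field_simps)
    finally show ?thesis unfolding u_def .
  qed
  have ds: "(s d has_real_derivative s' d t) (at t)" for d t
    unfolding s_def s'_def
    by (rule DERIV_cong[OF DERIV_cmult[OF DERIV_diff[OF dM DERIV_cmult[of "\<lambda>t. t + d" 1 t UNIV \<sigma>]]]])
       (auto intro!: derivative_eq_intros simp: algebra_simps)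
  have spos: "s d t > 0" for d t using \<sigma> M(3) by (simp add: s_def)
  have rhs: "s' d t - profile_rhs b t (u d t) (s d t) =
      ((1 - 1 / b) * (1 - M z * (M z - z)) - \<sigma> * d * (M z - z)) / 2"
    if "z = \<sigma> * (t + d)" for d t z
  proof -
    have z: "\<sigma> * t = z - \<sigma> * d" using that by (simp add: algebra_simps)
    have "profile_rhs b t (u d t) (s d t) =
        - b * (\<sigma> * (M z - z))\<^sup>2 - (t / 2 - (1 + 1 / b) * (A * \<sigma> * M z)) * (\<sigma> * (M z - z)) - 1 / 2"
      unfolding profile_rhs_def eu s_def that ..
    also have "\<dots> = - (b * (\<sigma> * \<sigma>)) * (M z - z)\<^sup>2 - (\<sigma> * t) / 2 * (M z - z)
        + ((1 + 1 / b) * A) * (\<sigma> * \<sigma>) * M z * (M z - z) - 1 / 2"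
      by (simp add: algebra_simps power2_eq_square diff_divide_distrib)
    also have "\<dots> = - (1 / 2) * (M z - z)\<^sup>2 - (z - \<sigma> * d) / 2 * (M z - z) + M z * (M z - z) - 1 / 2"
      unfolding A(2) \<sigma>(2) z using b by simp
    also have "\<dots> = (M z * (M z - z) - 1) / 2 + \<sigma> * d * (M z - z) / 2"
      by (simp add: field_simps power2_eq_square)
    finally have r: "profile_rhs b t (u d t) (s d t) = (M z * (M z - z) - 1) / 2 + \<sigma> * d * (M z - z) / 2" .
    have "s' d t = 1 / (2 * b) * (M z * (M z - z) - 1)"
      unfolding s'_def \<sigma>(2) that ..
    then show ?thesis unfolding r using b by (simp add: field_simps)
  qed
  have key: "\<bar>(1 - 1 / b) * (1 - M z * (M z - z))\<bar> \<le> \<sigma> * \<delta> * (M z - z)" for z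
  proof -
    have "\<bar>(1 - 1 / b) * (1 - M z * (M z - z))\<bar> = \<bar>1 - 1 / b\<bar> * (1 - M z * (M z - z))"
      using M(5)[of z] by (simp add: abs_mult)
    also have "\<dots> \<le> \<bar>1 - 1 / b\<bar> * (L * (M z - z))" by (intro mult_left_mono M) auto
    also have "\<dots> = (L * \<bar>1 - 1 / b\<bar>) * (M z - z)" by simp
    also have "\<dots> \<le> \<sigma> * \<delta> * (M z - z)" using M(3)[of z] \<delta> by (intro mult_right_mono) auto
    finally show ?thesis .
  qed
  have Mmono: "M x \<le> M y" if "x \<le> y" for x y
    using that
  proof (rule DERIV_nonneg_imp_nondecreasing)
    fix z show "\<exists>d. (M has_real_derivative d) (at z) \<and> 0 \<le> d"
      using M(2)[of z] mult_pos_pos[OF M(1)[of z], of "M z - z"] M(3)[of z]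
      by (auto intro: less_imp_le)
  qed
  obtain B where B: "B > 0" "\<And>z. z \<le> \<sigma> * \<delta> \<Longrightarrow> M z \<le> B * exp (- z\<^sup>2 / 2)"
    using M(8)[of "\<sigma> * \<delta>"] by blast
  have lims: "((\<lambda>t. exp (u d t) / t) \<longlongrightarrow> b / (b + 1)) at_top" for d
  proof (rule tendsto_sandwich)
    have ev: "\<forall>\<^sub>F t in at_top. t > \<bar>d\<bar>" by (rule eventually_gt_at_top)
    show "\<forall>\<^sub>F t in at_top. A * \<sigma> * (\<sigma> * (t + d)) / t \<le> exp (u d t) / t"
      using ev
    proof eventually_elim
      case (elim t)
      then show ?case unfolding eu using A \<sigma> M(3)[of "\<sigma> * (t + d)"]
        by (intro divide_right_mono mult_left_mono) auto
    qed
    show "\<forall>\<^sub>F t in at_top. exp (u d t) / t \<le> A * \<sigma> * (\<sigma> * (t + d) + 1 / (\<sigma> * (t + d))) / t"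
      using ev
    proof eventually_elim
      case (elim t)
      then have "\<sigma> * (t + d) > 0" using \<sigma> by simp
      from M(4)[OF this] show ?case unfolding eu using A \<sigma> elim
        by (intro divide_right_mono mult_left_mono) auto
    qed
    have "((\<lambda>t. A * \<sigma> * (\<sigma> * (t + d)) / t) \<longlongrightarrow> A * (\<sigma> * \<sigma>)) at_top"
      using \<sigma>(1) A(1) by real_asymp
    then show "((\<lambda>t. A * \<sigma> * (\<sigma> * (t + d)) / t) \<longlongrightarrow> b / (b + 1)) at_top" by (simp only: A(3))
    have "((\<lambda>t. A * \<sigma> * (\<sigma> * (t + d) + 1 / (\<sigma> * (t + d))) / t) \<longlongrightarrow> A * (\<sigma> * \<sigma>)) at_top"
      using \<sigma>(1) A(1) by real_asymp
    then show "((\<lambda>t. A * \<sigma> * (\<sigma> * (t + d) + 1 / (\<sigma> * (t + d))) / t) \<longlongrightarrow> b / (b + 1)) at_top"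
      by (simp only: A(3))
  qed
  have "barriers b \<delta> (ln (A * \<sigma> * B)) (u (-\<delta>)) (s (-\<delta>)) (s' (-\<delta>)) (u \<delta>) (s \<delta>) (s' \<delta>)"
  proof
    show "b > 0" by (rule b)
    fix t
    show "profile_rhs b t (u (- \<delta>) t) (s (- \<delta>) t) \<le> s' (- \<delta>) t"
      using rhs[OF refl, of "-\<delta>" t] key[of "\<sigma> * (t + - \<delta>)"] by (simp add: abs_le_iff)
    show "s' \<delta> t \<le> profile_rhs b t (u \<delta> t) (s \<delta> t)"
      using rhs[OF refl, of \<delta> t] key[of "\<sigma> * (t + \<delta>)"] by (simp add: abs_le_iff)
    have "M (\<sigma> * (t + - \<delta>)) \<le> M (\<sigma> * (t + \<delta>))" using \<sigma> \<delta> by (intro Mmono mult_left_mono) auto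
    then have "A * \<sigma> * M (\<sigma> * (t + - \<delta>)) \<le> A * \<sigma> * M (\<sigma> * (t + \<delta>))" using A \<sigma> by (intro mult_left_mono) auto
    then show "u (- \<delta>) t \<le> u \<delta> t"
      unfolding u_def using AM by (subst ln_le_cancel_iff) auto
    show "u \<delta> t \<le> ln (A * \<sigma> * B) - (t + \<delta>)\<^sup>2 / (4 * b)" if "t \<le> 0"
    proof -
      have "\<sigma> * (t + \<delta>) \<le> \<sigma> * \<delta>" using that \<sigma> by simp
      from B(2)[OF this] have "A * \<sigma> * M (\<sigma> * (t + \<delta>)) \<le> A * \<sigma> * (B * exp (- (\<sigma> * (t + \<delta>))\<^sup>2 / 2))"
        using A \<sigma> by (intro mult_left_mono) auto
      then have "u \<delta> t \<le> ln (A * \<sigma> * B * exp (- (\<sigma> * (t + \<delta>))\<^sup>2 / 2))"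
        unfolding u_def using AM[of "\<sigma> * (t + \<delta>)"] A \<sigma> B by (subst ln_le_cancel_iff) (auto simp: mult.assoc)
      also have "\<dots> = ln (A * \<sigma> * B) + (- (\<sigma> * (t + \<delta>))\<^sup>2 / 2)"
        using A \<sigma> B by (subst ln_mult) auto
      also have "(\<sigma> * (t + \<delta>))\<^sup>2 = (t + \<delta>)\<^sup>2 / (2 * b)"
        using \<sigma>(2) by (simp add: power_mult_distrib power2_eq_square[of \<sigma>])
      finally show ?thesis by simp
    qed
  next
    have M0: "(M \<longlongrightarrow> 0) at_bot"
    proof (rule tendsto_sandwich)
      show "\<forall>\<^sub>F z in at_bot. 0 \<le> M z" by (intro always_eventually allI less_imp_le M)
      show "\<forall>\<^sub>F z in at_bot. M z \<le> B * exp (- z\<^sup>2 / 2)"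
        using eventually_le_at_bot[of "\<sigma> * \<delta>"] by eventually_elim (rule B)
      show "((\<lambda>z. B * exp (- z\<^sup>2 / 2)) \<longlongrightarrow> 0) at_bot" using B(1) by real_asymp
    qed simp
    have fl: "filterlim (\<lambda>x. \<sigma> * (- x + \<delta>)) at_bot at_top" using \<sigma>(1) by real_asymp
    have "((\<lambda>x. (1 - b) / b / x - \<sigma> * M (\<sigma> * (- x + \<delta>)) + \<delta> / (2 * b)) \<longlongrightarrow> 0 - \<sigma> * 0 + \<delta> / (2 * b)) at_top"
      by (intro tendsto_intros filterlim_compose[OF M0 fl]) real_asymp
    then have e1: "\<forall>\<^sub>F x in at_top. (1 - b) / b / x - \<sigma> * M (\<sigma> * (- x + \<delta>)) + \<delta> / (2 * b) > 0"
      by (rule order_tendstoD) (use \<delta> b in simp)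
    have "((\<lambda>x. \<delta> / (2 * b) - (1 - b) / b / x) \<longlongrightarrow> \<delta> / (2 * b) - 0) at_top"
      by (intro tendsto_intros) real_asymp
    then have e2: "\<forall>\<^sub>F x in at_top. \<delta> / (2 * b) - (1 - b) / b / x > 0"
      by (rule order_tendstoD) (use \<delta> b in simp)
    \<comment> \<open>Far to the left the Mills term is negligible and the shift changes the slope
      by the constant - d / (2 b), which outweighs the correction of order 1/x. Hence the
      supersolution has the smaller slope there and the subsolution the larger one, the order that
      the maximum principle needs at the left end.\<close>
    have s_eq: "s d (- x) = \<sigma> * M (\<sigma> * (- x + d)) + (x - d) / (2 * b)" for d x
    proof -
      have "s d (- x) = \<sigma> * M (\<sigma> * (- x + d)) + \<sigma> * \<sigma> * (x - d)"
        by (simp add: s_def algebra_simps)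
      then show ?thesis by (simp only: \<sigma>(2)) simp
    qed
    show "\<forall>\<^sub>F x in at_top. s \<delta> (- x) < x / (2 * b) + (1 - b) / b / x
        \<and> x / (2 * b) + (1 - b) / b / x < s (- \<delta>) (- x)"
      using e1 e2
    proof eventually_elim
      case (elim x)
      have "\<sigma> * M (\<sigma> * (- x + - \<delta>)) > 0" using \<sigma> M(1) by simp
      then show ?case unfolding s_eq using elim by (simp add: diff_divide_distrib add_divide_distrib)
    qed
  qed (use du ds spos lims in auto)
  then show ?thesis by (rule that)
qed

section \<open>Entire solutions between the barriers\<close>

lemma exp_lipschitz_atMost:
  fixes x y :: real
  assumes "x \<le> c" "y \<le> c"
  shows "\<bar>exp x - exp y\<bar> \<le> exp c * \<bar>x - y\<bar>"
proof -
  have *: "exp x - exp y \<le> exp c * (x - y)" if "y \<le> x" "x \<le> c" for x y :: real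
  proof -
    have "exp x - exp y = exp x * (1 - exp (y - x))" by (simp add: exp_diff right_diff_distrib)
    also have "1 - exp (y - x) \<le> x - y" using exp_ge_add_one_self[of "y - x"] by linarith
    also have "exp x * (x - y) \<le> exp c * (x - y)" using that by (intro mult_right_mono) auto
    finally show ?thesis by simp
  qed
  show ?thesis
  proof (cases "y \<le> x")
    case True
    then show ?thesis using *[of y x] assms by simp
  next
    case False
    then show ?thesis using *[of x y] assms by simp
  qed
qed

text \<open>The strip is bounded in u only from above, as exp is Lipschitz on every left half-line.
  This matches the shooting argument, which caps u by \<open>min u c\<close> and lets it run freely
  downwards.\<close>

lemma profile_rhs_lipschitz:
  assumes "b > 0" "n \<ge> 0" "P \<ge> 0"
  obtains L where "L > 0"
    "\<And>t u v p r. \<bar>t\<bar> \<le> n \<Longrightarrow> u \<le> c \<Longrightarrow> v \<le> c \<Longrightarrow> 0 \<le> p \<Longrightarrow> p \<le> P \<Longrightarrow> 0 \<le> r \<Longrightarrow> r \<le> P \<Longrightarrow>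
      \<bar>profile_rhs b t u p - profile_rhs b t v r\<bar> \<le> L * (\<bar>u - v\<bar> + \<bar>p - r\<bar>)"
proof -
  define q where "q = 1 + 1 / b"
  have q: "q > 0" using assms by (simp add: q_def add_pos_pos)
  define L where "L = 2 * b * P + n / 2 + q * exp c * P + q * exp c"
  have "q * exp c > 0" "2 * b * P \<ge> 0" "q * exp c * P \<ge> 0" using q assms by auto
  then have "L > 0" using assms unfolding L_def by linarith
  moreover have "\<bar>profile_rhs b t u p - profile_rhs b t v r\<bar> \<le> L * (\<bar>u - v\<bar> + \<bar>p - r\<bar>)"
    if h: "\<bar>t\<bar> \<le> n" "u \<le> c" "v \<le> c" "0 \<le> p" "p \<le> P" "0 \<le> r" "r \<le> P" for t u v p r
  proof -
    have "profile_rhs b t u p - profile_rhs b t v r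
        = - (b * (p + r) * (p - r)) - t / 2 * (p - r) + q * (exp u - exp v) * p + q * exp v * (p - r)"
      by (simp add: profile_rhs_def q_def[symmetric] power2_eq_square algebra_simps diff_divide_distrib)
    also have "\<bar>\<dots>\<bar> \<le> \<bar>b * (p + r) * (p - r)\<bar> + \<bar>t / 2 * (p - r)\<bar> + \<bar>q * (exp u - exp v) * p\<bar> + \<bar>q * exp v * (p - r)\<bar>"
      by linarith
    also have "\<bar>b * (p + r) * (p - r)\<bar> \<le> (2 * b * P) * \<bar>p - r\<bar>"
      unfolding abs_mult using h assms by (intro mult_right_mono) auto
    also have "\<bar>t / 2 * (p - r)\<bar> \<le> n / 2 * \<bar>p - r\<bar>"
      unfolding abs_mult using h by (intro mult_right_mono) auto
    also have "\<bar>q * (exp u - exp v) * p\<bar> \<le> q * (exp c * \<bar>u - v\<bar>) * P"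
      unfolding abs_mult using h q exp_lipschitz_atMost[OF h(2,3)] by (intro mult_mono) auto
    also have "\<bar>q * exp v * (p - r)\<bar> \<le> q * exp c * \<bar>p - r\<bar>"
      unfolding abs_mult using h q by (intro mult_mono) auto
    finally have "\<bar>profile_rhs b t u p - profile_rhs b t v r\<bar>
        \<le> (2 * b * P) * \<bar>p - r\<bar> + n / 2 * \<bar>p - r\<bar> + q * (exp c * \<bar>u - v\<bar>) * P + q * exp c * \<bar>p - r\<bar>"
      by simp
    also have "\<dots> = (2 * b * P + n / 2 + q * exp c) * \<bar>p - r\<bar> + (q * exp c * P) * \<bar>u - v\<bar>"
      by (simp add: algebra_simps)
    also have "\<dots> \<le> L * \<bar>p - r\<bar> + L * \<bar>u - v\<bar>"
      using q assms by (intro add_mono mult_right_mono) (auto simp: L_def)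
    finally show ?thesis by (simp add: algebra_simps)
  qed
  ultimately show ?thesis by (rule that)
qed

text \<open>For large P the damping - b P^2 beats the terms linear in P. Together with
  \<open>negative_barrier\<close> this bounds the slope from above.\<close>

lemma profile_rhs_neg:
  assumes "b > 0" "\<bar>t\<bar> \<le> n" "u \<le> c" "P \<ge> 0" "b * P \<ge> n / 2 + (1 + 1 / b) * exp c"
  shows "profile_rhs b t u P < 0"
proof -
  have "(1 + 1 / b) * exp u \<le> (1 + 1 / b) * exp c" using assms by (intro mult_left_mono) auto
  then have "b * P + t / 2 - (1 + 1 / b) * exp u \<ge> 0" using assms by linarith
  then have "P * (b * P + t / 2 - (1 + 1 / b) * exp u) \<ge> 0" using assms by simp
  moreover have "profile_rhs b t u P = - (P * (b * P + t / 2 - (1 + 1 / b) * exp u)) - 1 / 2"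
    by (simp add: profile_rhs_def power2_eq_square algebra_simps)
  ultimately show ?thesis by linarith
qed

text \<open>For p > 0 this has the sign of u - v: the monotonicity on which the comparison with the
  barriers rests.\<close>

lemma profile_rhs_diff:
  "profile_rhs b t u p - profile_rhs b t v p = (1 + 1 / b) * (exp u - exp v) * p"
  by (simp add: profile_rhs_def algebra_simps)

section \<open>Boundary value problems on bounded intervals\<close>

context barriers
begin

lemma up_strict_mono: "s < t \<Longrightarrow> up s < up t"
  using up pp_pos by (blast intro: DERIV_pos_imp_increasing)

lemma up_mono: "s \<le> t \<Longrightarrow> up s \<le> up t"
  using up_strict_mono[of s t] by (cases "s = t") auto

text \<open>The conditions are u' = P0 at -n and u = \<open>up\<close> at n. For the truncated
  field, the end value u(n) stays within a fixed distance of the initial value u(-n) and depends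
  continuously on it, so the intermediate value theorem hits \<open>up n\<close>. The solution found
  then turns out to stay where the truncation does nothing.\<close>

lemma boundary_value_problem:
  assumes n: "n > 0" and P0: "pp (- n) < P0" "P0 < pm (- n)"
  obtains u p where
    "\<And>t. t \<in> {-n..n} \<Longrightarrow> (u has_real_derivative p t) (at t within {-n..n})"
    "\<And>t. t \<in> {-n..n} \<Longrightarrow> (p has_real_derivative profile_rhs b t (u t) (p t)) (at t within {-n..n})"
    "p (- n) = P0" "\<And>t. t \<in> {-n..n} \<Longrightarrow> um t \<le> u t" "\<And>t. t \<in> {-n..n} \<Longrightarrow> u t \<le> up t"
    "\<And>t. t \<in> {-n..n} \<Longrightarrow> 0 \<le> p t"
proof -
  define q where "q = 1 + 1 / b"
  have q: "q > 0" using b by (simp add: q_def add_pos_pos)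
  have P0pos: "P0 > 0" using P0 pp_pos[of "- n"] by simp
  \<comment> \<open>The margin 1 keeps the cap strictly above \<open>up\<close>, so that u >
    \<open>up\<close> survives the replacement of u by \<open>min u c\<close> in the
    comparison.\<close>
  define c where "c = up n + 1"
  have upc: "up t < c" if "t \<le> n" for t using up_mono[OF that] by (simp add: c_def)
  have cpp: "continuous_on {-n..n} pp"
    by (rule DERIV_continuous_on[where D = pp']) (rule has_field_derivative_at_within[OF pp])
  have cpm: "continuous_on {-n..n} pm"
    by (rule DERIV_continuous_on[where D = pm']) (rule has_field_derivative_at_within[OF pm])
  obtain P1 where P1: "\<And>t. t \<in> {-n..n} \<Longrightarrow> pp t \<le> P1"
    using continuous_attains_sup[OF compact_Icc _ cpp] n by fastforce
  obtain P2 where P2: "\<And>t. t \<in> {-n..n} \<Longrightarrow> pm t \<le> P2"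
    using continuous_attains_sup[OF compact_Icc _ cpm] n by fastforce
  \<comment> \<open>P exceeds the initial slope strictly, lies above both barrier slopes so that
    \<open>T\<close> leaves them unchanged, and reaches the threshold of
    \<open>profile_rhs_neg\<close>.\<close>
  define P where "P = Max {P0 + 1, P1, P2, (n / 2 + q * exp c) / b}"
  have P: "P \<ge> P0 + 1" "P \<ge> P1" "P \<ge> P2" "P \<ge> (n / 2 + q * exp c) / b"
    by (auto simp: P_def)
  have bP: "b * P \<ge> n / 2 + (1 + 1 / b) * exp c" using P(4) b by (simp add: q_def field_simps)
  have Pnn: "P \<ge> 0" using P P0pos by simp
  define cl where "cl = (\<lambda>t. max (- n) (min n t))"
  define T where "T = (\<lambda>p. max 0 (min P p))"
  define Ft where "Ft = (\<lambda>t u p. profile_rhs b (cl t) (min u c) (T p))"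
  define G where "G = (\<lambda>t (y :: real \<times> real). (snd y, Ft t (fst y) (snd y)))"
  have Tid: "T p = p" if "0 \<le> p" "p \<le> P" for p using that by (simp add: T_def)
  have clid: "cl t = t" if "t \<in> {-n..n}" for t using that by (simp add: cl_def)
  have clb: "\<bar>cl t\<bar> \<le> n" for t using n by (auto simp: cl_def)
  have Tb: "0 \<le> T p" "T p \<le> P" for p using Pnn by (auto simp: T_def)
  obtain L where L: "L > 0"
    "\<And>t u v p r. \<bar>t\<bar> \<le> n \<Longrightarrow> u \<le> c \<Longrightarrow> v \<le> c \<Longrightarrow> 0 \<le> p \<Longrightarrow> p \<le> P \<Longrightarrow> 0 \<le> r \<Longrightarrow> r \<le> P \<Longrightarrow>
      \<bar>profile_rhs b t u p - profile_rhs b t v r\<bar> \<le> L * (\<bar>u - v\<bar> + \<bar>p - r\<bar>)"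
    using profile_rhs_lipschitz[OF b, of n P c] n Pnn by (metis less_imp_le)
  have FtL: "\<bar>Ft t u p - Ft t v r\<bar> \<le> L * (\<bar>u - v\<bar> + \<bar>p - r\<bar>)" for t u v p r
  proof -
    have "\<bar>Ft t u p - Ft t v r\<bar> \<le> L * (\<bar>min u c - min v c\<bar> + \<bar>T p - T r\<bar>)"
      unfolding Ft_def by (rule L(2)) (use clb Tb in auto)
    also have "\<dots> \<le> L * (\<bar>u - v\<bar> + \<bar>p - r\<bar>)"
      using L(1) by (intro mult_left_mono add_mono) (auto simp: T_def)
    finally show ?thesis .
  qed
  have fstn: "\<bar>fst x\<bar> \<le> norm x" and sndn: "\<bar>snd x\<bar> \<le> norm x" for x :: "real \<times> real"
    using norm_fst_le[of "fst x" "snd x"] norm_snd_le[of "snd x" "fst x"] by simp_all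
  have GL: "norm (G t y - G t z) \<le> (1 + 2 * L) * norm (y - z)" for t y z
  proof -
    have f: "\<bar>fst y - fst z\<bar> \<le> norm (y - z)" "\<bar>snd y - snd z\<bar> \<le> norm (y - z)"
      using fstn[of "y - z"] sndn[of "y - z"] by simp_all
    have "norm (G t y - G t z) \<le> \<bar>snd y - snd z\<bar> + \<bar>Ft t (fst y) (snd y) - Ft t (fst z) (snd z)\<bar>"
      using norm_Pair_le[of "snd y - snd z" "Ft t (fst y) (snd y) - Ft t (fst z) (snd z)"]
      by (simp add: G_def)
    also have "\<dots> \<le> norm (y - z) + L * (norm (y - z) + norm (y - z))"
      using f L(1) by (intro add_mono order_trans[OF FtL] mult_left_mono) auto
    finally show ?thesis by (simp add: algebra_simps)
  qed
  have Gc: "continuous_on UNIV (\<lambda>(t, y). G t y)"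
    unfolding G_def Ft_def profile_rhs_def cl_def T_def case_prod_beta
    by (intro continuous_intros) auto
  define B where "B = b * P\<^sup>2 + (n / 2 + q * exp c) * P + 1 / 2"
  have FB: "\<bar>Ft t u p\<bar> \<le> B" for t u p
  proof -
    have 1: "(T p)\<^sup>2 \<le> P\<^sup>2" using Tb[of p] by (intro power_mono) auto
    have "q * exp (min u c) \<le> q * exp c" using q by simp
    moreover have "q * exp (min u c) > 0" using q by simp
    ultimately have "\<bar>cl t / 2 - q * exp (min u c)\<bar> \<le> n / 2 + q * exp c"
      using clb[of t] by linarith
    then have "\<bar>(cl t / 2 - q * exp (min u c)) * T p\<bar> \<le> (n / 2 + q * exp c) * P"
      unfolding abs_mult using Tb[of p] n by (intro mult_mono) auto
    moreover have "\<bar>b * (T p)\<^sup>2\<bar> \<le> b * P\<^sup>2" using 1 b by simp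
    ultimately show ?thesis unfolding Ft_def profile_rhs_def B_def q_def[symmetric] by linarith
  qed
  have "\<exists>y. y (- n) = (s, P0) \<and>
      (\<forall>t\<in>{-n..n}. (y has_vector_derivative G t (y t)) (at t within {-n..n}))" for s
    by (rule lipschitz_ode_solution[OF Gc GL, of "- n" n "(s, P0)"]) (use L n in auto)
  then obtain Y where Y0: "\<And>s. Y s (- n) = (s, P0)"
    and Y: "\<And>s t. t \<in> {-n..n} \<Longrightarrow> (Y s has_vector_derivative G t (Y s t)) (at t within {-n..n})"
    by metis
  have dfst: "((\<lambda>t. fst (Y s t)) has_real_derivative snd (Y s t)) (at t within {-n..n})"
    if "t \<in> {-n..n}" for s t
    using bounded_linear.has_vector_derivative[OF bounded_linear_fst Y[OF that]]
    by (simp add: has_real_derivative_iff_has_vector_derivative G_def)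
  have dsnd: "((\<lambda>t. snd (Y s t)) has_real_derivative Ft t (fst (Y s t)) (snd (Y s t))) (at t within {-n..n})"
    if "t \<in> {-n..n}" for s t
    using bounded_linear.has_vector_derivative[OF bounded_linear_snd Y[OF that]]
    by (simp add: has_real_derivative_iff_has_vector_derivative G_def)
  have mem: "- n \<in> {-n..n}" "n \<in> {-n..n}" using n by auto
  have Bnn: "B \<ge> 0" using order_trans[OF abs_ge_zero FB] .
  have sndb: "\<bar>snd (Y s t)\<bar> \<le> P0 + B * (2 * n)" if t: "t \<in> {-n..n}" for s t
  proof -
    have "norm (snd (Y s t) - snd (Y s (- n))) \<le> B * norm (t - - n)"
      by (rule field_differentiable_bound[OF _ dsnd _ t mem(1)]) (use FB in auto)
    also have "\<dots> \<le> B * (2 * n)" using t Bnn by (intro mult_left_mono) auto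
    finally show ?thesis using Y0[of s] P0pos by simp
  qed
  define C where "C = (P0 + B * (2 * n)) * (2 * n)"
  have fstb: "\<bar>fst (Y s n) - s\<bar> \<le> C" for s
  proof -
    have "norm (fst (Y s n) - fst (Y s (- n))) \<le> (P0 + B * (2 * n)) * norm (n - - n)"
      by (rule field_differentiable_bound[OF _ dfst _ mem(2) mem(1)]) (use sndb in auto)
    then show ?thesis using Y0[of s] n by (simp add: C_def)
  qed
  have Ylip: "\<bar>fst (Y s n) - fst (Y s' n)\<bar> \<le> exp ((1 + 2 * L) * (2 * n)) * \<bar>s - s'\<bar>" for s s'
  proof -
    have "norm (Y s n - Y s' n) \<le> exp ((1 + 2 * L) * \<bar>n - - n\<bar>) * norm (Y s (- n) - Y s' (- n))"
      by (rule gronwall[OF Y Y GL]) (use mem in auto)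
    then show ?thesis
      using fstn[of "Y s n - Y s' n"] n by (simp add: Y0 norm_Pair)
  qed
  have cont: "continuous_on UNIV (\<lambda>s. fst (Y s n))"
    by (rule lipschitz_on_continuous_on[OF lipschitz_onI]) (use Ylip in \<open>auto simp: dist_real_def\<close>)
  \<comment> \<open>Shooting in the free initial value u (- n) = s.\<close>
  have "\<exists>s. up n - C \<le> s \<and> s \<le> up n + C \<and> fst (Y s n) = up n"
    by (rule IVT') (use fstb[of "up n - C"] fstb[of "up n + C"] order_trans[OF abs_ge_zero fstb] in
        \<open>auto intro: continuous_on_subset[OF cont] simp: abs_le_iff\<close>)
  then obtain s where s: "fst (Y s n) = up n" by blast
  define u where "u = (\<lambda>t. fst (Y s t))"
  define p where "p = (\<lambda>t. snd (Y s t))"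
  have du: "(u has_real_derivative p t) (at t within {-n..n})" if "t \<in> {-n..n}" for t
    unfolding u_def p_def by (rule dfst[OF that])
  have dp: "(p has_real_derivative Ft t (u t) (p t)) (at t within {-n..n})" if "t \<in> {-n..n}" for t
    unfolding u_def p_def by (rule dsnd[OF that])
  have un: "u n = up n" using s by (simp add: u_def)
  have pn: "p (- n) = P0" by (simp add: p_def Y0)
  have up_w: "(up has_real_derivative pp t) (at t within S)" "(pp has_real_derivative pp' t) (at t within S)"
    "(um has_real_derivative pm t) (at t within S)" "(pm has_real_derivative pm' t) (at t within S)" for t S
    using up pp um pm by (auto intro: has_field_derivative_at_within)
  \<comment> \<open>The comparison is run on the truncated equation: at a point where the slopes
    agree, p t = pp t lies between 0 and P, so the cut-off of the slope is inactive exactly where it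
    is tested.\<close>
  have le_up: "u t \<le> up t" if t: "t \<in> {-n..n}" for t
  proof -
    have "u t - up t \<le> 0"
    proof (rule maximum_principle[of "- n" n "\<lambda>t. u t - up t" "\<lambda>t. p t - pp t"
          "\<lambda>t. Ft t (u t) (p t) - pp' t", OF _ _ _ _ _ t])
      fix t assume t: "t \<in> {-n..n}" and w: "u t - up t > 0" and v: "p t - pp t = 0"
      have Tp: "T (p t) = pp t" using v Tid[of "pp t"] pp_pos[of t] P1[OF t] P(2) by auto
      have "exp (min (u t) c) > exp (up t)" using w upc[of t] t by simp
      then have "(1 + 1 / b) * (exp (min (u t) c) - exp (up t)) * pp t > 0"
        using q pp_pos[of t] by (simp add: q_def)
      then have "Ft t (u t) (p t) > profile_rhs b t (up t) (pp t)"
        using profile_rhs_diff[of b t "min (u t) c" "pp t" "up t"]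
        unfolding Ft_def Tp clid[OF t] by linarith
      then show "Ft t (u t) (p t) - pp' t > 0" using super[of t] by simp
    qed (use du dp up_w P0 un pn in \<open>auto intro!: DERIV_diff\<close>)
    then show ?thesis by simp
  qed
  have ge_um: "um t \<le> u t" if t: "t \<in> {-n..n}" for t
  proof -
    have "um t - u t \<le> 0"
    proof (rule maximum_principle[of "- n" n "\<lambda>t. um t - u t" "\<lambda>t. pm t - p t"
          "\<lambda>t. pm' t - Ft t (u t) (p t)", OF _ _ _ _ _ t])
      fix t assume t: "t \<in> {-n..n}" and w: "um t - u t > 0" and v: "pm t - p t = 0"
      have Tp: "T (p t) = pm t" using v Tid[of "pm t"] pm_pos[of t] P2[OF t] P(3) by auto
      have mn: "min (u t) c = u t" using w um_le_up[of t] upc[of t] t by simp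
      have "(1 + 1 / b) * (exp (um t) - exp (u t)) * pm t > 0"
        using q w pm_pos[of t] by (simp add: q_def)
      then have "Ft t (u t) (p t) < profile_rhs b t (um t) (pm t)"
        using profile_rhs_diff[of b t "um t" "pm t" "u t"]
        unfolding Ft_def Tp clid[OF t] mn by linarith
      then show "pm' t - Ft t (u t) (p t) > 0" using sub[of t] by simp
    qed (use du dp up_w P0 un pn um_le_up in \<open>auto intro!: DERIV_diff\<close>)
    then show ?thesis by simp
  qed
  \<comment> \<open>Touching \<open>up\<close> from below at n forces p n \<ge> pp n > 0. At slope 0
    the field equals -1/2, so a slope that is negative somewhere would stay negative up to n, which
    is now excluded.\<close>
  have pn_ge: "p n \<ge> pp n"
  proof (rule ccontr)
    assume "\<not> p n \<ge> pp n"
    then have neg: "p n - pp n < 0" by simp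
    have "((\<lambda>t. u t - up t) has_real_derivative p n - pp n) (at n within {-n..n})"
      by (intro DERIV_diff du up_w mem)
    from has_real_derivative_neg_dec_left[OF this neg] obtain d where
      d: "d > 0" "\<And>h. 0 < h \<Longrightarrow> n - h \<in> {-n..n} \<Longrightarrow> h < d \<Longrightarrow> u n - up n < u (n - h) - up (n - h)" by blast
    define h where "h = min (d / 2) n"
    have "0 < h" "h < d" "n - h \<in> {-n..n}" using d n by (auto simp: h_def)
    then show False using d(2)[of h] le_up[of "n - h"] un by simp
  qed
  have pnn: "p t \<ge> 0" if t: "t \<in> {-n..n}" for t
  proof (rule ccontr)
    assume neg: "\<not> p t \<ge> 0"
    have "p n < 0"
    proof (rule negative_barrier[of t n p "\<lambda>t. Ft t (u t) (p t)"])
      show "(p has_real_derivative Ft x (u x) (p x)) (at x within {t..n})" if "x \<in> {t..n}" for x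
        by (rule DERIV_subset[OF dp]) (use that t in auto)
      show "Ft x (u x) (p x) < 0" if "p x = 0" for x
        using that Pnn by (simp add: Ft_def T_def profile_rhs_def)
    qed (use neg t in auto)
    then show False using pn_ge pp_pos[of n] by simp
  qed
  have pP: "p t < P" if t: "t \<in> {-n..n}" for t
  proof -
    have "p t - P < 0"
    proof (rule negative_barrier[of "- n" n "\<lambda>t. p t - P" "\<lambda>t. Ft t (u t) (p t)", OF _ _ _ t])
      show "((\<lambda>t. p t - P) has_real_derivative Ft t (u t) (p t)) (at t within {-n..n})" if "t \<in> {-n..n}" for t
        using DERIV_diff[OF dp[OF that] DERIV_const[of P]] by simp
      show "p (- n) - P < 0" using pn P by simp
      show "Ft t (u t) (p t) < 0" if "p t - P = 0" for t
        using profile_rhs_neg[OF b clb _ Pnn bP, of "min (u t) c" t] that Tid[of P] Pnn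
        by (simp add: Ft_def)
    qed
    then show ?thesis by simp
  qed
  have Ft: "Ft t (u t) (p t) = profile_rhs b t (u t) (p t)" if t: "t \<in> {-n..n}" for t
  proof -
    have "u t \<le> c" using le_up[OF t] upc[of t] t by simp
    then show ?thesis using clid[OF t] Tid[OF pnn[OF t]] pP[OF t] by (simp add: Ft_def)
  qed
  show ?thesis
    by (rule that[of u p]) (use du dp Ft pn ge_um le_up pnn in auto)
qed

end

text \<open>The value a = (1 - b) / b is the one that cancels the constant terms in t, the t^2 terms
  having cancelled already. What is left is of order 1/t^2 with leading coefficient b a^2 + a + g/2,
  so a large g of either sign decides the sign.\<close>

lemma profile_rhs_expansion:
  fixes b g t :: real
  assumes "b \<noteq> 0" "t \<noteq> 0"
  defines "a \<equiv> (1 - b) / b"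
  defines "U \<equiv> - t / (2 * b) - a / t - g / t ^ 3"
  shows "- b * U\<^sup>2 - t / 2 * U - 1 / 2 - (- 1 / (2 * b) + a / t\<^sup>2 + 3 * g / t ^ 4) =
    - (1 / t\<^sup>2 * (b * a\<^sup>2 + a + g / 2 + (2 * b * a + 3) * g * (1 / t\<^sup>2) + b * g\<^sup>2 * (1 / t\<^sup>2)\<^sup>2))"
proof -
  \<comment> \<open>Naming the inverses of b and t, and doubling U, turns the identity into a
    polynomial one modulo b c = 1 and t y = 1.\<close>
  define c y where "c = 1 / b" and "y = 1 / t"
  have cy: "b * c = 1" "t * y = 1" using assms by (simp_all add: c_def y_def)
  have a: "a = c - 1" using assms by (simp add: a_def c_def field_simps)
  define V where "V = 2 * U"
  have V: "V = - t * c - 2 * a * y - 2 * g * y ^ 3"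
    by (simp add: V_def U_def c_def y_def power_one_over)
  have e: "1 / t\<^sup>2 = y\<^sup>2" "- 1 / (2 * b) = - c / 2" "a / t\<^sup>2 = a * y\<^sup>2" "3 * g / t ^ 4 = 3 * g * y ^ 4"
    by (simp_all add: c_def y_def power_one_over)
  have "- b * V\<^sup>2 - t * V - 2 + 2 * c - 4 * a * y\<^sup>2 - 12 * g * y ^ 4 =
     - (y\<^sup>2 * (4 * b * a\<^sup>2 + 4 * a + 2 * g + 4 * (2 * b * a + 3) * g * y\<^sup>2 + 4 * b * g\<^sup>2 * (y\<^sup>2)\<^sup>2))"
    using cy a V by algebra
  then show ?thesis unfolding e V_def by (simp add: field_simps)
qed

section \<open>Control of the slope near -infinity and passage to the whole line\<close>

context barriers
begin

text \<open>The tail f' = exp (- x^2/4) |x|^(b-1) corresponds to u' = slope 0; the parameter g bounds the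
  remainder.\<close>

definition slope :: "real \<Rightarrow> real \<Rightarrow> real" where
  "slope g t = - t / (2 * b) - (1 - b) / b / t - g / t ^ 3"

lemma slope_deriv:
  "t \<noteq> 0 \<Longrightarrow> (slope g has_real_derivative (- 1 / (2 * b) + (1 - b) / b / t\<^sup>2 + 3 * g / t ^ 4)) (at t)"
  unfolding slope_def using b
  by (auto intro!: derivative_eq_intros simp: field_simps eval_nat_numeral)

text \<open>The exponential term is negligible by the Gaussian bound \<open>decay\<close>, so the
  residual of \<open>slope g\<close> has the sign of - g / t^2: solutions can cross
  \<open>slope g\<close> only downwards and \<open>slope (- g)\<close> only upwards. They start on
  \<open>slope 0\<close>, between the two. R and g are fixed before n, which makes the trap uniform
  in n.\<close>

lemma slope_trap:
  obtains R g where "R \<ge> 1"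
    "\<And>x. x \<ge> R \<Longrightarrow> pp (- x) < slope 0 (- x) \<and> slope 0 (- x) < pm (- x)"
    "\<And>n u p t. n \<ge> R \<Longrightarrow>
       (\<And>t. t \<in> {-n..n} \<Longrightarrow> (p has_real_derivative profile_rhs b t (u t) (p t)) (at t within {-n..n})) \<Longrightarrow>
       p (- n) = slope 0 (- n) \<Longrightarrow> (\<And>t. t \<in> {-n..n} \<Longrightarrow> u t \<le> up t) \<Longrightarrow>
       t \<in> {-n..-R} \<Longrightarrow> slope (- g) t \<le> p t \<and> p t \<le> slope g t"
proof -
  define a where "a = (1 - b) / b"
  define q where "q = 1 + 1 / b"
  have q: "q > 0" using b by (simp add: q_def add_pos_pos)
  \<comment> \<open>This size makes b a^2 + a + g/2 at least 1 and b a^2 + a - g/2 at most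
    -1.\<close>
  define g where "g = 2 * (\<bar>b * a\<^sup>2 + a\<bar> + 1)"
  have g: "g > 0" "b * a\<^sup>2 + a + g / 2 \<ge> 1" "b * a\<^sup>2 + a - g / 2 \<le> - 1"
  proof -
    define m where "m = b * a\<^sup>2 + a"
    have "g = 2 * \<bar>m\<bar> + 2" by (simp add: g_def m_def)
    moreover have "\<bar>m\<bar> \<ge> 0" "m \<le> \<bar>m\<bar>" "- m \<le> \<bar>m\<bar>" by simp_all
    ultimately have "g > 0" "m + g / 2 \<ge> 1" "m - g / 2 \<le> - 1" by linarith+
    then show "g > 0" "b * a\<^sup>2 + a + g / 2 \<ge> 1" "b * a\<^sup>2 + a - g / 2 \<le> - 1"
      by (simp_all add: m_def)
  qed
  \<comment> \<open>Each error term is granted a quarter of that margin of 1, for t below some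
    -R.\<close>
  have small: "\<forall>\<^sub>F x in at_top. f x \<le> 1 / 4" if "(f \<longlongrightarrow> 0) at_top" for f :: "real \<Rightarrow> real"
    using order_tendstoD(2)[OF that, of "1 / 4"] by (auto elim: eventually_mono)
  have e1: "\<forall>\<^sub>F x in at_top. \<bar>2 * b * a + 3\<bar> * g * (1 / x\<^sup>2) \<le> 1 / 4"
  proof -
    have "((\<lambda>x::real. \<bar>2 * b * a + 3\<bar> * g * (1 / x\<^sup>2)) \<longlongrightarrow> \<bar>2 * b * a + 3\<bar> * g * 0) at_top"
      by (intro tendsto_intros) real_asymp
    then show ?thesis by (intro small) simp
  qed
  have e2: "\<forall>\<^sub>F x in at_top. b * g\<^sup>2 * (1 / x\<^sup>2)\<^sup>2 \<le> 1 / 4"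
  proof -
    have "((\<lambda>x::real. b * g\<^sup>2 * (1 / x\<^sup>2)\<^sup>2) \<longlongrightarrow> b * g\<^sup>2 * 0) at_top"
      by (intro tendsto_intros) real_asymp
    then show ?thesis by (intro small) simp
  qed
  have e3: "\<forall>\<^sub>F x in at_top. q * exp (K - (- x + \<delta>)\<^sup>2 / (4 * b)) * (x / (2 * b) + a / x + g / x ^ 3) * x\<^sup>2 \<le> 1 / 4"
  proof -
    have "((\<lambda>x::real. q * exp (K - (- x + \<delta>)\<^sup>2 / (4 * b)) * (x / (2 * b) + a / x + g / x ^ 3) * x\<^sup>2) \<longlongrightarrow> 0) at_top"
      using b q by real_asymp
    then show ?thesis by (intro small) simp
  qed
  \<comment> \<open>This makes \<open>slope (- g)\<close> nonnegative; at the lower curve the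
    exponential term then has the favourable sign.\<close>
  have e4: "\<forall>\<^sub>F x in at_top. x / (2 * b) + a / x - g / x ^ 3 \<ge> 0"
    using b by real_asymp
  have "\<forall>\<^sub>F x in at_top. x \<ge> 1 \<and> \<bar>2 * b * a + 3\<bar> * g * (1 / x\<^sup>2) \<le> 1 / 4 \<and> b * g\<^sup>2 * (1 / x\<^sup>2)\<^sup>2 \<le> 1 / 4
      \<and> q * exp (K - (- x + \<delta>)\<^sup>2 / (4 * b)) * (x / (2 * b) + a / x + g / x ^ 3) * x\<^sup>2 \<le> 1 / 4
      \<and> x / (2 * b) + a / x - g / x ^ 3 \<ge> 0
      \<and> pp (- x) < x / (2 * b) + (1 - b) / b / x \<and> x / (2 * b) + (1 - b) / b / x < pm (- x)"
    using e1 e2 e3 e4 start eventually_ge_at_top[of "1::real"] by eventually_elim simp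
  then obtain R0 where R0: "\<And>x. x \<ge> R0 \<Longrightarrow> x \<ge> 1 \<and> \<bar>2 * b * a + 3\<bar> * g * (1 / x\<^sup>2) \<le> 1 / 4 \<and> b * g\<^sup>2 * (1 / x\<^sup>2)\<^sup>2 \<le> 1 / 4
      \<and> q * exp (K - (- x + \<delta>)\<^sup>2 / (4 * b)) * (x / (2 * b) + a / x + g / x ^ 3) * x\<^sup>2 \<le> 1 / 4
      \<and> x / (2 * b) + a / x - g / x ^ 3 \<ge> 0
      \<and> pp (- x) < x / (2 * b) + (1 - b) / b / x \<and> x / (2 * b) + (1 - b) / b / x < pm (- x)"
    by (auto simp: eventually_at_top_linorder)
  define R where "R = max R0 1"
  have slope_neg: "slope g (- x) = x / (2 * b) + a / x + g / x ^ 3" for g x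
    by (simp add: slope_def a_def power_minus_odd)
  have rhs: "profile_rhs b t u (slope g' t) - (- 1 / (2 * b) + (1 - b) / b / t\<^sup>2 + 3 * g' / t ^ 4) =
      - (1 / t\<^sup>2 * (b * a\<^sup>2 + a + g' / 2 + (2 * b * a + 3) * g' * (1 / t\<^sup>2) + b * g'\<^sup>2 * (1 / t\<^sup>2)\<^sup>2))
      + q * exp u * slope g' t" if "t \<noteq> 0" for t u g'
  proof -
    have "profile_rhs b t u (slope g' t) = - b * (slope g' t)\<^sup>2 - t / 2 * slope g' t - 1 / 2 + q * exp u * slope g' t"
      by (simp add: profile_rhs_def q_def[symmetric] algebra_simps)
    then show ?thesis
      using profile_rhs_expansion[of b t g'] b that unfolding slope_def[symmetric] a_def by simp
  qed
  have above: "- y + r < 0" if "x * (3 / 4) \<le> y" "x > 0" "r \<le> 1 / 4 * x" for x y r :: real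
    using that by linarith
  have below: "- (- y + r) < 0" if "y \<le> x * (- (1 / 2))" "x > 0" "r \<ge> 0" for x y r :: real
    using that by linarith
  show ?thesis
  proof (rule that[of R g])
    show "R \<ge> 1" by (simp add: R_def)
    show "pp (- x) < slope 0 (- x) \<and> slope 0 (- x) < pm (- x)" if "x \<ge> R" for x
      using R0[of x] that by (simp add: slope_neg R_def a_def)
    fix n u p t
    assume n: "R \<le> n"
      and dp: "\<And>t. t \<in> {-n..n} \<Longrightarrow> (p has_real_derivative profile_rhs b t (u t) (p t)) (at t within {-n..n})"
      and pn: "p (- n) = slope 0 (- n)" and ule: "\<And>t. t \<in> {-n..n} \<Longrightarrow> u t \<le> up t"
      and t: "t \<in> {-n..-R}"
    have n1: "n \<ge> 1" using n by (simp add: R_def)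
    have sub: "{-n..-R} \<subseteq> {-n..n}" using n by (auto simp: R_def)
    have dv: "((\<lambda>t. p t - slope g' t) has_real_derivative
        profile_rhs b s (u s) (p s) - (- 1 / (2 * b) + (1 - b) / b / s\<^sup>2 + 3 * g' / s ^ 4)) (at s within {-n..-R})"
      if "s \<in> {-n..-R}" for s g'
    proof -
      have "s \<noteq> 0" using that by (auto simp: R_def)
      then show ?thesis
        by (intro DERIV_diff DERIV_subset[OF dp sub] has_field_derivative_at_within[OF slope_deriv])
           (use that sub in auto)
    qed
    have facts: "s \<noteq> 0" "1 / s\<^sup>2 > 0" "\<bar>2 * b * a + 3\<bar> * g * (1 / s\<^sup>2) \<le> 1 / 4" "b * g\<^sup>2 * (1 / s\<^sup>2)\<^sup>2 \<le> 1 / 4"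
        "slope (- g) s \<ge> 0" "slope g s \<ge> 0" "q * exp (u s) * slope g s \<le> 1 / 4 * (1 / s\<^sup>2)"
      if s: "s \<in> {-n..-R}" for s
    proof -
      have x: "- s \<ge> R0" using s by (auto simp: R_def)
      note r = R0[OF x]
      show nz: "s \<noteq> 0" using s by (auto simp: R_def)
      then show "1 / s\<^sup>2 > 0" by simp
      show "\<bar>2 * b * a + 3\<bar> * g * (1 / s\<^sup>2) \<le> 1 / 4" "b * g\<^sup>2 * (1 / s\<^sup>2)\<^sup>2 \<le> 1 / 4" using r by simp_all
      show lo: "slope (- g) s \<ge> 0" using r slope_neg[of "- g" "- s"] by simp
      have "s ^ 3 < 0" using s by (auto simp: R_def power_less_zero_eq)
      then have "g / s ^ 3 < 0" using g(1) by (simp add: divide_less_0_iff)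
      then show hi: "slope g s \<ge> 0" using lo by (simp add: slope_def)
      have "u s \<le> K - (s + \<delta>)\<^sup>2 / (4 * b)"
      proof -
        have "s \<le> 0" using x r by linarith
        then show ?thesis using ule[of s] decay[of s] s sub by auto
      qed
      then have "q * exp (u s) * slope g s \<le> q * exp (K - (s + \<delta>)\<^sup>2 / (4 * b)) * slope g s"
        using q hi by (intro mult_right_mono mult_left_mono) auto
      moreover have "q * exp (K - (s + \<delta>)\<^sup>2 / (4 * b)) * slope g s * s\<^sup>2 \<le> 1 / 4"
        using r slope_neg[of g "- s"] by simp
      then have "q * exp (K - (s + \<delta>)\<^sup>2 / (4 * b)) * slope g s \<le> 1 / 4 * (1 / s\<^sup>2)"
        using nz by (simp add: field_simps)
      ultimately show "q * exp (u s) * slope g s \<le> 1 / 4 * (1 / s\<^sup>2)" by linarith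
    qed
    have "p t - slope g t < 0"
    proof (rule negative_barrier[OF dv _ _ t])
      have "g / n ^ 3 > 0" using g(1) n1 by simp
      then show "p (- n) - slope g (- n) < 0" by (simp add: pn slope_neg)
      fix s assume s: "s \<in> {-n..-R}" and "p s - slope g s = 0"
      then have ps: "p s = slope g s" by simp
      note f = facts[OF s]
      have "\<bar>(2 * b * a + 3) * g * (1 / s\<^sup>2)\<bar> \<le> 1 / 4" using f(3) g(1) by (simp add: abs_mult)
      moreover have "b * g\<^sup>2 * (1 / s\<^sup>2)\<^sup>2 \<ge> 0" using b by simp
      ultimately have "3 / 4 \<le> b * a\<^sup>2 + a + g / 2 + (2 * b * a + 3) * g * (1 / s\<^sup>2) + b * g\<^sup>2 * (1 / s\<^sup>2)\<^sup>2"
        using g(2) by linarith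
      then have "1 / s\<^sup>2 * (3 / 4) \<le> 1 / s\<^sup>2 * (b * a\<^sup>2 + a + g / 2 + (2 * b * a + 3) * g * (1 / s\<^sup>2) + b * g\<^sup>2 * (1 / s\<^sup>2)\<^sup>2)"
        using f(2) by (intro mult_left_mono) auto
      then show "profile_rhs b s (u s) (p s) - (- 1 / (2 * b) + (1 - b) / b / s\<^sup>2 + 3 * g / s ^ 4) < 0"
        unfolding ps rhs[OF f(1)] by (rule above[OF _ f(2) f(7)])
    qed
    moreover have "- (p t - slope (- g) t) < 0"
    proof (rule negative_barrier[OF DERIV_minus[OF dv] _ _ t])
      have "g / n ^ 3 > 0" using g(1) n1 by simp
      then show "- (p (- n) - slope (- g) (- n)) < 0" by (simp add: pn slope_neg)
      fix s assume s: "s \<in> {-n..-R}" and "- (p s - slope (- g) s) = 0"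
      then have ps: "p s = slope (- g) s" by simp
      note f = facts[OF s]
      have "\<bar>(2 * b * a + 3) * g * (1 / s\<^sup>2)\<bar> \<le> 1 / 4" using f(3) g(1) by (simp add: abs_mult)
      then have "b * a\<^sup>2 + a + (- g) / 2 + (2 * b * a + 3) * (- g) * (1 / s\<^sup>2) + b * (- g)\<^sup>2 * (1 / s\<^sup>2)\<^sup>2 \<le> - (1 / 2)"
      proof -
        have "m + (- g) / 2 + - X + Z \<le> - (1 / 2)" if "\<bar>X\<bar> \<le> 1 / 4" "m - g / 2 \<le> - 1" "Z \<le> 1 / 4"
          for m X Z :: real using that by linarith
        from this[OF \<open>\<bar>(2 * b * a + 3) * g * (1 / s\<^sup>2)\<bar> \<le> 1 / 4\<close> g(3) f(4)] show ?thesis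
          by (simp only: mult_minus_right mult_minus_left power2_minus)
      qed
      then have "1 / s\<^sup>2 * (b * a\<^sup>2 + a + (- g) / 2 + (2 * b * a + 3) * (- g) * (1 / s\<^sup>2) + b * (- g)\<^sup>2 * (1 / s\<^sup>2)\<^sup>2)
          \<le> 1 / s\<^sup>2 * (- (1 / 2))"
        using f(2) by (intro mult_left_mono) auto
      moreover have "q * exp (u s) * slope (- g) s \<ge> 0" using q f(5) by simp
      ultimately show "- (profile_rhs b s (u s) (p s) - (- 1 / (2 * b) + (1 - b) / b / s\<^sup>2 + 3 * (- g) / s ^ 4)) < 0"
        unfolding ps rhs[OF f(1)] by (rule below[OF _ f(2)])
    qed
    ultimately show "slope (- g) t \<le> p t \<and> p t \<le> slope g t" by simp
  qed
qed


text \<open>At the time -R the barriers and the trap confine u and u' to a box independent of n, so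
  a subsequence of these values converges and \<open>ode_limit\<close> carries the convergence to
  the whole line. The barrier and slope inequalities are closed and pass to the limit.\<close>

lemma entire_solution:
  obtains u p R g where "R \<ge> 1"
    "\<And>t. (u has_real_derivative p t) (at t)"
    "\<And>t. (p has_real_derivative profile_rhs b t (u t) (p t)) (at t)"
    "\<And>t. um t \<le> u t" "\<And>t. u t \<le> up t"
    "\<And>t. t \<le> - R \<Longrightarrow> slope (- g) t \<le> p t" "\<And>t. t \<le> - R \<Longrightarrow> p t \<le> slope g t"
proof -
  obtain R g where R: "R \<ge> 1"
    "\<And>x. x \<ge> R \<Longrightarrow> pp (- x) < slope 0 (- x) \<and> slope 0 (- x) < pm (- x)"
    and trap: "\<And>n u p t. n \<ge> R \<Longrightarrow>
       (\<And>t. t \<in> {-n..n} \<Longrightarrow> (p has_real_derivative profile_rhs b t (u t) (p t)) (at t within {-n..n})) \<Longrightarrow>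
       p (- n) = slope 0 (- n) \<Longrightarrow> (\<And>t. t \<in> {-n..n} \<Longrightarrow> u t \<le> up t) \<Longrightarrow>
       t \<in> {-n..-R} \<Longrightarrow> slope (- g) t \<le> p t \<and> p t \<le> slope g t"
    by (rule slope_trap) blast
  define N0 where "N0 = nat \<lceil>R\<rceil>"
  have N0: "R \<le> real n" if "N0 \<le> n" for n using that by (simp add: N0_def nat_le_iff ceiling_le_iff)
  define sol where "sol = (\<lambda>n (u :: real \<Rightarrow> real) p.
    (\<forall>t\<in>{-real n..real n}. (u has_real_derivative p t) (at t within {-real n..real n})) \<and>
    (\<forall>t\<in>{-real n..real n}. (p has_real_derivative profile_rhs b t (u t) (p t)) (at t within {-real n..real n})) \<and>
    p (- real n) = slope 0 (- real n) \<and> (\<forall>t\<in>{-real n..real n}. um t \<le> u t) \<and>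
    (\<forall>t\<in>{-real n..real n}. u t \<le> up t) \<and> (\<forall>t\<in>{-real n..real n}. 0 \<le> p t))"
  have "\<exists>u p. N0 \<le> n \<longrightarrow> sol n u p" for n
  proof (cases "N0 \<le> n")
    case True
    then have "R \<le> real n" by (rule N0)
    then show ?thesis
      using boundary_value_problem[of "real n" "slope 0 (- real n)"] R unfolding sol_def
      by (smt (verit, del_insts))
  qed blast
  then obtain u p where "\<And>n. N0 \<le> n \<longrightarrow> sol n (u n) (p n)" by metis
  then have sol: "sol n (u n) (p n)" if "N0 \<le> n" for n using that by blast
  have du: "(u n has_real_derivative p n t) (at t within {-real n..real n})"
    and dp: "(p n has_real_derivative profile_rhs b t (u n t) (p n t)) (at t within {-real n..real n})"
    and ule: "u n t \<le> up t" and uge: "um t \<le> u n t" and pge: "0 \<le> p n t"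
    if "N0 \<le> n" "t \<in> {-real n..real n}" for n t
    using sol[OF that(1)] that(2) unfolding sol_def by blast+
  have pstart: "p n (- real n) = slope 0 (- real n)" if "N0 \<le> n" for n
    using sol[OF that] unfolding sol_def by blast
  have tr: "slope (- g) t \<le> p n t" "p n t \<le> slope g t" if "N0 \<le> n" "t \<in> {-real n..-R}" for n t
    using trap[OF N0[OF that(1)] dp[OF that(1)] pstart[OF that(1)] ule[OF that(1)] that(2)] by auto
  define q where "q = 1 + 1 / b"
  have q: "q > 0" using b by (simp add: q_def add_pos_pos)
  \<comment> \<open>A slope bound on \<open>{-N..N}\<close> valid for all later n: the trap controls
    the slope at -N, and \<open>profile_rhs_neg\<close> prevents it from crossing P N further right.
    The bound inside \<open>boundary_value_problem\<close> depends on n and would not do.\<close>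
  define P where "P = (\<lambda>N::nat. max (slope g (- real N) + 1) ((real N / 2 + q * exp (up (real N))) / b))"
  have Pnn: "P N \<ge> 0" for N
  proof -
    have "(real N / 2 + q * exp (up (real N))) / b \<ge> 0" using b q by (intro divide_nonneg_pos add_nonneg_nonneg) auto
    then show ?thesis by (simp add: P_def le_max_iff_disj)
  qed
  have pP: "p n t \<le> P N" if "N0 \<le> N" "N \<le> n" "t \<in> {-real N..real N}" for N n t
  proof -
    have n: "N0 \<le> n" and sub: "{-real N..real N} \<subseteq> {-real n..real n}" using that by auto
    have "p n t - P N < 0"
    proof (rule negative_barrier[of "- real N" "real N" "\<lambda>t. p n t - P N" "\<lambda>t. profile_rhs b t (u n t) (p n t)"])
      show "((\<lambda>t. p n t - P N) has_real_derivative profile_rhs b t (u n t) (p n t)) (at t within {-real N..real N})"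
        if "t \<in> {-real N..real N}" for t
        using DERIV_diff[OF DERIV_subset[OF dp[OF n] sub] DERIV_const[of "P N"]] that sub by auto
      have "- real N \<in> {-real n..-R}" using that N0[of N] by auto
      from tr(2)[OF n this] show "p n (- real N) - P N < 0" by (simp add: P_def less_max_iff_disj)
      fix t assume t: "t \<in> {-real N..real N}" and "p n t - P N = 0"
      then have pt: "p n t = P N" by simp
      have "u n t \<le> up (real N)"
        using ule[OF n, of t] up_mono[of t "real N"] t sub by force
      moreover have "b * P N \<ge> real N / 2 + (1 + 1 / b) * exp (up (real N))"
      proof -
        have "(real N / 2 + q * exp (up (real N))) / b \<le> P N" by (simp add: P_def)
        then show ?thesis using b by (simp add: q_def pos_divide_le_eq mult.commute)
      qed
      ultimately show "profile_rhs b t (u n t) (p n t) < 0"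
        unfolding pt using t by (intro profile_rhs_neg[OF b _ _ Pnn]) auto
    qed (use that in auto)
    then show ?thesis by simp
  qed
  have "\<exists>L. L > 0 \<and> (\<forall>t u v p r. \<bar>t\<bar> \<le> real N \<longrightarrow> u \<le> up (real N) \<longrightarrow> v \<le> up (real N) \<longrightarrow>
      0 \<le> p \<longrightarrow> p \<le> P N \<longrightarrow> 0 \<le> r \<longrightarrow> r \<le> P N \<longrightarrow>
      \<bar>profile_rhs b t u p - profile_rhs b t v r\<bar> \<le> L * (\<bar>u - v\<bar> + \<bar>p - r\<bar>))" for N
    by (rule profile_rhs_lipschitz[OF b, where n = "real N" and P = "P N" and c = "up (real N)"])
       (use Pnn in auto)
  then obtain L where L: "\<And>N. L N > 0"
    "\<And>N t u v p r. \<bar>t\<bar> \<le> real N \<Longrightarrow> u \<le> up (real N) \<Longrightarrow> v \<le> up (real N) \<Longrightarrow>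
      0 \<le> p \<Longrightarrow> p \<le> P N \<Longrightarrow> 0 \<le> r \<Longrightarrow> r \<le> P N \<Longrightarrow>
      \<bar>profile_rhs b t u p - profile_rhs b t v r\<bar> \<le> L N * (\<bar>u - v\<bar> + \<bar>p - r\<bar>)"
    by metis
  define G where "G = (\<lambda>t (y :: real \<times> real). (snd y, profile_rhs b t (fst y) (snd y)))"
  define y where "y = (\<lambda>n t. (u n t, p n t))"
  have cG: "continuous_on UNIV (G t)" for t
    unfolding G_def profile_rhs_def by (intro continuous_intros)
  have ode: "(y n has_vector_derivative G t (y n t)) (at t within {-real n..real n})"
    if "N0 \<le> n" "t \<in> {-real n..real n}" for n t
    using has_vector_derivative_Pair[OF du[OF that, unfolded has_real_derivative_iff_has_vector_derivative]
        dp[OF that, unfolded has_real_derivative_iff_has_vector_derivative]]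
    by (simp add: y_def G_def)
  have lip: "norm (G t (y m t) - G t (y n t)) \<le> (1 + 2 * L N) * norm (y m t - y n t)"
    if "N0 \<le> N" "N \<le> m" "N \<le> n" "t \<in> {-real N..real N}" for N m n t
  proof -
    have bnd: "u k t \<le> up (real N)" "0 \<le> p k t" "p k t \<le> P N" if "N \<le> k" for k
    proof -
      have k: "N0 \<le> k" "t \<in> {-real k..real k}" using \<open>N0 \<le> N\<close> \<open>N \<le> k\<close> \<open>t \<in> {-real N..real N}\<close> by auto
      show "u k t \<le> up (real N)" using ule[OF k] up_mono[of t "real N"] \<open>t \<in> {-real N..real N}\<close> by force
      show "0 \<le> p k t" by (rule pge[OF k])
      show "p k t \<le> P N" by (rule pP) (use \<open>N0 \<le> N\<close> \<open>N \<le> k\<close> \<open>t \<in> {-real N..real N}\<close> in auto)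
    qed
    have 1: "\<bar>u m t - u n t\<bar> \<le> norm (y m t - y n t)" "\<bar>p m t - p n t\<bar> \<le> norm (y m t - y n t)"
      using norm_fst_le[of "u m t - u n t" "p m t - p n t"] norm_snd_le[of "p m t - p n t" "u m t - u n t"]
      by (simp_all add: y_def)
    have 2: "\<bar>profile_rhs b t (u m t) (p m t) - profile_rhs b t (u n t) (p n t)\<bar>
        \<le> L N * (\<bar>u m t - u n t\<bar> + \<bar>p m t - p n t\<bar>)"
      by (rule L(2)) (use bnd that in auto)
    have 3: "L N * (\<bar>u m t - u n t\<bar> + \<bar>p m t - p n t\<bar>) \<le> L N * (norm (y m t - y n t) + norm (y m t - y n t))"
      using 1 L(1)[of N] by (intro mult_left_mono add_mono) auto
    have "norm (G t (y m t) - G t (y n t)) \<le> \<bar>p m t - p n t\<bar>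
        + \<bar>profile_rhs b t (u m t) (p m t) - profile_rhs b t (u n t) (p n t)\<bar>"
      using norm_Pair_le[of "p m t - p n t" "profile_rhs b t (u m t) (p m t) - profile_rhs b t (u n t) (p n t)"]
      by (simp add: G_def y_def)
    also have "\<dots> \<le> norm (y m t - y n t) + L N * (norm (y m t - y n t) + norm (y m t - y n t))"
      using 1 2 3 by linarith
    finally show ?thesis by (simp add: algebra_simps)
  qed
  have mem: "- R \<in> {-real n..-R}" "- R \<in> {-real n..real n}" if "N0 \<le> n" for n
    using N0[OF that] R by auto
  define Bx where "Bx = {um (- R)..up (- R)} \<times> {slope (- g) (- R)..slope g (- R)}"
  have "compact Bx" unfolding Bx_def by (intro compact_Times compact_Icc)
  moreover have "y (n + N0) (- R) \<in> Bx" for n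
    unfolding Bx_def y_def
    using ule[OF _ mem(2)] uge[OF _ mem(2)] tr(1)[OF _ mem(1)] tr(2)[OF _ mem(1)] by simp
  ultimately have "\<exists>c\<in>Bx. \<exists>r. strict_mono r \<and> ((\<lambda>n. y (n + N0) (- R)) \<circ> r) \<longlonglongrightarrow> c"
    unfolding compact_def by (elim allE[of _ "\<lambda>n. y (n + N0) (- R)"]) simp
  then obtain c r where r: "strict_mono (r :: nat \<Rightarrow> nat)" "((\<lambda>n. y (n + N0) (- R)) \<circ> r) \<longlonglongrightarrow> c"
    by blast
  define r' where "r' = (\<lambda>n. r n + N0)"
  have r': "strict_mono r'" using r(1) by (simp add: r'_def strict_mono_def)
  have conv: "(\<lambda>n. y (r' n) (- R)) \<longlonglongrightarrow> c" using r(2) by (simp add: r'_def o_def)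
  have L0: "0 \<le> 1 + 2 * L N" for N using L(1)[of N] by linarith
  obtain z where z: "\<And>t. (\<lambda>n. y (r' n) t) \<longlonglongrightarrow> z t" "\<And>t. (z has_vector_derivative G t (z t)) (at t)"
    using ode_limit[of G N0 y "\<lambda>N. 1 + 2 * L N", OF cG ode lip L0 r' conv] by blast
  have limu: "(\<lambda>n. u (r' n) t) \<longlonglongrightarrow> fst (z t)" and limp: "(\<lambda>n. p (r' n) t) \<longlonglongrightarrow> snd (z t)" for t
    using tendsto_fst[OF z(1)[of t]] tendsto_snd[OF z(1)[of t]] by (simp_all add: y_def)
  have ev: "\<forall>\<^sub>F n in sequentially. N0 \<le> r' n \<and> \<bar>t\<bar> \<le> real (r' n)" for t
  proof -
    have "N0 \<le> r' n \<and> \<bar>t\<bar> \<le> real (r' n)" if "nat \<lceil>\<bar>t\<bar>\<rceil> \<le> n" for n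
      using seq_suble[OF r', of n] that by (auto simp: r'_def nat_le_iff ceiling_le_iff)
    then show ?thesis unfolding eventually_sequentially by blast
  qed
  show ?thesis
  proof (rule that[of R "\<lambda>t. fst (z t)" "\<lambda>t. snd (z t)" g])
    show "R \<ge> 1" by (rule R)
    fix t
    show "((\<lambda>t. fst (z t)) has_real_derivative snd (z t)) (at t)"
      using bounded_linear.has_vector_derivative[OF bounded_linear_fst z(2)[of t]]
      by (simp add: has_real_derivative_iff_has_vector_derivative G_def)
    show "((\<lambda>t. snd (z t)) has_real_derivative profile_rhs b t (fst (z t)) (snd (z t))) (at t)"
      using bounded_linear.has_vector_derivative[OF bounded_linear_snd z(2)[of t]]
      by (simp add: has_real_derivative_iff_has_vector_derivative G_def)
    show "um t \<le> fst (z t)"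
      by (rule tendsto_lowerbound[OF limu])
         (use ev[of t] in \<open>auto elim!: eventually_mono intro!: uge simp: abs_le_iff\<close>)
    show "fst (z t) \<le> up t"
      by (rule tendsto_upperbound[OF limu])
         (use ev[of t] in \<open>auto elim!: eventually_mono intro!: ule simp: abs_le_iff\<close>)
    assume t: "t \<le> - R"
    show "slope (- g) t \<le> snd (z t)"
      by (rule tendsto_lowerbound[OF limp])
         (use ev[of t] t in \<open>auto elim!: eventually_mono intro!: tr simp: abs_le_iff\<close>)
    show "snd (z t) \<le> slope g t"
      by (rule tendsto_upperbound[OF limp])
         (use ev[of t] t in \<open>auto elim!: eventually_mono intro!: tr simp: abs_le_iff\<close>)
  qed
qed

end

section \<open>The similarity profile\<close>

text \<open>As c / (2 t^2) has derivative - c / t^3, adding it to \<psi> gives a nondecreasing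
  function and subtracting it a nonincreasing one. The latter bounds the former from below, so the
  former converges, and the correction tends to 0. Since t is negative, c / t^3 is the lower bound
  for c \<ge> 0.\<close>

lemma tendsto_at_bot_cubic_derivative:
  fixes \<psi> \<psi>' :: "real \<Rightarrow> real"
  assumes R: "R \<ge> 1"
    and der: "\<And>t. t \<le> - R \<Longrightarrow> (\<psi> has_real_derivative \<psi>' t) (at t)"
    and lo: "\<And>t. t \<le> - R \<Longrightarrow> c / t ^ 3 \<le> \<psi>' t"
    and hi: "\<And>t. t \<le> - R \<Longrightarrow> \<psi>' t \<le> - (c / t ^ 3)"
  obtains L where "(\<psi> \<longlongrightarrow> L) at_bot"
proof -
  have d: "((\<lambda>t. c / (2 * t\<^sup>2)) has_real_derivative - (c / t ^ 3)) (at t)" if "t \<le> - R" for t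
    using that R by (auto intro!: derivative_eq_intros simp: field_simps eval_nat_numeral)
  have mono: "\<psi> x + c / (2 * x\<^sup>2) \<le> \<psi> y + c / (2 * y\<^sup>2)" if "x \<le> y" "y \<le> - R" for x y
  proof (rule DERIV_nonneg_imp_nondecreasing[of x y "\<lambda>t. \<psi> t + c / (2 * t\<^sup>2)", OF that(1)])
    fix t assume "x \<le> t" "t \<le> y"
    then have t: "t \<le> - R" using that by simp
    show "\<exists>D. ((\<lambda>t. \<psi> t + c / (2 * t\<^sup>2)) has_real_derivative D) (at t) \<and> 0 \<le> D"
      using DERIV_add[OF der[OF t] d[OF t]] lo[OF t] by (intro exI conjI) auto
  qed
  have anti: "\<psi> y - c / (2 * y\<^sup>2) \<le> \<psi> x - c / (2 * x\<^sup>2)" if "x \<le> y" "y \<le> - R" for x y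
  proof (rule DERIV_nonpos_imp_nonincreasing[of x y "\<lambda>t. \<psi> t - c / (2 * t\<^sup>2)", OF that(1)])
    fix t assume "x \<le> t" "t \<le> y"
    then have t: "t \<le> - R" using that by simp
    show "\<exists>D. ((\<lambda>t. \<psi> t - c / (2 * t\<^sup>2)) has_real_derivative D) (at t) \<and> D \<le> 0"
      using DERIV_diff[OF der[OF t] d[OF t]] hi[OF t] by (intro exI conjI) auto
  qed
  have bound: "\<psi> (- R) - c / (2 * (- R)\<^sup>2) - \<bar>c\<bar> \<le> \<psi> x + c / (2 * x\<^sup>2)" if "x \<le> - R" for x
  proof -
    have "x\<^sup>2 \<ge> 1" using that R abs_le_square_iff[of 1 x] by simp
    then have "\<bar>c\<bar> / x\<^sup>2 \<le> \<bar>c\<bar>" by (simp add: divide_le_eq mult_le_cancel_left1)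
    moreover have "- (c / x\<^sup>2) \<le> \<bar>c\<bar> / x\<^sup>2"
      using divide_right_mono[of "- c" "\<bar>c\<bar>" "x\<^sup>2"] by simp
    moreover have "c / (2 * x\<^sup>2) = c / x\<^sup>2 / 2" by simp
    ultimately show ?thesis using anti[OF that] by simp
  qed
  obtain L where L: "((\<lambda>t. \<psi> t + c / (2 * t\<^sup>2)) \<longlongrightarrow> L) at_bot"
    using mono_bounded_tendsto_at_bot[of "- R" "\<lambda>t. \<psi> t + c / (2 * t\<^sup>2)", OF mono bound] by metis
  have "((\<lambda>t::real. c / (2 * t\<^sup>2)) \<longlongrightarrow> 0) at_bot" by real_asymp
  from tendsto_diff[OF L this] have "(\<psi> \<longlongrightarrow> L) at_bot" by simp
  then show ?thesis by (rule that)
qed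

text \<open>With g = exp (b u), f is the antiderivative of g vanishing at -infinity. The profile
  equation follows from a conserved quantity. Both limits come from l'Hospital's rule: at +infinity
  from the barriers, at -infinity from the trapped slope.\<close>

lemma similarity_profile:
  fixes b :: real
  assumes b: "b > 0"
  obtains f g h :: "real \<Rightarrow> real" and C :: real where
    "\<And>x. (f has_real_derivative g x) (at x)" "\<And>x. (g has_real_derivative h x) (at x)"
    "continuous_on UNIV h" "\<And>x. f x > 0" "\<And>x. g x > 0" "strict_mono f"
    "\<And>x. h x + x / 2 * g x + (b - 1) / 2 * f x - g x powr (1 + 1 / b) = 0"
    "((\<lambda>x. x powr (- (b + 1)) * f x) \<longlongrightarrow> (b + 1) powr (- (b + 1)) * b powr b) at_top"
    "C > 0" "((\<lambda>x. exp (x\<^sup>2 / 4) * (- x) powr (- (b - 2)) * f x) \<longlongrightarrow> C) at_bot"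
proof -
  obtain \<delta> K um pm pm' up pp pp' where "barriers b \<delta> K um pm pm' up pp pp'"
    using barriers_exist[OF b] .
  then interpret barriers b \<delta> K um pm pm' up pp pp' .
  obtain u p R \<gamma> where R: "R \<ge> 1"
    and du: "\<And>t. (u has_real_derivative p t) (at t)"
    and dp: "\<And>t. (p has_real_derivative profile_rhs b t (u t) (p t)) (at t)"
    and u: "\<And>t. um t \<le> u t" "\<And>t. u t \<le> up t"
    and trap: "\<And>t. t \<le> - R \<Longrightarrow> slope (- \<gamma>) t \<le> p t" "\<And>t. t \<le> - R \<Longrightarrow> p t \<le> slope \<gamma> t"
    by (rule entire_solution) blast
  define g where "g = (\<lambda>t. exp (b * u t))"
  define h where "h = (\<lambda>t. b * p t * g t)"
  have gpos: "g t > 0" for t by (simp add: g_def)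
  have dg: "(g has_real_derivative h t) (at t)" for t
    unfolding g_def h_def by (auto intro!: derivative_eq_intros du)
  have cont: "continuous_on UNIV u" "continuous_on UNIV p" "continuous_on UNIV g"
    using du dp dg by (auto intro!: DERIV_continuous_on)
  then have ch: "continuous_on UNIV h" unfolding h_def by (intro continuous_intros)
  \<comment> \<open>The constant comes from completing a square, which weakens the Gaussian bound on
    g to the exponential bound wanted by \<open>antiderivative_vanishing_at_bot\<close>.\<close>
  define k where "k = b * K + 1 + \<delta>"
  have ub: "b * u t \<le> k + t" if "t \<le> 0" for t
  proof -
    have "b * u t \<le> b * (K - (t + \<delta>)\<^sup>2 / (4 * b))"
      using b u(2)[of t] decay[OF that] by (intro mult_left_mono) auto
    also have "\<dots> = b * K - (t + \<delta>)\<^sup>2 / 4" using b by (simp add: field_simps)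
    also have "\<dots> \<le> k + t"
    proof -
      have "0 \<le> ((t + \<delta>) / 2 + 1)\<^sup>2" by simp
      also have "\<dots> = (t + \<delta>)\<^sup>2 / 4 + (t + \<delta>) + 1" by (simp add: power2_eq_square field_simps)
      finally show ?thesis by (simp add: k_def)
    qed
    finally show ?thesis .
  qed
  have gb: "g t \<le> exp k * exp t" if "t \<le> 0" for t
    using ub[OF that] by (simp add: g_def exp_add[symmetric])
  obtain f where df: "\<And>x. (f has_real_derivative g x) (at x)" and f0: "(f \<longlongrightarrow> 0) at_bot"
    and fpos: "\<And>x. f x > 0" and fmono: "strict_mono f"
    using antiderivative_vanishing_at_bot[OF cont(3) gpos gb] by metis
  have pow: "g t powr (1 + 1 / b) = exp ((b + 1) * u t)" for t
    using b by (simp add: g_def exp_powr_real field_simps)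
  have zero_at_bot: "((\<lambda>t. k t * g t) \<longlongrightarrow> 0) at_bot"
    if "((\<lambda>t. M t * exp t) \<longlongrightarrow> 0) at_bot" "\<forall>\<^sub>F t in at_bot. \<bar>k t\<bar> \<le> M t" for k M
  proof (rule Lim_null_comparison)
    show "((\<lambda>t. exp k' * (M t * exp t)) \<longlongrightarrow> 0) at_bot" for k'
      using tendsto_mult_left[OF that(1), of "exp k'"] by simp
    show "\<forall>\<^sub>F t in at_bot. norm (k t * g t) \<le> exp (b * K + 1 + \<delta>) * (M t * exp t)"
      using that(2) eventually_le_at_bot[of 0]
    proof eventually_elim
      case (elim t)
      have "norm (k t * g t) \<le> M t * (exp (b * K + 1 + \<delta>) * exp t)"
        unfolding norm_mult using elim gb[of t] gpos[of t]
        by (intro mult_mono) (auto simp: k_def)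
      then show ?case by (simp add: mult_ac)
    qed
  qed
  \<comment> \<open>E is the left-hand side of the profile equation and the equation for u says E' =
    0. Every summand vanishes at -infinity (this fixes the choice of f among the antiderivatives),
    hence E = 0.\<close>
  define E where "E = (\<lambda>t. h t + t / 2 * g t + (b - 1) / 2 * f t - exp ((b + 1) * u t))"
  have dE: "(E has_real_derivative 0) (at t)" for t
  proof -
    have dh: "(h has_real_derivative b * profile_rhs b t (u t) (p t) * g t + h t * (b * p t)) (at t)"
      unfolding h_def using DERIV_mult[OF DERIV_cmult[OF dp[of t], of b] dg[of t]] by (simp add: h_def)
    have "(E has_real_derivative b * profile_rhs b t (u t) (p t) * g t + h t * (b * p t)
        + (1 / 2 * g t + h t * (t / 2)) + (b - 1) / 2 * g t - exp ((b + 1) * u t) * ((b + 1) * p t)) (at t)"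
    proof -
      have 1: "((\<lambda>t. t / 2) has_real_derivative 1 / 2) (at t)"
        by (auto intro!: derivative_eq_intros)
      have 2: "((\<lambda>t. exp ((b + 1) * u t)) has_real_derivative exp ((b + 1) * u t) * ((b + 1) * p t)) (at t)"
        by (auto intro!: derivative_eq_intros du)
      show ?thesis
        unfolding E_def by (intro DERIV_diff DERIV_add dh DERIV_mult[OF 1 dg] DERIV_cmult[OF df] 2)
    qed
    also have "exp ((b + 1) * u t) = exp (u t) * g t" by (simp add: g_def exp_add[symmetric] algebra_simps)
    also have "b * profile_rhs b t (u t) (p t) * g t + h t * (b * p t)
        + (1 / 2 * g t + h t * (t / 2)) + (b - 1) / 2 * g t - exp (u t) * g t * ((b + 1) * p t) = 0"
      using b by (simp add: profile_rhs_def h_def field_simps power2_eq_square)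
    finally show ?thesis .
  qed
  have E0: "(E \<longlongrightarrow> 0) at_bot"
  proof -
    have 1: "(h \<longlongrightarrow> 0) at_bot"
    proof -
      have "((\<lambda>t. (b * (\<bar>t\<bar> / (2 * b) + \<bar>(1 - b) / b\<bar> + \<bar>\<gamma>\<bar>)) * exp t) \<longlongrightarrow> 0) at_bot"
        using b by real_asymp
      moreover have "\<forall>\<^sub>F t in at_bot. \<bar>b * p t\<bar> \<le> b * (\<bar>t\<bar> / (2 * b) + \<bar>(1 - b) / b\<bar> + \<bar>\<gamma>\<bar>)"
        using eventually_le_at_bot[of "- R"]
      proof eventually_elim
        case (elim t)
        have t: "\<bar>t\<bar> \<ge> 1" using elim R by auto
        have i: "\<bar>c / t\<bar> \<le> \<bar>c\<bar>" "\<bar>c / t ^ 3\<bar> \<le> \<bar>c\<bar>" for c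
          using t one_le_power[OF t, of 3]
          by (auto simp: divide_le_eq mult_le_cancel_left1 power_abs)
        have "\<bar>p t\<bar> \<le> \<bar>t\<bar> / (2 * b) + \<bar>(1 - b) / b\<bar> + \<bar>\<gamma>\<bar>"
        proof -
          have 1: "\<bar>- t / (2 * b)\<bar> = \<bar>t\<bar> / (2 * b)" using b by simp
          have 2: "- t / (2 * b) - (1 - b) / b / t + \<gamma> / t ^ 3 \<le> p t"
            "p t \<le> - t / (2 * b) - (1 - b) / b / t - \<gamma> / t ^ 3"
            using trap[OF elim] by (simp_all add: slope_def)
          have "\<bar>x\<bar> \<le> X' + Y' + Z'"
            if "\<bar>X\<bar> = X'" "\<bar>Y\<bar> \<le> Y'" "\<bar>Z\<bar> \<le> Z'" "X - Y + Z \<le> x" "x \<le> X - Y - Z"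
            for x X Y Z X' Y' Z' :: real using that by linarith
          from this[OF 1 i(1) i(2) 2] show ?thesis .
        qed
        then show ?case using b by (simp add: abs_mult)
      qed
      ultimately show ?thesis using zero_at_bot[of _ "\<lambda>t. b * p t"] by (simp add: h_def)
    qed
    have 2: "((\<lambda>t. t / 2 * g t) \<longlongrightarrow> 0) at_bot"
    proof (rule zero_at_bot[where M = "\<lambda>t. \<bar>t\<bar> / 2"])
      show "((\<lambda>t::real. \<bar>t\<bar> / 2 * exp t) \<longlongrightarrow> 0) at_bot" by real_asymp
    qed auto
    have 3: "((\<lambda>t. exp ((b + 1) * u t)) \<longlongrightarrow> 0) at_bot"
    proof (rule Lim_null_comparison)
      show "((\<lambda>t. exp ((b + 1) / b * (k + t))) \<longlongrightarrow> 0) at_bot" using b by real_asymp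
      show "\<forall>\<^sub>F t in at_bot. norm (exp ((b + 1) * u t)) \<le> exp ((b + 1) / b * (k + t))"
        using eventually_le_at_bot[of 0]
      proof eventually_elim
        case (elim t)
        have "(b + 1) * u t = (b + 1) / b * (b * u t)" using b by simp
        also have "\<dots> \<le> (b + 1) / b * (k + t)" using ub[OF elim] b by (intro mult_left_mono) auto
        finally show ?case by simp
      qed
    qed
    have "(E \<longlongrightarrow> 0 + 0 + (b - 1) / 2 * 0 - 0) at_bot"
      unfolding E_def by (intro tendsto_intros 1 2 3 f0)
    then show ?thesis by simp
  qed
  have Ez: "E t = 0" for t
  proof -
    have "E s = E t" for s using DERIV_isconst_all[of E s t] dE by blast
    then have "E = (\<lambda>s. E t)" by auto
    then have "((\<lambda>s. E t) \<longlongrightarrow> 0) (at_bot :: real filter)" using E0 by simp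
    then show ?thesis by (simp add: tendsto_const_iff)
  qed
  have top: "((\<lambda>x. x powr (- (b + 1)) * f x) \<longlongrightarrow> (b + 1) powr (- (b + 1)) * b powr b) at_top"
  proof -
    \<comment> \<open>Both barriers have the same leading behaviour at +infinity, whatever their
      shift, so squeezing determines exp u / t and thereby g / t^b.\<close>
    have eu: "((\<lambda>t. exp (u t) / t) \<longlongrightarrow> b / (b + 1)) at_top"
    proof (rule tendsto_sandwich[OF _ _ um_at_top up_at_top])
      show "\<forall>\<^sub>F t in at_top. exp (um t) / t \<le> exp (u t) / t"
        using eventually_gt_at_top[of 0] by eventually_elim (use u in \<open>auto intro!: divide_right_mono\<close>)
      show "\<forall>\<^sub>F t in at_top. exp (u t) / t \<le> exp (up t) / t"
        using eventually_gt_at_top[of 0] by eventually_elim (use u in \<open>auto intro!: divide_right_mono\<close>)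
    qed
    have gp: "((\<lambda>t. g t / ((b + 1) * t powr b)) \<longlongrightarrow> (b / (b + 1)) powr b / (b + 1)) at_top"
    proof (rule Lim_transform_eventually)
      show "((\<lambda>t. (exp (u t) / t) powr b / (b + 1)) \<longlongrightarrow> (b / (b + 1)) powr b / (b + 1)) at_top"
        using b by (intro tendsto_intros eu) auto
      show "\<forall>\<^sub>F t in at_top. (exp (u t) / t) powr b / (b + 1) = g t / ((b + 1) * t powr b)"
        using eventually_gt_at_top[of 0]
      proof eventually_elim
        case (elim t)
        then show ?case by (simp add: powr_divide exp_powr_real g_def mult.commute)
      qed
    qed
    have "((\<lambda>t. f t / t powr (b + 1)) \<longlongrightarrow> (b / (b + 1)) powr b / (b + 1)) at_top"
    proof (rule lhospital_at_top_at_top[OF _ _ _ _ gp])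
      show "filterlim (\<lambda>t::real. t powr (b + 1)) at_top at_top" using b by real_asymp
      show "\<forall>\<^sub>F t in at_top. (b + 1) * t powr b \<noteq> 0"
        using eventually_gt_at_top[of 0] by eventually_elim (use b in auto)
      show "\<forall>\<^sub>F t in at_top. (f has_real_derivative g t) (at t)" using df by simp
      show "\<forall>\<^sub>F t in at_top. ((\<lambda>t. t powr (b + 1)) has_real_derivative (b + 1) * t powr b) (at t)"
        using eventually_gt_at_top[of 0]
      proof eventually_elim
        case (elim t)
        then show ?case using has_real_derivative_powr[of t "b + 1"] by simp
      qed
    qed
    moreover have "(b / (b + 1)) powr b / (b + 1) = (b + 1) powr (- (b + 1)) * b powr b"
    proof -
      have "(b + 1) powr (b + 1) = (b + 1) powr b * (b + 1)" using powr_add[of "b + 1" b 1] b by simp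
      then have "(b + 1) powr (- (b + 1)) = 1 / ((b + 1) powr b * (b + 1))" by (simp only: powr_minus_divide)
      moreover have "(b / (b + 1)) powr b = b powr b / (b + 1) powr b" using b by (simp add: powr_divide)
      ultimately show ?thesis by simp
    qed
    moreover have "x powr (- (b + 1)) * f x = f x / x powr (b + 1)" for x
      by (simp only: powr_minus_divide) simp
    ultimately show ?thesis by (simp only:)
  qed
  have bot: "\<exists>C>0. ((\<lambda>x. exp (x\<^sup>2 / 4) * (- x) powr (- (b - 2)) * f x) \<longlongrightarrow> C) at_bot"
  proof -
    \<comment> \<open>\<psi> is the logarithm of g divided by the expected tail exp (- t^2/4) (-
      t)^(b - 1). The first two terms of \<open>slope\<close> cancel in its derivative, leaving an
      error bounded by b \<gamma> / |t|^3.\<close>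
    define \<psi> where "\<psi> = (\<lambda>t. b * u t + t\<^sup>2 / 4 - (b - 1) * ln (- t))"
    obtain L where L: "(\<psi> \<longlongrightarrow> L) at_bot"
    proof (rule tendsto_at_bot_cubic_derivative[OF R, of \<psi> "\<lambda>t. b * p t + t / 2 - (b - 1) / t" "b * \<gamma>"])
      fix t assume t: "t \<le> - R"
      then have t0: "t < 0" using R by simp
      show "(\<psi> has_real_derivative b * p t + t / 2 - (b - 1) / t) (at t)"
        unfolding \<psi>_def using t0 by (auto intro!: derivative_eq_intros du)
      have s: "b * slope c t + t / 2 - (b - 1) / t = - (b * c / t ^ 3)" for c
        using b t0 by (simp add: slope_def field_simps)
      have "b * slope (- \<gamma>) t \<le> b * p t" "b * p t \<le> b * slope \<gamma> t"
        using trap[OF t] b by (auto intro: mult_left_mono)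
      then show "b * \<gamma> / t ^ 3 \<le> b * p t + t / 2 - (b - 1) / t"
        "b * p t + t / 2 - (b - 1) / t \<le> - (b * \<gamma> / t ^ 3)"
        using s[of "- \<gamma>"] s[of \<gamma>] by simp_all
    qed
    \<comment> \<open>Integrating a Gaussian tail gains a factor 2 / |t|. So W carries the power b -
      2 instead of b - 1, and the limit of f / W is twice that of exp \<psi>.\<close>
    define W where "W = (\<lambda>t::real. exp (- t\<^sup>2 / 4) * (- t) powr (b - 2))"
    have Weq: "W t = (- t) powr (b - 2) / exp (t\<^sup>2 / 4)" for t
    proof -
      have "exp (- t\<^sup>2 / 4) = inverse (exp (t\<^sup>2 / 4))" using exp_minus[of "t\<^sup>2 / 4"] by simp
      then show ?thesis unfolding W_def by (simp only: divide_inverse mult.commute)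
    qed
    define W' where "W' = (\<lambda>t. W t * (- t / 2 + (b - 2) / t))"
    have "\<forall>\<^sub>F t::real in at_bot. - t / 2 + (b - 2) / t > 0" by real_asymp
    then obtain S where S: "\<And>t. t \<le> S \<Longrightarrow> - t / 2 + (b - 2) / t > 0"
      by (auto simp: eventually_at_bot_linorder)
    have fW: "((\<lambda>x. f x / W x) \<longlongrightarrow> exp L * 2) at_bot"
    proof (rule lhopital_at_bot[of "min S (- 1)" f g W W'])
      fix t assume t: "t \<le> min S (- 1)"
      show "(f has_real_derivative g t) (at t)" by (rule df)
      have t0: "t < 0" using t by simp
      have "((\<lambda>t. (- t) powr (b - 2)) has_real_derivative (b - 2) * (- t) powr (b - 2 - 1) * (- 1)) (at t)"
        using t0 by (auto intro!: derivative_eq_intros)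
      also have "(- t) powr (b - 2 - 1) = (- t) powr (b - 2) / (- t) powr 1" by (rule powr_diff)
      also have "(- t) powr 1 = - t" using t0 by simp
      finally have 1: "((\<lambda>t. (- t) powr (b - 2)) has_real_derivative (- t) powr (b - 2) * ((b - 2) / t)) (at t)"
        by (simp add: mult.commute)
      have 2: "((\<lambda>t::real. exp (- t\<^sup>2 / 4)) has_real_derivative exp (- t\<^sup>2 / 4) * (- t / 2)) (at t)"
        by (auto intro!: derivative_eq_intros)
      show "(W has_real_derivative W' t) (at t)"
        using DERIV_mult[OF 2 1] unfolding W_def W'_def by (simp add: algebra_simps)
      show "W' t > 0" unfolding W'_def W_def using S[of t] t t0 by simp
    next
      show "(f \<longlongrightarrow> 0) at_bot" by (rule f0)
      show "(W \<longlongrightarrow> 0) at_bot" unfolding W_def by real_asymp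
      show "((\<lambda>x. g x / W' x) \<longlongrightarrow> exp L * 2) at_bot"
      proof (rule Lim_transform_eventually)
        have "((\<lambda>t::real. (- t) / (- t / 2 + (b - 2) / t)) \<longlongrightarrow> 2) at_bot" by real_asymp
        then show "((\<lambda>t. exp (\<psi> t) * ((- t) / (- t / 2 + (b - 2) / t))) \<longlongrightarrow> exp L * 2) at_bot"
          by (intro tendsto_intros L)
        show "\<forall>\<^sub>F t in at_bot. exp (\<psi> t) * ((- t) / (- t / 2 + (b - 2) / t)) = g t / W' t"
          using eventually_le_at_bot[of "min S (- 1)"]
        proof eventually_elim
          case (elim t)
          then have t0: "t < 0" by simp
          have "exp (\<psi> t) = g t * exp (t\<^sup>2 / 4) / (- t) powr (b - 1)"
            using t0 by (simp add: \<psi>_def g_def exp_add exp_diff powr_def)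
          moreover have "(- t) powr (b - 1) = (- t) powr (b - 2) * (- t)"
          proof -
            have "(- t) powr (b - 2 + 1) = (- t) powr (b - 2) * (- t) powr 1" by (rule powr_add)
            then show ?thesis using t0 by simp
          qed
          moreover have "W t = (- t) powr (b - 2) / exp (t\<^sup>2 / 4)"
            by (rule Weq)
          moreover have "G * e / (w * m) * (m / X) = G / (w / e * X)"
            if "e \<noteq> 0" "w \<noteq> 0" "m \<noteq> 0" "X \<noteq> 0" for G e w m X :: real
            using that by simp
          from this[of "exp (t\<^sup>2 / 4)" "(- t) powr (b - 2)" "- t" "- t / 2 + (b - 2) / t" "g t"]
          have "g t * exp (t\<^sup>2 / 4) / ((- t) powr (b - 2) * (- t)) * ((- t) / (- t / 2 + (b - 2) / t))
              = g t / ((- t) powr (b - 2) / exp (t\<^sup>2 / 4) * (- t / 2 + (b - 2) / t))"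
            using t0 S[of t] elim by simp
          ultimately show ?case unfolding W'_def by (simp only:)
        qed
      qed
    qed
    have "exp (x\<^sup>2 / 4) * (- x) powr (- (b - 2)) * f x = f x / W x" for x
      by (simp only: Weq powr_minus_divide) simp
    then have "((\<lambda>x. exp (x\<^sup>2 / 4) * (- x) powr (- (b - 2)) * f x) \<longlongrightarrow> exp L * 2) at_bot" using fW by simp
    then show ?thesis by (intro exI[of _ "exp L * 2"]) simp
  qed
  then obtain C where C: "C > 0" "((\<lambda>x. exp (x\<^sup>2 / 4) * (- x) powr (- (b - 2)) * f x) \<longlongrightarrow> C) at_bot" by blast
  show ?thesis
    by (rule that[of f g h C]) (use df dg ch fpos gpos fmono Ez top C in \<open>auto simp: E_def pow\<close>)
qed

section \<open>The self-similar solution\<close>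

text \<open>All three terms of the equation scale like t^(- a/2 - 1), the gradient term because q (a
  + 1) = a + 2; the equation thus reduces to the profile equation at x$k / sqrt t. Positivity of g
  removes the absolute value from the gradient.\<close>

lemma self_similar_classical_solution:
  fixes f g h :: "real \<Rightarrow> real" and q :: real and k :: "'n::finite"
  assumes q: "q > 1"
    and df: "\<And>x. (f has_real_derivative g x) (at x)"
    and dg: "\<And>x. (g has_real_derivative h x) (at x)"
    and ch: "continuous_on UNIV h" and gpos: "\<And>x. g x > 0"
    and ode: "\<And>x. h x + x / 2 * g x + a / 2 * f x - g x powr q = 0"
    and a: "a = (2 - q) / (q - 1)"
  shows "classical_solution q (UNIV \<times> {0<..})
    (\<lambda>(x :: real^'n, t). t powr (- a / 2) * f (x $ k / sqrt t))"
proof -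
  define ut where "ut = (\<lambda>(x :: real^'n, t). t powr (- a / 2 - 1) *
    (- (a / 2) * f (x $ k / sqrt t) - (x $ k / sqrt t) / 2 * g (x $ k / sqrt t)))"
  define ux where "ux = (\<lambda>i (x :: real^'n, t).
    if i = k then t powr (- a / 2 - 1 / 2) * g (x $ k / sqrt t) else 0)"
  define uxx where "uxx = (\<lambda>i j (x :: real^'n, t).
    if i = k \<and> j = k then t powr (- a / 2 - 1) * h (x $ k / sqrt t) else 0)"
  have cf: "continuous_on UNIV f" and cg: "continuous_on UNIV g"
    using df dg by (auto intro!: DERIV_continuous_on)
  let ?Q = "UNIV \<times> {0<..} :: ((real^'n) \<times> real) set"
  have cn: "continuous_on ?Q (\<lambda>z. fst z $ k / sqrt (snd z))"
    by (intro continuous_intros) auto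
  have cp: "continuous_on ?Q (\<lambda>z. snd z powr c)" for c
    by (intro continuous_intros) auto
  have cF: "continuous_on ?Q (\<lambda>z. F (fst z $ k / sqrt (snd z)))" if "continuous_on UNIV F" for F :: "real \<Rightarrow> real"
    by (rule continuous_on_compose2[OF that cn]) auto
  have pw: "t powr c / sqrt t = t powr (c - 1 / 2)" "t powr c / t = t powr (c - 1)" if "t > 0" for c t :: real
    using that by (simp_all add: powr_diff powr_half_sqrt)
  show ?thesis
    unfolding classical_solution_def
  proof (intro exI[of _ ut] exI[of _ ux] exI[of _ uxx] conjI allI impI)
    show "continuous_on ?Q (\<lambda>(x, t). t powr (- a / 2) * f (x $ k / sqrt t))"
      unfolding case_prod_beta by (intro continuous_on_mult cp cF cf)
    show "continuous_on ?Q ut"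
      unfolding ut_def case_prod_beta by (intro continuous_intros cp cF cf cg) auto
    show "continuous_on ?Q (ux i)" for i
      unfolding ux_def case_prod_beta by (cases "i = k") (auto intro!: continuous_on_mult cp cF cg)
    show "continuous_on ?Q (uxx i j)" for i j
      unfolding uxx_def case_prod_beta by (cases "i = k \<and> j = k") (auto intro!: continuous_on_mult cp cF ch)
  next
    fix x :: "real^'n" and t :: real
    assume "(x, t) \<in> ?Q"
    then have t: "t > 0" by simp
    define \<eta> where "\<eta> = x $ k / sqrt t"
    have ut_eq: "ut (x, t) = t powr (- a / 2 - 1) * (- (a / 2) * f \<eta> - \<eta> / 2 * g \<eta>)"
      by (simp only: ut_def prod.case \<eta>_def)
    have d\<eta>: "((\<lambda>s. x $ k / sqrt s) has_real_derivative - \<eta> / 2 / t) (at t)"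
    proof -
      have "((\<lambda>s. x $ k / sqrt s) has_real_derivative
          (0 * sqrt t - x $ k * (inverse (sqrt t) / 2)) / (sqrt t * sqrt t)) (at t)"
        by (rule DERIV_divide[OF DERIV_const DERIV_real_sqrt[OF t]]) (use t in simp)
      also have "(0 * sqrt t - x $ k * (inverse (sqrt t) / 2)) / (sqrt t * sqrt t) = - \<eta> / 2 / t"
        using t unfolding \<eta>_def by (simp add: inverse_eq_divide)
      finally show ?thesis .
    qed
    have "((\<lambda>s. s powr (- a / 2) * f (x $ k / sqrt s)) has_real_derivative
        (- a / 2) * t powr (- a / 2 - 1) * f \<eta> + g \<eta> * (- \<eta> / 2 / t) * t powr (- a / 2)) (at t)"
    proof -
      have "((\<lambda>s. f (x $ k / sqrt s)) has_real_derivative g (x $ k / sqrt t) * (- \<eta> / 2 / t)) (at t)"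
        by (rule DERIV_chain2[where f = f and g = "\<lambda>s. x $ k / sqrt s", OF df d\<eta>])
      from DERIV_mult[OF has_real_derivative_powr[OF t] this] show ?thesis
        by (simp only: \<eta>_def[symmetric])
    qed
    also have "(- a / 2) * t powr (- a / 2 - 1) * f \<eta> + g \<eta> * (- \<eta> / 2 / t) * t powr (- a / 2)
        = (- a / 2) * t powr (- a / 2 - 1) * f \<eta> - g \<eta> * \<eta> / 2 * (t powr (- a / 2) / t)"
      by simp
    also have "\<dots> = ut (x, t)"
      unfolding pw(2)[OF t] ut_eq by (simp add: algebra_simps)
    finally show "((\<lambda>s. case (x, s) of (x, t) \<Rightarrow> t powr (- a / 2) * f (x $ k / sqrt t)) has_real_derivative ut (x, t)) (at t)"
      by simp
    have dsp: "((\<lambda>r. F ((x + r *\<^sub>R axis i 1) $ k / sqrt t)) has_real_derivative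
        (if i = k then F' \<eta> / sqrt t else 0)) (at 0)"
      if F: "\<And>y. (F has_real_derivative F' y) (at y)" for F F' :: "real \<Rightarrow> real" and i
    proof (cases "i = k")
      case True
      have 1: "((\<lambda>r. (x $ k + r) / sqrt t) has_real_derivative 1 / sqrt t) (at 0)"
        by (rule DERIV_cdivide) (auto intro!: derivative_eq_intros)
      have "((\<lambda>r. F ((x $ k + r) / sqrt t)) has_real_derivative F' \<eta> * (1 / sqrt t)) (at 0)"
        by (rule DERIV_chain2[where f = F and g = "\<lambda>r. (x $ k + r) / sqrt t", OF _ 1])
           (use F in \<open>simp add: \<eta>_def\<close>)
      then show ?thesis using True by simp
    next
      case False
      then have "axis i (1::real) $ k = 0" by (simp add: axis_def)
      then show ?thesis using False by simp
    qed
    show "((\<lambda>r. case (x + r *\<^sub>R axis i 1, t) of (x, t) \<Rightarrow> t powr (- a / 2) * f (x $ k / sqrt t))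
        has_real_derivative ux i (x, t)) (at 0)" for i
    proof -
      have "((\<lambda>r. t powr (- a / 2) * f ((x + r *\<^sub>R axis i 1) $ k / sqrt t)) has_real_derivative
          t powr (- a / 2) * (if i = k then g \<eta> / sqrt t else 0)) (at 0)"
        by (rule DERIV_cmult[OF dsp[OF df]])
      moreover have "t powr (- a / 2) * (if i = k then g \<eta> / sqrt t else 0) = ux i (x, t)"
        using pw(1)[OF t, of "- a / 2"] by (simp add: ux_def \<eta>_def mult.commute[of "g _"] flip: times_divide_eq_left)
      ultimately show ?thesis by simp
    qed
    show "((\<lambda>r. ux i (x + r *\<^sub>R axis j 1, t)) has_real_derivative uxx i j (x, t)) (at 0)" for i j
    proof (cases "i = k")
      case True
      have "((\<lambda>r. t powr (- a / 2 - 1 / 2) * g ((x + r *\<^sub>R axis j 1) $ k / sqrt t)) has_real_derivative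
          t powr (- a / 2 - 1 / 2) * (if j = k then h \<eta> / sqrt t else 0)) (at 0)"
        by (rule DERIV_cmult[OF dsp[OF dg]])
      moreover have "t powr (- a / 2 - 1 / 2) * (if j = k then h \<eta> / sqrt t else 0) = uxx i j (x, t)"
      proof -
        have "- a / 2 - 1 / 2 - 1 / 2 = - a / 2 - 1" by simp
        with pw(1)[OF t, of "- a / 2 - 1 / 2"]
        have "t powr (- a / 2 - 1 / 2) / sqrt t = t powr (- a / 2 - 1)" by (simp only:)
        moreover have "t powr (- a / 2 - 1 / 2) * (h \<eta> / sqrt t) = t powr (- a / 2 - 1 / 2) / sqrt t * h \<eta>" by simp
        ultimately have "t powr (- a / 2 - 1 / 2) * (h \<eta> / sqrt t) = t powr (- a / 2 - 1) * h \<eta>" by (simp only:)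
        then show ?thesis using True by (simp add: uxx_def \<eta>_def)
      qed
      ultimately show ?thesis using True by (simp add: ux_def)
    qed (simp add: ux_def uxx_def)
    show "ut (x, t) - (\<Sum>i\<in>UNIV. uxx i i (x, t)) + sqrt (\<Sum>i\<in>UNIV. (ux i (x, t))\<^sup>2) powr q = 0"
    proof -
      have "(\<Sum>i\<in>UNIV. uxx i i (x, t)) = t powr (- a / 2 - 1) * h \<eta>"
        by (simp add: uxx_def \<eta>_def)
      moreover have "(\<Sum>i\<in>UNIV. (ux i (x, t))\<^sup>2) = (t powr (- a / 2 - 1 / 2) * g \<eta>)\<^sup>2"
        by (simp add: ux_def \<eta>_def if_distrib[of "\<lambda>y. y\<^sup>2"] cong: if_cong)
      then have "sqrt (\<Sum>i\<in>UNIV. (ux i (x, t))\<^sup>2) = t powr (- a / 2 - 1 / 2) * g \<eta>"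
        using gpos[of \<eta>] by (simp add: real_sqrt_abs abs_mult)
      moreover have "(t powr (- a / 2 - 1 / 2) * g \<eta>) powr q = t powr (- a / 2 - 1) * g \<eta> powr q"
      proof -
        have "(- a / 2 - 1 / 2) * q = - a / 2 - 1" using q unfolding a by (simp add: field_simps)
        then show ?thesis using gpos[of \<eta>] by (simp add: powr_mult powr_powr)
      qed
      ultimately have "ut (x, t) - (\<Sum>i\<in>UNIV. uxx i i (x, t)) + sqrt (\<Sum>i\<in>UNIV. (ux i (x, t))\<^sup>2) powr q
          = - (t powr (- a / 2 - 1)) * (h \<eta> + \<eta> / 2 * g \<eta> + a / 2 * f \<eta> - g \<eta> powr q)"
        unfolding ut_eq by (simp add: algebra_simps)
      then show ?thesis by (simp only: ode mult_zero_right)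
    qed
  qed
qed

text \<open>Monotonicity of f reduces both conditions to points at a fixed distance d from the
  hyperplane. With y = d / sqrt t, the solution there is d^(-a) times y^a f(y) or y^a f(-y), and y
  tends to infinity as t tends to 0.\<close>

lemma self_similar_initial_trace:
  fixes f :: "real \<Rightarrow> real" and a :: real and k :: "'n::finite"
  assumes fpos: "\<And>x. f x > 0" and mono: "mono f"
    and bot: "((\<lambda>y. (- y) powr a * f y) \<longlongrightarrow> 0) at_bot"
    and top: "filterlim (\<lambda>y. y powr a * f y) at_top at_top"
  shows "has_initial_trace (\<lambda>(x :: real^'n, t). t powr (- a / 2) * f (x $ k / sqrt t))
    {x. x $ k \<ge> 0} (null_measure lborel)"
proof -
  have scale: "t powr (- a / 2) = d powr (- a) * (d / sqrt t) powr a" if "t > 0" "d > 0" for t d :: real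
  proof -
    have "sqrt t powr a = t powr (a / 2)" using that by (simp add: powr_half_sqrt[symmetric] powr_powr)
    then show ?thesis using that by (simp add: powr_divide powr_minus field_simps)
  qed
  show ?thesis
    unfolding has_initial_trace_def
  proof (intro conjI allI impI ballI)
    show "closed {x :: real^'n. x $ k \<ge> 0}"
      by (intro closed_Collect_le continuous_intros)
  next
    fix \<psi> :: "real^'n \<Rightarrow> real"
    assume "continuous_on UNIV \<psi> \<and> compact (closure {x. \<psi> x \<noteq> 0}) \<and> closure {x. \<psi> x \<noteq> 0} \<subseteq> - {x. x $ k \<ge> 0}"
    \<comment> \<open>Compactness of the support keeps it at a positive distance d from the closed
      half-space, which yields a bound uniform in x.\<close>
    define S where "S = closure {x. \<psi> x \<noteq> 0}"
    have cont: "continuous_on UNIV \<psi>" and comp: "compact S" and sub: "S \<subseteq> - {x. x $ k \<ge> 0}"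
      using \<open>continuous_on UNIV \<psi> \<and> _\<close> by (auto simp: S_def)
    have supp: "\<psi> x = 0" if "x \<notin> S" for x using that closure_subset[of "{x. \<psi> x \<noteq> 0}"] by (auto simp: S_def)
    obtain d where d: "d > 0" "\<And>x. x \<in> S \<Longrightarrow> x $ k \<le> - d"
    proof (cases "S = {}")
      case True
      then show ?thesis using that[of 1] by simp
    next
      case False
      have "continuous_on S (\<lambda>x. x $ k)" by (intro continuous_intros)
      from continuous_attains_sup[OF comp False this] obtain z where "z \<in> S" "\<And>x. x \<in> S \<Longrightarrow> x $ k \<le> z $ k" by blast
      moreover have "z $ k < 0" using sub \<open>z \<in> S\<close> by auto
      ultimately show ?thesis using that[of "- (z $ k)"] by simp
    qed
    have "bounded (\<psi> ` S)"
      by (intro compact_imp_bounded compact_continuous_image comp continuous_on_subset[OF cont]) auto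
    then obtain B where B: "\<And>x. x \<in> S \<Longrightarrow> \<bar>\<psi> x\<bar> \<le> B" "B > 0"
      unfolding bounded_pos by auto
    define V where "V = (\<lambda>t. t powr (- a / 2) * f (- d / sqrt t))"
    have V0: "(V \<longlongrightarrow> 0) (at_right 0)"
    proof (rule Lim_transform_eventually)
      have "filterlim (\<lambda>t::real. - d / sqrt t) at_bot (at_right 0)" using d(1) by real_asymp
      from tendsto_mult_left[OF filterlim_compose[OF bot this], of "d powr (- a)"]
      show "((\<lambda>t. d powr (- a) * ((- (- d / sqrt t)) powr a * f (- d / sqrt t))) \<longlongrightarrow> 0) (at_right 0)" by simp
      show "\<forall>\<^sub>F t in at_right 0. d powr (- a) * ((- (- d / sqrt t)) powr a * f (- d / sqrt t)) = V t"
        using eventually_at_right_less[of 0]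
      proof eventually_elim
        case (elim t)
        have "- (- d / sqrt t) = d / sqrt t" by simp
        then show ?case by (simp only: V_def scale[OF elim d(1)] mult.assoc)
      qed
    qed
    have bound: "\<bar>\<integral>x\<in>(- {x. x $ k \<ge> 0}). (case (x, t) of (x, t) \<Rightarrow> t powr (- a / 2) * f (x $ k / sqrt t)) * \<psi> x \<partial>lborel\<bar>
        \<le> V t * B * measure lborel S" if t: "t > 0" for t
    proof -
      define F where "F = (\<lambda>x. indicator (- {x. x $ k \<ge> 0}) x *\<^sub>R (t powr (- a / 2) * f (x $ k / sqrt t) * \<psi> x))"
      have FV: "\<bar>F x\<bar> \<le> indicator S x * (V t * B)" for x
      proof (cases "x \<in> S")
        case True
        have "x $ k / sqrt t \<le> - d / sqrt t" using d(2)[OF True] t by (intro divide_right_mono) auto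
        then have "f (x $ k / sqrt t) \<le> f (- d / sqrt t)" using mono by (rule monoD[rotated])
        then have "t powr (- a / 2) * f (x $ k / sqrt t) \<le> V t"
          unfolding V_def by (intro mult_left_mono) auto
        then have "t powr (- a / 2) * f (x $ k / sqrt t) * \<bar>\<psi> x\<bar> \<le> V t * B"
          by (rule mult_mono[OF _ B(1)[OF True]]) (use fpos[of "- d / sqrt t"] in \<open>auto simp: V_def\<close>)
        moreover have "\<bar>F x\<bar> \<le> t powr (- a / 2) * f (x $ k / sqrt t) * \<bar>\<psi> x\<bar>"
          using fpos[of "x $ k / sqrt t"] by (simp add: F_def abs_mult indicator_def)
        ultimately show ?thesis using True by simp
      next
        case False
        then show ?thesis by (simp add: F_def supp)
      qed
      have "\<bar>integral\<^sup>L lborel F\<bar> \<le> V t * B * measure lborel S"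
      \<comment> \<open>A non-integrable function has integral 0 by convention, so the bound holds
        in that case too.\<close>
      proof (cases "integrable lborel F")
        case True
        have "S \<in> sets lborel" using comp by (simp add: compact_imp_closed)
        moreover have "emeasure lborel S < \<infinity>" using comp by (intro emeasure_bounded_finite compact_imp_bounded)
        ultimately have iS: "integrable lborel (\<lambda>x. indicator S x * (V t * B))"
          by (intro integrable_mult_left integrable_real_indicator)
        have "\<bar>integral\<^sup>L lborel F\<bar> \<le> (\<integral>x. \<bar>F x\<bar> \<partial>lborel)" by (rule integral_abs_bound)
        also have "\<dots> \<le> (\<integral>x. indicator S x * (V t * B) \<partial>lborel)"
          by (rule integral_mono[OF _ iS FV]) (use True in simp)
        also have "\<dots> = V t * B * measure lborel S" using \<open>S \<in> sets lborel\<close> by simp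
        finally show ?thesis .
      next
        case False
        then show ?thesis using B(2) fpos[of "- d / sqrt t"]
          by (simp add: not_integrable_integral_eq V_def)
      qed
      then show ?thesis by (simp add: set_lebesgue_integral_def F_def)
    qed
    have "((\<lambda>t. V t * B * measure lborel S) \<longlongrightarrow> 0 * B * measure lborel S) (at_right 0)"
      by (intro tendsto_intros V0)
    then have Vlim: "((\<lambda>t. V t * B * measure lborel S) \<longlongrightarrow> 0) (at_right 0)" by simp
    have "((\<lambda>t. \<integral>x\<in>(- {x. x $ k \<ge> 0}). (case (x, t) of (x, t) \<Rightarrow> t powr (- a / 2) * f (x $ k / sqrt t)) * \<psi> x \<partial>lborel)
        \<longlongrightarrow> 0) (at_right 0)"
    proof (rule Lim_null_comparison[OF _ Vlim])
      show "\<forall>\<^sub>F t in at_right 0.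
          norm (\<integral>x\<in>(- {x. x $ k \<ge> 0}). (case (x, t) of (x, t) \<Rightarrow> t powr (- a / 2) * f (x $ k / sqrt t)) * \<psi> x \<partial>lborel)
            \<le> V t * B * measure lborel S"
        using eventually_at_right_less[of 0] unfolding real_norm_def by eventually_elim (rule bound)
    qed
    moreover have "(\<integral>x\<in>(- {x. x $ k \<ge> 0}). \<psi> x \<partial>null_measure lborel) = 0"
      unfolding set_lebesgue_integral_def by (rule integral_null_measure)
    ultimately show "((\<lambda>t. \<integral>x\<in>(- {x. x $ k \<ge> 0}). (case (x, t) of (x, t) \<Rightarrow> t powr (- a / 2) * f (x $ k / sqrt t)) * \<psi> x \<partial>lborel)
        \<longlongrightarrow> (\<integral>x\<in>(- {x. x $ k \<ge> 0}). \<psi> x \<partial>null_measure lborel)) (at_right 0)"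
      by (simp only:)
  next
    fix x0 :: "real^'n" and \<epsilon> :: real
    assume x0: "x0 \<in> {x. x $ k \<ge> 0}" and \<epsilon>: "\<epsilon> > 0"
    \<comment> \<open>Moving the centre inward by \<epsilon>/2 and taking radius \<epsilon>/4 gives
      a ball inside the original one on which x$k \<ge> \<epsilon>/4, even if x0 lies on the
      boundary hyperplane.\<close>
    define x1 where "x1 = x0 + (\<epsilon> / 2) *\<^sub>R axis k 1"
    define d where "d = \<epsilon> / 4"
    have d: "d > 0" using \<epsilon> by (simp add: d_def)
    have ball: "x \<in> ball x0 \<epsilon> \<and> x $ k \<ge> d" if "x \<in> ball x1 d" for x
    proof
      have nx: "norm (x - x1) < d" using that by (simp add: dist_norm norm_minus_commute)
      have "x - x0 = (x - x1) + (\<epsilon> / 2) *\<^sub>R axis k 1" by (simp add: x1_def)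
      then have "norm (x - x0) \<le> norm (x - x1) + norm ((\<epsilon> / 2) *\<^sub>R axis k (1::real) :: real^'n)"
        by (metis norm_triangle_ineq)
      also have "norm ((\<epsilon> / 2) *\<^sub>R axis k (1::real) :: real^'n) = \<epsilon> / 2" using \<epsilon> by simp
      finally show "x \<in> ball x0 \<epsilon>" using nx \<epsilon> by (simp add: dist_norm norm_minus_commute d_def)
      have "\<bar>(x - x1) $ k\<bar> < d" using component_le_norm_cart[of "x - x1" k] nx by linarith
      moreover have "(x - x1) $ k = x $ k - x0 $ k - \<epsilon> / 2" by (simp add: x1_def)
      moreover have "x0 $ k \<ge> 0" using x0 by simp
      ultimately show "x $ k \<ge> d" unfolding d_def by linarith
    qed
    define V where "V = (\<lambda>t. t powr (- a / 2) * f (d / sqrt t))"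
    have Vtop: "filterlim V at_top (at_right 0)"
    proof -
      have "filterlim (\<lambda>t::real. d / sqrt t) at_top (at_right 0)" using d by real_asymp
      from filterlim_tendsto_pos_mult_at_top[OF tendsto_const[of "d powr (- a)"] _ filterlim_compose[OF top this]]
      have "filterlim (\<lambda>t. d powr (- a) * ((d / sqrt t) powr a * f (d / sqrt t))) at_top (at_right 0)" using d by simp
      then show ?thesis
      proof (rule filterlim_mono_eventually[OF _ order_refl order_refl])
        show "\<forall>\<^sub>F t in at_right 0. d powr (- a) * ((d / sqrt t) powr a * f (d / sqrt t)) = V t"
          using eventually_at_right_less[of 0]
          by eventually_elim (simp only: V_def scale[OF _ d] mult.assoc)
      qed
    qed
    define m where "m = measure lborel (ball x1 d)"
    have m: "m > 0" unfolding m_def using content_ball_pos[OF d, of x1] by simp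
    have em: "emeasure lborel (ball x1 d) = ennreal m"
      unfolding m_def using emeasure_lborel_ball_finite[of x1 d] by (intro emeasure_eq_ennreal_measure) auto
    have low: "ennreal (V t * m) \<le> (\<integral>\<^sup>+x\<in>ball x0 \<epsilon>. ennreal (case (x, t) of (x, t) \<Rightarrow> t powr (- a / 2) * f (x $ k / sqrt t)) \<partial>lborel)"
      if t: "t > 0" for t
    proof -
      have "ennreal (V t * m) = (\<integral>\<^sup>+x. ennreal (V t) * indicator (ball x1 d) x \<partial>lborel)"
        using fpos[of "d / sqrt t"] m by (simp add: nn_integral_cmult_indicator em ennreal_mult V_def)
      also have "\<dots> \<le> (\<integral>\<^sup>+x. ennreal (t powr (- a / 2) * f (x $ k / sqrt t)) * indicator (ball x0 \<epsilon>) x \<partial>lborel)"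
      proof (rule nn_integral_mono)
        fix x :: "real^'n"
        show "ennreal (V t) * indicator (ball x1 d) x \<le> ennreal (t powr (- a / 2) * f (x $ k / sqrt t)) * indicator (ball x0 \<epsilon>) x"
        proof (cases "x \<in> ball x1 d")
          case True
          from ball[OF this] have x: "x \<in> ball x0 \<epsilon>" "x $ k \<ge> d" by auto
          have "d / sqrt t \<le> x $ k / sqrt t" using x(2) t by (intro divide_right_mono) auto
          then have "V t \<le> t powr (- a / 2) * f (x $ k / sqrt t)"
            unfolding V_def using mono by (intro mult_left_mono) (auto dest: monoD)
          then show ?thesis using True x(1) by (simp add: ennreal_leI)
        qed simp
      qed
      finally show ?thesis by simp
    qed
    have "filterlim (\<lambda>t. V t * m) at_top (at_right 0)"
      using filterlim_tendsto_pos_mult_at_top[OF tendsto_const[of m] m Vtop] by (simp add: mult.commute)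
    then have lim: "((\<lambda>t. ennreal (V t * m)) \<longlongrightarrow> \<infinity>) (at_right 0)"
      by (simp add: ennreal_tendsto_top_eq_at_top)
    show "((\<lambda>t. \<integral>\<^sup>+x\<in>ball x0 \<epsilon>. ennreal (case (x, t) of (x, t) \<Rightarrow> t powr (- a / 2) * f (x $ k / sqrt t)) \<partial>lborel)
        \<longlongrightarrow> \<infinity>) (at_right 0)"
    proof (rule tendsto_sandwich[OF _ _ lim tendsto_const])
      show "\<forall>\<^sub>F t in at_right 0. ennreal (V t * m) \<le>
          (\<integral>\<^sup>+x\<in>ball x0 \<epsilon>. ennreal (case (x, t) of (x, t) \<Rightarrow> t powr (- a / 2) * f (x $ k / sqrt t)) \<partial>lborel)"
        using eventually_at_right_less[of 0] by eventually_elim (rule low)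
    qed simp
  qed
qed

text \<open>The profile for b = 1/(q - 1) supplies f, and the remaining claims restate its two
  limits in the variable x$k / sqrt t. Each asymptotic equivalence is expressed as a ratio tending
  to 1; the coordinate \<open>k\<close> takes the role of x_1.\<close>

theorem theorem1p3:
  fixes q :: real and k :: "'n::finite"
  assumes "q > 1"
  defines "q' \<equiv> q / (q - 1)"
      and "a \<equiv> (2 - q) / (q - 1)"
      and "c \<equiv> (q / (q - 1)) powr (- (q / (q - 1))) * (1 / (q - 1)) powr (1 / (q - 1))"
  shows "\<exists>f :: real \<Rightarrow> real. \<exists>C > 0.
    C2_real f \<and> (\<forall>\<eta>. f \<eta> > 0) \<and>
    (let U = (\<lambda>(x :: real^'n, t). t powr (- a / 2) * f (x $ k / sqrt t)) in
       classical_solution q (UNIV \<times> {0<..}) U \<and>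
       (\<forall>x t. t > 0 \<longrightarrow> U (x, t) > 0) \<and>
       has_initial_trace U {x. x $ k \<ge> 0} (null_measure lborel) \<and>
       (\<forall>x. x $ k > 0 \<longrightarrow>
          ((\<lambda>t. U (x, t) / (c * (x $ k) powr q' * t powr (- 1 / (q - 1)))) \<longlongrightarrow> 1) (at_right 0)) \<and>
       (\<forall>x t. x $ k = 0 \<and> t > 0 \<longrightarrow> U (x, t) = f 0 * t powr (- a / 2)) \<and>
       (\<forall>x t. t > 0 \<longrightarrow>
          ((\<lambda>s. U (\<chi> i. if i = k then s else x $ i, t) / (c * t powr (- 1 / (q - 1)) * s powr q'))
             \<longlongrightarrow> 1) at_top)) \<and>
    ((\<lambda>\<eta>. \<eta> powr (- q') * f \<eta>) \<longlongrightarrow> c) at_top \<and>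
    ((\<lambda>\<eta>. exp (\<eta>\<^sup>2 / 4) * (- \<eta>) powr (- ((3 - 2 * q) / (q - 1))) * f \<eta>) \<longlongrightarrow> C) at_bot"
proof -
  define b where "b = 1 / (q - 1)"
  have b: "b > 0" using assms(1) by (simp add: b_def)
  have qb: "1 + 1 / b = q" "q' = b + 1" "a = b - 1" "(3 - 2 * q) / (q - 1) = b - 2" "- 1 / (q - 1) = - b"
    using assms(1) by (auto simp: b_def q'_def a_def field_simps)
  have c: "c = (b + 1) powr (- (b + 1)) * b powr b"
    unfolding c_def using qb(2) unfolding q'_def by (simp only: b_def)
  have cpos: "c > 0" unfolding c using b by simp
  obtain f g h C where df: "\<And>x. (f has_real_derivative g x) (at x)"
    and dg: "\<And>x. (g has_real_derivative h x) (at x)" and ch: "continuous_on UNIV h"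
    and fpos: "\<And>x. f x > 0" and gpos: "\<And>x. g x > 0" and fm: "strict_mono f"
    and ode: "\<And>x. h x + x / 2 * g x + (b - 1) / 2 * f x - g x powr (1 + 1 / b) = 0"
    and top: "((\<lambda>x. x powr (- (b + 1)) * f x) \<longlongrightarrow> (b + 1) powr (- (b + 1)) * b powr b) at_top"
    and C: "C > 0" and bot: "((\<lambda>x. exp (x\<^sup>2 / 4) * (- x) powr (- (b - 2)) * f x) \<longlongrightarrow> C) at_bot"
    by (rule similarity_profile[OF b]) (rule that; assumption)
  define U where "U = (\<lambda>(x :: real^'n, t). t powr (- a / 2) * f (x $ k / sqrt t))"
  have cs: "classical_solution q (UNIV \<times> {0<..}) U"
    unfolding U_def
    by (rule self_similar_classical_solution[OF assms(1) df dg ch gpos])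
       (use ode qb in \<open>auto simp: a_def\<close>)
  have tr: "has_initial_trace U {x. x $ k \<ge> 0} (null_measure lborel)"
    unfolding U_def
  proof (rule self_similar_initial_trace[OF fpos])
    show "mono f" using fm by (rule strict_mono_mono)
    \<comment> \<open>The tail limit leaves a factor exp (- y^2/4), which beats every power.\<close>
    show "((\<lambda>y. (- y) powr a * f y) \<longlongrightarrow> 0) at_bot"
    proof (rule Lim_transform_eventually)
      have "((\<lambda>y::real. exp (- y\<^sup>2 / 4) * (- y) powr (a + (b - 2))) \<longlongrightarrow> 0) at_bot" by real_asymp
      from tendsto_mult[OF this bot]
      show "((\<lambda>y. exp (- y\<^sup>2 / 4) * (- y) powr (a + (b - 2)) * (exp (y\<^sup>2 / 4) * (- y) powr (- (b - 2)) * f y)) \<longlongrightarrow> 0) at_bot"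
        by simp
      show "\<forall>\<^sub>F y in at_bot. exp (- y\<^sup>2 / 4) * (- y) powr (a + (b - 2)) * (exp (y\<^sup>2 / 4) * (- y) powr (- (b - 2)) * f y)
          = (- y) powr a * f y"
        using eventually_le_at_bot[of "-1"]
      proof eventually_elim
        case (elim y)
        have 1: "exp (- y\<^sup>2 / 4) * exp (y\<^sup>2 / 4) = 1" by (simp add: exp_add[symmetric])
        have 2: "(- y) powr (a + (b - 2)) * (- y) powr (- (b - 2)) = (- y) powr a"
          by (simp add: powr_add[symmetric])
        have "exp (- y\<^sup>2 / 4) * (- y) powr (a + (b - 2)) * (exp (y\<^sup>2 / 4) * (- y) powr (- (b - 2)) * f y)
          = (exp (- y\<^sup>2 / 4) * exp (y\<^sup>2 / 4)) * ((- y) powr (a + (b - 2)) * (- y) powr (- (b - 2))) * f y"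
          by (simp only: mult_ac)
        then show ?case unfolding 1 2 by simp
      qed
    qed
    \<comment> \<open>The growth exponent is a + b + 1 = 2 b > 0. So the trace is infinite for every
      q > 1, although for q > 2 the values on the hyperplane itself tend to 0.\<close>
    show "filterlim (\<lambda>y. y powr a * f y) at_top at_top"
    proof -
      have "filterlim (\<lambda>y::real. y powr (a + (b + 1))) at_top at_top"
        using b qb(3) by real_asymp
      from filterlim_tendsto_pos_mult_at_top[OF top _ this]
      have "filterlim (\<lambda>y. y powr (- (b + 1)) * f y * y powr (a + (b + 1))) at_top at_top"
        using cpos c by simp
      then show ?thesis
      proof (rule filterlim_mono_eventually[OF _ order_refl order_refl])
        show "\<forall>\<^sub>F y in at_top. y powr (- (b + 1)) * f y * y powr (a + (b + 1)) = y powr a * f y"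
        proof (rule always_eventually, rule allI)
          fix y :: real
          have "y powr (a + (b + 1)) * y powr (- (b + 1)) = y powr a"
            by (simp add: powr_add[symmetric])
          then show "y powr (- (b + 1)) * f y * y powr (a + (b + 1)) = y powr a * f y"
            by (simp only: mult_ac)
        qed
      qed
    qed
  qed
  \<comment> \<open>The quotient depends on s and t only through s / sqrt t, so the limit t to 0 at
    a fixed point and the limit s to infinity at fixed t are both instances of the single limit
    \<open>lim1\<close>.\<close>
  have ratio: "t powr (- a / 2) * f (s / sqrt t) / (c * (s powr q' * t powr (- 1 / (q - 1))))
      = (s / sqrt t) powr (- (b + 1)) * f (s / sqrt t) / c" if "s > 0" "t > 0" for s t :: real
  proof -
    have "sqrt t powr (b + 1) = t powr ((b + 1) / 2)" using that by (simp add: powr_half_sqrt[symmetric] powr_powr)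
    then have "(s / sqrt t) powr (- (b + 1)) = t powr ((b + 1) / 2) / s powr (b + 1)"
      using that by (simp only: powr_minus_divide powr_divide) simp
    moreover have "t powr (- a / 2) / t powr (- b) = t powr ((b + 1) / 2)"
    proof -
      have "- a / 2 - - b = (b + 1) / 2" using qb(3) by (simp add: field_simps)
      then show ?thesis by (simp only: powr_diff[symmetric])
    qed
    ultimately show ?thesis
      unfolding qb(2) qb(5) by (metis (no_types, lifting) divide_divide_eq_left mult.commute times_divide_eq_right)
  qed
  have lim1: "((\<lambda>y. y powr (- (b + 1)) * f y / c) \<longlongrightarrow> 1) at_top"
    using tendsto_divide[OF top[folded c] tendsto_const[of c]] cpos by simp
  have l1: "((\<lambda>t. U (x, t) / (c * (x $ k) powr q' * t powr (- 1 / (q - 1)))) \<longlongrightarrow> 1) (at_right 0)"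
    if x: "x $ k > 0" for x :: "real^'n"
  proof (rule Lim_transform_eventually)
    have "filterlim (\<lambda>t. x $ k / sqrt t) at_top (at_right 0)" using x by real_asymp
    from filterlim_compose[OF lim1 this]
    show "((\<lambda>t. (x $ k / sqrt t) powr (- (b + 1)) * f (x $ k / sqrt t) / c) \<longlongrightarrow> 1) (at_right 0)" .
    show "\<forall>\<^sub>F t in at_right 0. (x $ k / sqrt t) powr (- (b + 1)) * f (x $ k / sqrt t) / c
        = U (x, t) / (c * (x $ k) powr q' * t powr (- 1 / (q - 1)))"
      using eventually_at_right_less[of 0]
    proof eventually_elim
      case (elim t)
      then show ?case using ratio[OF x elim] by (simp add: U_def mult.assoc)
    qed
  qed
  have l2: "((\<lambda>s. U (\<chi> i. if i = k then s else x $ i, t) / (c * t powr (- 1 / (q - 1)) * s powr q')) \<longlongrightarrow> 1) at_top"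
    if t: "t > 0" for x :: "real^'n" and t
  proof (rule Lim_transform_eventually)
    have "filterlim (\<lambda>s. s / sqrt t) at_top at_top" using t by real_asymp
    from filterlim_compose[OF lim1 this]
    show "((\<lambda>s. (s / sqrt t) powr (- (b + 1)) * f (s / sqrt t) / c) \<longlongrightarrow> 1) at_top" .
    show "\<forall>\<^sub>F s in at_top. (s / sqrt t) powr (- (b + 1)) * f (s / sqrt t) / c
        = U (\<chi> i. if i = k then s else x $ i, t) / (c * t powr (- 1 / (q - 1)) * s powr q')"
      using eventually_gt_at_top[of 0]
    proof eventually_elim
      case (elim s)
      then show ?case using ratio[OF elim t] by (simp add: U_def mult.assoc mult.commute[of "s powr q'"])
    qed
  qed
  show ?thesis
  proof (intro exI[of _ f] exI[of _ C] conjI C)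
    show "C2_real f" unfolding C2_real_def using df dg ch by blast
    show "\<forall>\<eta>. f \<eta> > 0" using fpos by blast
    have Upos: "\<forall>x t. t > 0 \<longrightarrow> U (x, t) > 0" using fpos by (simp add: U_def)
    have U0: "\<forall>x t. x $ k = 0 \<and> t > 0 \<longrightarrow> U (x, t) = f 0 * t powr (- a / 2)" by (simp add: U_def)
    show "let U = (\<lambda>(x :: real^'n, t). t powr (- a / 2) * f (x $ k / sqrt t)) in
       classical_solution q (UNIV \<times> {0<..}) U \<and>
       (\<forall>x t. t > 0 \<longrightarrow> U (x, t) > 0) \<and>
       has_initial_trace U {x. x $ k \<ge> 0} (null_measure lborel) \<and>
       (\<forall>x. x $ k > 0 \<longrightarrow>
          ((\<lambda>t. U (x, t) / (c * (x $ k) powr q' * t powr (- 1 / (q - 1)))) \<longlongrightarrow> 1) (at_right 0)) \<and>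
       (\<forall>x t. x $ k = 0 \<and> t > 0 \<longrightarrow> U (x, t) = f 0 * t powr (- a / 2)) \<and>
       (\<forall>x t. t > 0 \<longrightarrow>
          ((\<lambda>s. U (\<chi> i. if i = k then s else x $ i, t) / (c * t powr (- 1 / (q - 1)) * s powr q'))
             \<longlongrightarrow> 1) at_top)"
      unfolding Let_def U_def[symmetric] using cs tr l1 l2 Upos U0 by blast
    show "((\<lambda>\<eta>. \<eta> powr (- q') * f \<eta>) \<longlongrightarrow> c) at_top" using top unfolding qb(2) c .
    show "((\<lambda>\<eta>. exp (\<eta>\<^sup>2 / 4) * (- \<eta>) powr (- ((3 - 2 * q) / (q - 1))) * f \<eta>) \<longlongrightarrow> C) at_bot"
      using bot unfolding qb(4) .
  qed
qed

end
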